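(* Let $\zeta\in\{0,1,2\}$ and $(\mu_1,\mu_2)\in\mathcal{A}$, where $\mathcal{A}=\mathcal{A}_\zeta^{-}$ (resp. $\mathcal{A}=\mathcal{A}_\zeta^{+}$). Then $H^{\mathrm{s}}_{\mu_1\mu_2}(0)$ has exactly $\zeta$ eigenvalues, counted with multiplicity, lying below (resp. above) the essential spectrum $\sigma_{\mathrm{ess}}(H_{\mu_1\mu_2}(0))=[0,24]$. For any such eigenvalue $z=z(\mu_1,\mu_2)$, an eigenfunction can be chosen as $$f^{\mathrm{s}}_{\mu_1\mu_2}(p)=C\left(\mu_1\mu_2\,a^{\mathrm{s}}_{12}(z)\frac{\alpha^{\mathrm{s}}_1(p)}{\mathcal{E}_0(p)-z}-\mu_2\bigl(1+\mu_1a^{\mathrm{s}}_{11}(z)\bigr)\frac{\alpha^{\mathrm{s}}_2(p)}{\mathcal{E}_0(p)-z}\right),$$ where $C\neq0$ is a normalization constant.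
   Context: $\mathbb{T}^3=(\mathbb{R}/2\pi\mathbb{Z})^3$; $L^{2,\mathrm{e}}(\mathbb{T}^3)$ is the Hilbert space of even functions in $L^2(\mathbb{T}^3)$, and $L^{2,\mathrm{e,s}}(\mathbb{T}^3)$ its subspace of functions symmetric under all permutations of $(p_1,p_2,p_3)$. For $\mu_1,\mu_2\in\mathbb{R}$, $H_{\mu_1\mu_2}(0)=H_0(0)+V_{\mu_1\mu_2}$ on $L^{2,\mathrm{e}}(\mathbb{T}^3)$, where $(H_0(0)f)(p)=\mathcal{E}_0(p)f(p)$, $\mathcal{E}_0(p)=4\sum_{i=1}^3(1-\cos p_i)$, and $$(V_{\mu_1\mu_2}f)(p)=\frac{\mu_1}{(2\pi)^3}\int_{\mathbb{T}^3}f(q)\,dq+\frac{2\mu_2}{(2\pi)^3}\sum_{i=1}^3\cos p_i\int_{\mathbb{T}^3}\cos q_i\,f(q)\,dq.$$ $H^{\mathrm{s}}_{\mu_1\mu_2}(0)$ is the restriction of $H_{\mu_1\mu_2}(0)$ to the reducing subspace $L^{2,\mathrm{e,s}}(\mathbb{T}^3)$; equivalently $H^{\mathrm{s}}_{\mu_1\mu_2}(0)=H_0(0)+\mu_1(\cdot,\alpha^{\mathrm{s}}_1)\alpha^{\mathrm{s}}_1+\mu_2(\cdot,\alpha^{\mathrm{s}}_2)\alpha^{\mathrm{s}}_2$ with $\alpha^{\mathrm{s}}_1(p)=\frac{1}{\sqrt{8\pi^3}}$, $\alpha^{\mathrm{s}}_2(p)=\frac{\cos p_1+\cos p_2+\cos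 p_3}{\sqrt{12\pi^3}}$. For $z\in\mathbb{R}\setminus(0,24)$, $a^{\mathrm{s}}_{ij}(z)=\int_{\mathbb{T}^3}\frac{\alpha^{\mathrm{s}}_i(p)\alpha^{\mathrm{s}}_j(p)}{\mathcal{E}_0(p)-z}\,dp$. Put $\mu_0=\frac{24\,a^{\mathrm{s}}_{11}(0)}{12\,a^{\mathrm{s}}_{11}(0)-1}$ (where $12a^{\mathrm{s}}_{11}(0)-1>0$), $\mu_2^{-}(\mu_1)=\frac{24}{\mu_1+12}-\mu_0$ for $\mu_1\ne-12$, $\mu_2^{+}(\mu_1)=\frac{24}{\mu_1-12}+\mu_0$ for $\mu_1\neq12$. Regions in the $(\mu_1,\mu_2)$-plane: $\mathcal{A}_0^{-}=\{\mu_1>-12,\ \mu_2>\mu_2^{-}(\mu_1)\}$; $\mathcal{A}_1^{-}=\{\mu_1>-12,\ \mu_2<\mu_2^{-}(\mu_1)\}\cup\{\mu_1<-12,\ \mu_2>\mu_2^{-}(\mu_1)\}\cup\{(-12,\mu_2):\mu_2\in\mathbb{R}\}$; $\mathcal{A}_2^{-}=\{\mu_1<-12,\ \mu_2<\mu_2^{-}(\mu_1)\}$; $\mathcal{A}_0^{+}=\{\mu_1<12,\ \mu_2<\mu_2^{+}(\mu_1)\}$; $\mathcal{A}_1^{+}=\{\mu_1<12,\ \mu_2>\mu_2^{+}(\mu_1)\}\cup\{\mu_1>12,\ \mu_2<\mu_2^{+}(\mu_1)\}\cup\{(12,\mu_2):\mu_2\in\mathbb{R}\}$; $\mathcal{A}_2^{+}=\{\mu_1>12,\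 \mu_2>\mu_2^{+}(\mu_1)\}$.
   Formalization: The eigenfunction formula is asserted for μ₂ ≠ 0 only, since it vanishes identically at μ₂ = 0 (e.g. μ₁ = −12, μ₂ = 0 in A₁⁻); for μ₂ = 0 the common factor μ₂ is cancelled and the eigenfunction is Cα₁ˢ(p)/(E₀(p)−z). *)

theory Defs
  imports "HOL-Analysis.Analysis" "HOL-Library.Extended_Nat"
begin

section \<open>The Hilbert spaces\<close>

text \<open>The torus is represented by its fundamental cube \<open>[-\<pi>, \<pi>]\<^sup>3\<close>, whose opposite faces differ
  only by null sets. The cube is stable under \<open>p \<mapsto> -p\<close> and under permutations of the coordinates.
  Elements of \<open>L\<^sup>2\<close> are represented by functions, and equality in \<open>L\<^sup>2\<close> is equality almost
  everywhere; values outside the cube are irrelevant.\<close>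

definition torus3 :: "(real^3) measure" where
  "torus3 = restrict_space lborel (cbox (\<chi> i. - pi) (\<chi> i. pi))"

definition L2 :: "(real^3 \<Rightarrow> complex) set" where
  "L2 = {f \<in> borel_measurable torus3. integrable torus3 (\<lambda>p. (cmod (f p))\<^sup>2)}"

definition L2_norm :: "(real^3 \<Rightarrow> complex) \<Rightarrow> real" where
  "L2_norm f = sqrt (LINT p|torus3. (cmod (f p))\<^sup>2)"

definition L2e :: "(real^3 \<Rightarrow> complex) set" where
  "L2e = {f \<in> L2. AE p in torus3. f (- p) = f p}"

definition L2es :: "(real^3 \<Rightarrow> complex) set" where
  "L2es = {f \<in> L2e. \<forall>\<pi>. \<pi> permutes (UNIV :: 3 set) \<longrightarrow>
             (AE p in torus3. f (\<chi> i. p $ \<pi> i) = f p)}"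

section \<open>Spectral notions\<close>

text \<open>Below, \<open>X\<close> is a closed subspace of \<open>L\<^sup>2\<close> and \<open>T\<close> is a bounded operator mapping \<open>X\<close> into
  itself; the restriction of \<open>T\<close> to a reducing subspace is expressed by changing \<open>X\<close>.\<close>

definition eigenspace ::
  "((real^3 \<Rightarrow> complex) \<Rightarrow> (real^3 \<Rightarrow> complex)) \<Rightarrow> (real^3 \<Rightarrow> complex) set \<Rightarrow> complex
    \<Rightarrow> (real^3 \<Rightarrow> complex) set" where
  "eigenspace T X z = {f \<in> X. AE p in torus3. T f p = z * f p}"

definition is_eigenfunction ::
  "((real^3 \<Rightarrow> complex) \<Rightarrow> (real^3 \<Rightarrow> complex)) \<Rightarrow> (real^3 \<Rightarrow> complex) set \<Rightarrow> complex
    \<Rightarrow> (real^3 \<Rightarrow> complex) \<Rightarrow> bool" where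
  "is_eigenfunction T X z f \<longleftrightarrow> f \<in> eigenspace T X z \<and> \<not> (AE p in torus3. f p = 0)"

definition is_eigenvalue ::
  "((real^3 \<Rightarrow> complex) \<Rightarrow> (real^3 \<Rightarrow> complex)) \<Rightarrow> (real^3 \<Rightarrow> complex) set \<Rightarrow> complex \<Rightarrow> bool" where
  "is_eigenvalue T X z \<longleftrightarrow> (\<exists>f. is_eigenfunction T X z f)"

definition AE_independent :: "nat \<Rightarrow> (nat \<Rightarrow> real^3 \<Rightarrow> complex) \<Rightarrow> bool" where
  "AE_independent n b \<longleftrightarrow>
     (\<forall>c :: nat \<Rightarrow> complex. (AE p in torus3. (\<Sum>i<n. c i * b i p) = 0) \<longrightarrow> (\<forall>i<n. c i = 0))"

text \<open>Complex dimension of a linear space of functions modulo null functions.\<close>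

definition AE_dim :: "(real^3 \<Rightarrow> complex) set \<Rightarrow> enat" where
  "AE_dim X = (SUP n \<in> {n. \<exists>b. (\<forall>i<n. b i \<in> X) \<and> AE_independent n b}. enat n)"

definition multiplicity_of ::
  "((real^3 \<Rightarrow> complex) \<Rightarrow> (real^3 \<Rightarrow> complex)) \<Rightarrow> (real^3 \<Rightarrow> complex) set \<Rightarrow> complex \<Rightarrow> enat" where
  "multiplicity_of T X z = AE_dim (eigenspace T X z)"

text \<open>The lower bound gives both injectivity of \<open>T - z\<close> modulo null functions and boundedness of
  the inverse.\<close>

definition resolvent_set ::
  "((real^3 \<Rightarrow> complex) \<Rightarrow> (real^3 \<Rightarrow> complex)) \<Rightarrow> (real^3 \<Rightarrow> complex) set \<Rightarrow> complex set" where
  "resolvent_set T X = {z.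
     (\<forall>g\<in>X. \<exists>f\<in>X. AE p in torus3. T f p - z * f p = g p) \<and>
     (\<exists>K. \<forall>f\<in>X. L2_norm f \<le> K * L2_norm (\<lambda>p. T f p - z * f p))}"

definition spectrum_of ::
  "((real^3 \<Rightarrow> complex) \<Rightarrow> (real^3 \<Rightarrow> complex)) \<Rightarrow> (real^3 \<Rightarrow> complex) set \<Rightarrow> complex set" where
  "spectrum_of T X = - resolvent_set T X"

definition discrete_spectrum ::
  "((real^3 \<Rightarrow> complex) \<Rightarrow> (real^3 \<Rightarrow> complex)) \<Rightarrow> (real^3 \<Rightarrow> complex) set \<Rightarrow> complex set" where
  "discrete_spectrum T X = {z. z isolated_in spectrum_of T X \<and> is_eigenvalue T X z \<and>
     multiplicity_of T X z < \<infinity>}"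

definition essential_spectrum ::
  "((real^3 \<Rightarrow> complex) \<Rightarrow> (real^3 \<Rightarrow> complex)) \<Rightarrow> (real^3 \<Rightarrow> complex) set \<Rightarrow> complex set" where
  "essential_spectrum T X = spectrum_of T X - discrete_spectrum T X"

section \<open>The operators\<close>

definition E0 :: "real^3 \<Rightarrow> real" where
  "E0 p = 4 * (\<Sum>i\<in>UNIV. 1 - cos (p $ i))"

definition V_op :: "real \<Rightarrow> real \<Rightarrow> (real^3 \<Rightarrow> complex) \<Rightarrow> real^3 \<Rightarrow> complex" where
  "V_op \<mu>1 \<mu>2 f p =
     complex_of_real (\<mu>1 / (2 * pi) ^ 3) * (LINT q|torus3. f q)
     + complex_of_real (2 * \<mu>2 / (2 * pi) ^ 3) *
       (\<Sum>i\<in>UNIV. complex_of_real (cos (p $ i)) * (LINT q|torus3. complex_of_real (cos (q $ i)) * f q))"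

definition H_op :: "real \<Rightarrow> real \<Rightarrow> (real^3 \<Rightarrow> complex) \<Rightarrow> real^3 \<Rightarrow> complex" where
  "H_op \<mu>1 \<mu>2 f p = complex_of_real (E0 p) * f p + V_op \<mu>1 \<mu>2 f p"

definition alpha_s :: "nat \<Rightarrow> real^3 \<Rightarrow> real" where
  "alpha_s i p =
     (if i = 1 then 1 / sqrt (8 * pi ^ 3)
      else (cos (p $ 1) + cos (p $ 2) + cos (p $ 3)) / sqrt (12 * pi ^ 3))"

definition a_s :: "nat \<Rightarrow> nat \<Rightarrow> real \<Rightarrow> real" where
  "a_s i j z = (LINT p|torus3. alpha_s i p * alpha_s j p / (E0 p - z))"

text \<open>Real eigenvalues of the restriction of \<open>H\<close> to \<open>L2es\<close> that lie below, respectively above, the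
  essential spectrum of \<open>H\<close> on \<open>L2e\<close>.\<close>

definition eigs_below :: "real \<Rightarrow> real \<Rightarrow> real set" where
  "eigs_below \<mu>1 \<mu>2 = {z. is_eigenvalue (H_op \<mu>1 \<mu>2) L2es (complex_of_real z) \<and>
     (\<forall>w\<in>essential_spectrum (H_op \<mu>1 \<mu>2) L2e. z < Re w)}"

definition eigs_above :: "real \<Rightarrow> real \<Rightarrow> real set" where
  "eigs_above \<mu>1 \<mu>2 = {z. is_eigenvalue (H_op \<mu>1 \<mu>2) L2es (complex_of_real z) \<and>
     (\<forall>w\<in>essential_spectrum (H_op \<mu>1 \<mu>2) L2e. Re w < z)}"

text \<open>This has the overall factor \<open>\<mu>2\<close>, hence vanishes identically for \<open>\<mu>2 = 0\<close>. In that case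
  \<open>1 + \<mu>1 * a_s 1 1 z = 0\<close> at an eigenvalue, and cancelling \<open>\<mu>2\<close> leaves a multiple of
  \<open>alpha_s 1 p / (E0 p - z)\<close>.\<close>

definition f_s :: "complex \<Rightarrow> real \<Rightarrow> real \<Rightarrow> real \<Rightarrow> real^3 \<Rightarrow> complex" where
  "f_s C \<mu>1 \<mu>2 z p = C * complex_of_real
     (\<mu>1 * \<mu>2 * a_s 1 2 z * (alpha_s 1 p / (E0 p - z))
      - \<mu>2 * (1 + \<mu>1 * a_s 1 1 z) * (alpha_s 2 p / (E0 p - z)))"

section \<open>The regions\<close>

definition mu0 :: real where
  "mu0 = 24 * a_s 1 1 0 / (12 * a_s 1 1 0 - 1)"

definition mu2_minus :: "real \<Rightarrow> real" where
  "mu2_minus \<mu>1 = 24 / (\<mu>1 + 12) - mu0"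

definition mu2_plus :: "real \<Rightarrow> real" where
  "mu2_plus \<mu>1 = 24 / (\<mu>1 - 12) + mu0"

text \<open>Only the indices 0, 1, 2 are meaningful.\<close>

definition A_minus :: "nat \<Rightarrow> (real \<times> real) set" where
  "A_minus \<zeta> =
    (if \<zeta> = 0 then {(\<mu>1, \<mu>2). \<mu>1 > - 12 \<and> \<mu>2 > mu2_minus \<mu>1}
     else if \<zeta> = 1 then
       {(\<mu>1, \<mu>2). \<mu>1 > - 12 \<and> \<mu>2 < mu2_minus \<mu>1}
       \<union> {(\<mu>1, \<mu>2). \<mu>1 < - 12 \<and> \<mu>2 > mu2_minus \<mu>1}
       \<union> {(\<mu>1, \<mu>2). \<mu>1 = - 12}
     else if \<zeta> = 2 then {(\<mu>1, \<mu>2). \<mu>1 < - 12 \<and> \<mu>2 < mu2_minus \<mu>1}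
     else {})"

definition A_plus :: "nat \<Rightarrow> (real \<times> real) set" where
  "A_plus \<zeta> =
    (if \<zeta> = 0 then {(\<mu>1, \<mu>2). \<mu>1 < 12 \<and> \<mu>2 < mu2_plus \<mu>1}
     else if \<zeta> = 1 then
       {(\<mu>1, \<mu>2). \<mu>1 < 12 \<and> \<mu>2 > mu2_plus \<mu>1}
       \<union> {(\<mu>1, \<mu>2). \<mu>1 > 12 \<and> \<mu>2 < mu2_plus \<mu>1}
       \<union> {(\<mu>1, \<mu>2). \<mu>1 = 12}
     else if \<zeta> = 2 then {(\<mu>1, \<mu>2). \<mu>1 > 12 \<and> \<mu>2 > mu2_plus \<mu>1}
     else {})"

end

theory Submission
  imports Defs "HOL-Complex_Analysis.Conformal_Mappings"
begin

text \<open>The potential has rank four, so for \<open>z\<close> off the band \<open>[0, 24]\<close> the equation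
  \<open>(H - z) f = g\<close> reduces to a \<open>4 \<times> 4\<close> Birman-Schwinger system. If its determinant is not
  zero then \<open>z\<close> is in the resolvent set; otherwise \<open>z\<close> is an eigenvalue of finite
  multiplicity, isolated because the determinant is holomorphic off the band and not identically
  zero. Every point of the band is in the spectrum: functions antisymmetric under permutations are
  annihilated by the potential, and can be concentrated on any level of \<open>E0\<close>. On symmetric
  functions the system is \<open>2 \<times> 2\<close> and its kernel is at most one-dimensional. All integrals in it
  are expressed by \<open>a = a_s 1 1 z\<close>, and with \<open>w = 12 - z\<close> the determinant is
  \<open>1 + \<mu>1 a + \<mu>2 (w a - 1) (w + \<mu>1) / 24\<close>. For \<open>w > 12\<close> it vanishes iff \<open>w \<noteq> - \<mu>1\<close> and
  \<open>\<mu>2 = 24 / (w + \<mu>1) - 24 / (w - 1 / a)\<close>. The right-hand side is strictly decreasing on each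
  side of the pole \<open>w = - \<mu>1\<close>, since \<open>w - 1 / a\<close> is decreasing, and its value at \<open>w = 12\<close> is
  \<open>mu2_minus \<mu>1\<close>, so the number of roots can be read off the region of \<open>(\<mu>1, \<mu>2)\<close>. The shift
  of the torus by \<open>(\<pi>, \<pi>, \<pi>)\<close> flips the sign of the sum of the cosines and thereby exchanges
  the two sides of the band together with the signs of \<open>\<mu>1\<close> and \<open>\<mu>2\<close>.\<close>

section \<open>Integration over the torus\<close>

definition csum :: "real^3 \<Rightarrow> real" where
  "csum p = (\<Sum>i\<in>UNIV. cos (p $ i))"

lemma E0_csum: "E0 p = 12 - 4 * csum p"
  by (simp add: E0_def csum_def sum_subtractf)

lemma csum_bounds: "- 3 \<le> csum p" "csum p \<le> 3"
proof -
  have "(\<Sum>i\<in>(UNIV::3 set). - 1) \<le> csum p" "csum p \<le> (\<Sum>i\<in>(UNIV::3 set). 1)"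
    unfolding csum_def by (intro sum_mono; simp)+
  then show "- 3 \<le> csum p" "csum p \<le> 3" by simp_all
qed

lemma E0_bounds: "0 \<le> E0 p" "E0 p \<le> 24"
  using csum_bounds[of p] by (simp_all add: E0_csum)

lemma csum_uminus [simp]: "csum (- p) = csum p"
  by (simp add: csum_def)

lemma csum_permute:
  assumes "\<pi> permutes (UNIV :: 3 set)"
  shows "csum (\<chi> i. p $ \<pi> i) = csum p"
  unfolding csum_def using sum.permute[OF assms, of "\<lambda>i. cos (p $ i)"] by (simp add: comp_def)

lemma alpha_s_csum: "alpha_s 1 p = 1 / sqrt (8 * pi ^ 3)" "alpha_s 2 p = csum p / sqrt (12 * pi ^ 3)"
  by (simp_all add: alpha_s_def csum_def sum_3)

section \<open>The fundamental cube and its Lebesgue measure\<close>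

abbreviation cube3 :: "(real^3) set" where
  "cube3 \<equiv> cbox (\<chi> i. - pi) (\<chi> i. pi)"

lemma space_torus3 [simp]: "space torus3 = cube3"
  by (simp add: torus3_def space_restrict_space)

lemma mem_cube3: "p \<in> cube3 \<longleftrightarrow> (\<forall>i. - pi \<le> p $ i \<and> p $ i \<le> pi)"
  by (simp add: mem_box_cart)

lemma measurable_torus3I:
  "f \<in> borel_measurable borel \<Longrightarrow> f \<in> borel_measurable torus3"
  by (simp add: torus3_def measurable_restrict_space1)

lemma continuous_measurable_torus3:
  "continuous_on UNIV f \<Longrightarrow> f \<in> borel_measurable torus3"
  by (intro measurable_torus3I borel_measurable_continuous_onI)

lemma continuous_on_csum: "continuous_on A csum"
  unfolding csum_def by (intro continuous_intros)

lemma continuous_on_E0: "continuous_on A E0"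
  unfolding E0_csum using continuous_on_csum by (intro continuous_intros)

lemma vec_nth_measurable_torus3 [measurable]: "(\<lambda>p. p $ i) \<in> borel_measurable torus3"
  by (intro continuous_measurable_torus3 continuous_intros)

lemma csum_measurable [measurable]: "csum \<in> borel_measurable torus3"
  by (intro continuous_measurable_torus3 continuous_on_csum)

lemma E0_measurable [measurable]: "E0 \<in> borel_measurable torus3"
  by (intro continuous_measurable_torus3 continuous_on_E0)

lemma prod_Basis_vec:
  fixes x :: "real^'n"
  shows "(\<Prod>b\<in>Basis. x \<bullet> b) = (\<Prod>i\<in>UNIV. x $ i)"
proof -
  have B: "(Basis :: (real^'n) set) = range (\<lambda>i. axis i 1)"
    by (auto simp: Basis_vec_def)
  have "inj (\<lambda>i::'n. axis i (1::real))"
    by (auto simp: inj_on_def axis_eq_axis)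
  then show ?thesis
    unfolding B by (subst prod.reindex) (simp_all add: inner_axis)
qed

lemma emeasure_cube_radius:
  assumes "0 \<le> r"
  shows "emeasure lborel (cbox (\<chi> i. - r) (\<chi> i. r) :: (real^3) set) = ennreal (8 * r ^ 3)"
proof -
  have "emeasure lborel (cbox (\<chi> i. - r) (\<chi> i. r) :: (real^3) set)
      = ennreal (\<Prod>b\<in>Basis. ((\<chi> i. r) - (\<chi> i. - r) :: real^3) \<bullet> b)"
    using assms by (subst emeasure_lborel_cbox_eq) (auto simp: Basis_vec_def inner_axis)
  also have "\<dots> = ennreal (8 * r ^ 3)"
    by (subst prod_Basis_vec) (simp add: power_mult_distrib)
  finally show ?thesis .
qed

lemma emeasure_torus3_space: "emeasure torus3 cube3 = ennreal (8 * pi ^ 3)"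
  using emeasure_cube_radius[of pi] by (simp add: torus3_def emeasure_restrict_space)

lemma measure_torus3_space [simp]: "measure torus3 cube3 = 8 * pi ^ 3"
  by (simp add: measure_def emeasure_torus3_space)

interpretation torus3: finite_measure torus3
  by standard (simp add: emeasure_torus3_space)

lemma AE_torus3_iff: "(AE p in torus3. P p) \<longleftrightarrow> (AE p in lborel. p \<in> cube3 \<longrightarrow> P p)"
  unfolding torus3_def by (intro AE_restrict_space_iff) simp

text \<open>The faces of the cube are dropped first: intersecting with the open box turns the
  assumption into negligibility of a nonempty open set.\<close>

lemma torus3_open_pos:
  assumes "open U" "x \<in> U" "x \<in> box (\<chi> i. - pi) (\<chi> i. pi)"
  shows "\<not> (AE p in torus3. p \<notin> U)"
proof
  assume "AE p in torus3. p \<notin> U"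
  then have "AE p in lborel. p \<notin> U \<inter> box (\<chi> i. - pi) (\<chi> i. pi)"
    unfolding AE_torus3_iff by eventually_elim (use box_subset_cbox in auto)
  moreover have op: "open (U \<inter> box (\<chi> i. - pi) (\<chi> i. pi))"
    using assms by auto
  ultimately have "U \<inter> box (\<chi> i. - pi) (\<chi> i. pi) \<in> null_sets lborel"
    by (subst (asm) AE_iff_null_sets[symmetric]) auto
  then have "negligible (U \<inter> box (\<chi> i. - pi) (\<chi> i. pi))"
    by (simp add: negligible_iff_null_sets null_sets_completionI)
  with open_not_negligible[OF op] assms show False by auto
qed

lemma E0_level_pos:
  assumes "0 \<le> a" "a < b" "b \<le> 24"
  shows "\<not> (AE p in torus3. \<not> (a < E0 p \<and> E0 p < b))"
proof -
  let ?c = "(a + b) / 2"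
  \<comment> \<open>On the diagonal \<open>E0\<close> equals \<open>12 * (1 - cos t)\<close>, so
    this \<open>t\<close> hits the midpoint of the level interval.\<close>
  let ?t = "arccos (1 - ?c / 12)"
  have c: "a < ?c" "?c < b" "0 < ?c" "?c < 24" using assms by auto
  then have t: "0 < ?t" "?t < pi"
    using arccos_lt_bounded[of "1 - ?c / 12"] by auto
  let ?x = "\<chi> i. ?t :: real^3"
  have "cos ?t = 1 - ?c / 12" using c by (intro cos_arccos) auto
  then have "E0 ?x = ?c" by (simp add: E0_def)
  moreover have "open {p. a < E0 p \<and> E0 p < b}"
    by (intro open_Collect_conj open_Collect_less continuous_on_E0 continuous_intros)
  moreover have "?x \<in> box (\<chi> i. - pi) (\<chi> i. pi)"
    using t pi_gt_zero by (auto simp: mem_box_cart less_eq_real_def intro: less_trans)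
  ultimately show ?thesis
    using torus3_open_pos[of "{p. a < E0 p \<and> E0 p < b}" ?x] c by auto
qed

section \<open>Invariance under coordinate permutations and half-period shifts\<close>

text \<open>Preimages of boxes are boxes with the same side lengths in another order, and the
  volumes of boxes determine Lebesgue measure.\<close>

lemma lborel_distr_permute:
  assumes "\<pi> permutes (UNIV :: 'n::finite set)"
  shows "distr lborel borel (\<lambda>p. \<chi> i. p $ \<pi> i) = (lborel :: (real^'n) measure)"
proof (rule lborel_eqI[symmetric])
  let ?P = "\<lambda>p :: real^'n. \<chi> i. p $ \<pi> i"
  have cont: "continuous_on UNIV ?P"
    by (intro continuous_intros)
  have meas [measurable]: "?P \<in> borel_measurable borel"
    using cont by (rule borel_measurable_continuous_onI)
  fix l u :: "real^'n"
  assume "\<And>b. b \<in> Basis \<Longrightarrow> l \<bullet> b \<le> u \<bullet> b"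
  then have lu: "l $ i \<le> u $ i" for i
    by (metis axis_in_Basis_iff cart_eq_inner_axis Basis_real_def singletonI)
  let ?\<rho> = "inv \<pi>"
  let ?l = "\<chi> i. l $ ?\<rho> i" and ?u = "\<chi> i. u $ ?\<rho> i"
  have inv: "?\<rho> (\<pi> i) = i" "\<pi> (?\<rho> i) = i" for i
    using permutes_inverses[OF assms] by auto
  have "?P -` box l u = box ?l ?u"
    by (auto simp: mem_box_cart) (metis inv)+
  then have "emeasure (distr lborel borel ?P) (box l u) = emeasure lborel (box ?l ?u)"
    by (subst emeasure_distr) auto
  also have "\<dots> = ennreal (\<Prod>b\<in>Basis. (?u - ?l) \<bullet> b)"
    using lu by (subst emeasure_lborel_box_eq) (auto simp: Basis_vec_def inner_axis)
  also have "(\<Prod>b\<in>Basis. (?u - ?l) \<bullet> b) = (\<Prod>i\<in>UNIV. (u - l) $ ?\<rho> i)"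
    by (subst prod_Basis_vec) simp
  also have "\<dots> = (\<Prod>b\<in>Basis. (u - l) \<bullet> b)"
    using prod.permute[OF permutes_inv[OF assms], of "\<lambda>i. (u - l) $ i"]
    by (subst prod_Basis_vec) (simp add: comp_def)
  finally show "emeasure (distr lborel borel ?P) (box l u) = ennreal (\<Prod>b\<in>Basis. (u - l) \<bullet> b)" .
qed simp

lemma integral_torus3_permute:
  fixes f :: "real^3 \<Rightarrow> complex"
  assumes \<pi>: "\<pi> permutes (UNIV :: 3 set)" and f: "f \<in> borel_measurable torus3"
  shows "(LINT p|torus3. f (\<chi> i. p $ \<pi> i)) = (LINT p|torus3. f p)"
proof -
  let ?P = "\<lambda>p :: real^3. \<chi> i. p $ \<pi> i"
  let ?g = "\<lambda>p. indicator cube3 p *\<^sub>R f p"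
  have [measurable]: "?P \<in> borel_measurable borel"
    by (intro borel_measurable_continuous_onI continuous_intros)
  have g: "?g \<in> borel_measurable borel"
    using f unfolding torus3_def by (subst (asm) borel_measurable_restrict_space_iff) auto
  have mem: "?P p \<in> cube3 \<longleftrightarrow> p \<in> cube3" for p
    using permutes_inverses[OF \<pi>] by (auto simp: mem_cube3) (metis)+
  have "(LINT p|torus3. f p) = (LINT p|lborel. ?g p)"
    unfolding torus3_def by (subst integral_restrict_space) auto
  also have "\<dots> = (LINT p|distr lborel borel ?P. ?g p)"
    by (simp add: lborel_distr_permute[OF \<pi>])
  also have "\<dots> = (LINT p|lborel. ?g (?P p))"
    using g by (intro integral_distr) auto
  also have "\<dots> = (LINT p|lborel. indicator cube3 p *\<^sub>R f (?P p))"
    by (intro Bochner_Integration.integral_cong refl) (simp add: indicator_def mem)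
  also have "\<dots> = (LINT p|torus3. f (?P p))"
    unfolding torus3_def by (subst integral_restrict_space) auto
  finally show ?thesis by simp
qed

lemma emeasure_torus3: "S \<in> sets borel \<Longrightarrow> emeasure torus3 (cube3 \<inter> S) = emeasure lborel (cube3 \<inter> S)"
  unfolding torus3_def by (subst emeasure_restrict_space) auto

text \<open>Cut the cube along \<open>p $ i = 0\<close>. Translation by \<open>pi\<close> or
  \<open>- pi\<close> exchanges the two halves, and periodicity of \<open>S\<close> makes the two
  translations agree on it.\<close>

lemma emeasure_cube3_shift:
  fixes i :: 3
  assumes S [measurable]: "S \<in> sets borel" and per: "\<And>p. p + axis i (2 * pi) \<in> S \<longleftrightarrow> p \<in> S"
  shows "emeasure lborel (cube3 \<inter> {p. p + axis i pi \<in> S}) = emeasure lborel (cube3 \<inter> S)"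
proof -
  let ?T = "{p. p + axis i pi \<in> S}"
  let ?N = "{p :: real^3. p $ i \<le> 0}" and ?P = "{p :: real^3. 0 \<le> p $ i}"
  have [measurable]: "?N \<in> sets borel" "?P \<in> sets borel"
    by (auto intro!: borel_closed closed_Collect_le continuous_intros)
  have "(\<lambda>p. p + axis i pi) \<in> borel_measurable borel" by simp
  from measurable_sets[OF this S] have T [measurable]: "?T \<in> sets borel"
    by (simp add: vimage_def)
  \<comment> \<open>Both halves are closed and overlap in the cutting hyperplane, which is null, so
    their measures still add up.\<close>
  have split: "emeasure lborel (cube3 \<inter> A)
      = emeasure lborel (cube3 \<inter> ?N \<inter> A) + emeasure lborel (cube3 \<inter> ?P \<inter> A)"
    if [measurable]: "A \<in> sets borel" for A
  proof -
    have "{p :: real^3. p $ i = 0} \<in> null_sets lebesgue"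
      using negligible_standard_hyperplane_cart[of i] by (simp add: negligible_iff_null_sets)
    then have "AE p in lebesgue. (p :: real^3) $ i \<noteq> 0"
      by (auto simp: eventually_ae_filter intro!: exI[of _ "{p. p $ i = 0}"])
    then have nz: "AE p in lborel. (p :: real^3) $ i \<noteq> 0"
      by (simp add: AE_completion_iff)
    have "emeasure lborel (cube3 \<inter> ?P \<inter> A) = emeasure lborel (cube3 \<inter> (- ?N) \<inter> A)"
      by (rule emeasure_eq_AE) (use nz in \<open>auto elim!: eventually_mono\<close>)
    moreover have "emeasure lborel (cube3 \<inter> ?N \<inter> A) + emeasure lborel (cube3 \<inter> (- ?N) \<inter> A)
        = emeasure lborel ((cube3 \<inter> ?N \<inter> A) \<union> (cube3 \<inter> (- ?N) \<inter> A))"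
      by (rule plus_emeasure) auto
    moreover have "(cube3 \<inter> ?N \<inter> A) \<union> (cube3 \<inter> (- ?N) \<inter> A) = cube3 \<inter> A" by auto
    ultimately show ?thesis by simp
  qed
  have transl: "emeasure lborel ((+) c -` B) = emeasure lborel B"
    if "B \<in> sets borel" for B and c :: "real^3"
    using that by (subst (2) lborel_distr_plus[of c, symmetric]) (simp add: emeasure_distr)
  have cube_iff: "axis i t + p \<in> cube3 \<longleftrightarrow>
      - pi \<le> t + p $ i \<and> t + p $ i \<le> pi \<and> (\<forall>j. j \<noteq> i \<longrightarrow> - pi \<le> p $ j \<and> p $ j \<le> pi)" for t p
    by (auto simp: mem_cube3 axis_def)
  have cube_iff0: "p \<in> cube3 \<longleftrightarrow>
      - pi \<le> p $ i \<and> p $ i \<le> pi \<and> (\<forall>j. j \<noteq> i \<longrightarrow> - pi \<le> p $ j \<and> p $ j \<le> pi)" for p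
    using cube_iff[of 0 p] by (simp add: axis_def mem_cube3)
  have shift_back: "axis i (- pi) + p \<in> S \<longleftrightarrow> p + axis i pi \<in> S" for p
  proof -
    have "(axis i (- pi) + p) + axis i (2 * pi) = p + axis i pi"
      by (simp add: vec_eq_iff axis_def)
    then show ?thesis by (metis per)
  qed
  have "(+) (axis i pi) -` (cube3 \<inter> ?P \<inter> S) = cube3 \<inter> ?N \<inter> ?T"
    using pi_gt_zero
    by (auto simp: cube_iff cube_iff0 add.commute simp del: pi_gt_zero) (auto simp: axis_def)
  moreover have "(+) (axis i (- pi)) -` (cube3 \<inter> ?N \<inter> S) = cube3 \<inter> ?P \<inter> ?T"
    using pi_gt_zero
    by (auto simp: cube_iff cube_iff0 shift_back simp del: pi_gt_zero) (auto simp: axis_def)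
  ultimately have "emeasure lborel (cube3 \<inter> ?N \<inter> ?T) = emeasure lborel (cube3 \<inter> ?P \<inter> S)"
    "emeasure lborel (cube3 \<inter> ?P \<inter> ?T) = emeasure lborel (cube3 \<inter> ?N \<inter> S)"
    using transl[of "cube3 \<inter> ?P \<inter> S" "axis i pi"] transl[of "cube3 \<inter> ?N \<inter> S" "axis i (- pi)"] by auto
  then show ?thesis
    by (simp add: split[OF S] split[OF T] add.commute)
qed

text \<open>Shifting all three coordinates by \<open>pi\<close> negates every cosine. The shift is
  made one axis at a time, each an instance of \<open>emeasure_cube3_shift\<close>.\<close>

lemma distr_csum_uminus: "distr torus3 borel (\<lambda>p. - csum p) = distr torus3 borel csum"
proof (rule measure_eqI)
  fix B :: "real set" assume "B \<in> sets (distr torus3 borel (\<lambda>p. - csum p))"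
  then have B [measurable]: "B \<in> sets borel" by simp
  let ?S = "\<lambda>e :: real^3. {p. csum (p + e) \<in> B}"
  have S: "?S e \<in> sets borel" for e
  proof -
    have "(\<lambda>p. csum (p + e)) \<in> borel_measurable borel"
      by (intro borel_measurable_continuous_onI continuous_on_compose2[OF continuous_on_csum]
          continuous_intros) auto
    from measurable_sets[OF this B] show ?thesis by (simp add: vimage_def)
  qed
  have per: "csum (p + axis i (2 * pi) + e) = csum (p + e)" for p e :: "real^3" and i :: 3
    unfolding csum_def
  proof (rule sum.cong[OF refl])
    fix j :: 3
    show "cos ((p + axis i (2 * pi) + e) $ j) = cos ((p + e) $ j)"
      using cos_periodic[of "(p + e) $ j"] by (cases "j = i") (simp_all add: axis_def algebra_simps)
  qed
  have step: "emeasure lborel (cube3 \<inter> ?S (axis i pi + e)) = emeasure lborel (cube3 \<inter> ?S e)"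
    for i :: 3 and e
    using emeasure_cube3_shift[OF S[of e], of i] per by (simp add: add.assoc)
  \<comment> \<open>The trailing \<open>+ 0\<close> gives the total shift the nested shape that
    three applications of \<open>step\<close> produce.\<close>
  have flip: "csum (p + (axis 1 pi + (axis 2 pi + (axis 3 pi + 0)))) = - csum p" for p
    unfolding csum_def sum_3 by (simp add: axis_def)
  have "emeasure lborel (cube3 \<inter> {p. - csum p \<in> B}) = emeasure lborel (cube3 \<inter> {p. csum p \<in> B})"
    using step[of 1 "axis 2 pi + (axis 3 pi + 0)"] step[of 2 "axis 3 pi + 0"] step[of 3 0]
    by (simp only: flip) simp
  moreover have "emeasure (distr torus3 borel f) B = emeasure lborel (cube3 \<inter> {p. f p \<in> B})"
    if "continuous_on UNIV f" for f
  proof -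
    have "f \<in> borel_measurable borel" using that by (rule borel_measurable_continuous_onI)
    from measurable_sets[OF this B] have "{p. f p \<in> B} \<in> sets borel" by (simp add: vimage_def)
    then show ?thesis
      using continuous_measurable_torus3[OF that] emeasure_torus3[of "{p. f p \<in> B}"]
      by (simp add: emeasure_distr vimage_def Int_commute)
  qed
  ultimately show "emeasure (distr torus3 borel (\<lambda>p. - csum p)) B = emeasure (distr torus3 borel csum) B"
    by (simp add: continuous_on_csum continuous_on_minus)
qed simp

lemma integral_csum_uminus:
  fixes g :: "real \<Rightarrow> real"
  assumes [measurable]: "g \<in> borel_measurable borel"
  shows "(LINT p|torus3. g (- csum p)) = (LINT p|torus3. g (csum p))"
  using distr_csum_uminus integral_distr[of "\<lambda>p. - csum p" torus3 borel g]
    integral_distr[of csum torus3 borel g] by simp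

section \<open>Integrability of the inverse of the dispersion relation\<close>

text \<open>Since \<open>1 - cos x\<close> is twice the square of the sine of the half-angle
  \<open>y\<close>, it suffices that \<open>sin y \<ge> y / 2\<close>, which the cubic Taylor
  remainder yields.\<close>

lemma one_minus_cos_ge:
  assumes "\<bar>x\<bar> \<le> pi"
  shows "x\<^sup>2 / 8 \<le> 1 - cos x"
proof -
  let ?y = "\<bar>x\<bar> / 2"
  \<comment> \<open>The bound 1.6 exceeds \<open>pi / 2\<close>, and its square is below 3, which is
    what makes \<open>y ^ 3 / 6\<close> at most \<open>y / 2\<close>.\<close>
  have y: "0 \<le> ?y" "?y \<le> 1.6" using assms pi_approx by auto
  have "\<bar>sin ?y - ?y\<bar> \<le> ?y ^ 3 / 6"
    using Maclaurin_sin_bound[of ?y 3] y by (simp add: eval_nat_numeral sin_coeff_def)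
  moreover have "?y ^ 3 / 6 \<le> ?y / 2"
  proof -
    have "?y * ?y \<le> 1.6 * 1.6" using y by (intro mult_mono) auto
    then have "?y * (?y * ?y) \<le> ?y * 3" using y by (intro mult_left_mono) auto
    then show ?thesis by (simp add: power3_eq_cube mult.assoc)
  qed
  ultimately have "?y / 2 \<le> sin ?y" by linarith
  then have "(?y / 2)\<^sup>2 \<le> (sin ?y)\<^sup>2" using y by (intro power_mono) auto
  moreover have "cos (2 * ?y) = 1 - 2 * (sin ?y)\<^sup>2" by (rule cos_double_sin)
  ultimately show ?thesis by (simp add: power_divide)
qed

lemma E0_ge:
  assumes "p \<in> cube3"
  shows "(p $ i)\<^sup>2 / 2 \<le> E0 p"
proof -
  have "(p $ i)\<^sup>2 / 8 \<le> 1 - cos (p $ i)"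
    using assms by (intro one_minus_cos_ge) (auto simp: mem_cube3 abs_le_iff minus_le_iff)
  also have "\<dots> \<le> (\<Sum>i\<in>UNIV. 1 - cos (p $ i))"
    by (rule member_le_sum) auto
  finally show ?thesis by (simp add: E0_def)
qed

text \<open>The shells between the cubes of half-width \<open>\<pi> / 2 ^ k\<close> contribute \<open>4 ^ k / 8 ^ k\<close> each.\<close>

lemma integrable_inverse_E0: "integrable torus3 (\<lambda>p. 1 / E0 p)"
proof (rule integrableI_nonneg)
  show "(\<lambda>p. 1 / E0 p) \<in> borel_measurable torus3" by measurable
  show "AE p in torus3. 0 \<le> 1 / E0 p" by (simp add: E0_bounds)
  let ?Q = "\<lambda>k :: nat. cbox (\<chi> i. - (pi / 2 ^ k)) (\<chi> i. pi / 2 ^ k) :: (real^3) set"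
  \<comment> \<open>A point of \<open>?Q k\<close> outside \<open>?Q (Suc k)\<close> has a
    coordinate larger than \<open>pi / 2 ^ Suc k\<close> in absolute value, which bounds
    \<open>1 / E0\<close> by this weight. The majorant puts the weight on all of
    \<open>?Q k\<close>.\<close>
  let ?t = "\<lambda>k p. ennreal (8 * 4 ^ k / pi\<^sup>2) * indicator (?Q k) p"
  have Q0: "?Q k \<subseteq> cube3" for k
  proof -
    have "pi / 2 ^ k \<le> pi" by (simp add: divide_le_eq)
    then show ?thesis by (intro subset_interval_imp_cart) (auto simp: minus_le_iff)
  qed
  have Qm [measurable]: "?Q k \<in> sets torus3" for k
    unfolding torus3_def sets_restrict_space using Q0[of k] by auto
  have bound: "ennreal (1 / E0 p) \<le> (\<Sum>k. ?t k p)" if p: "p \<in> cube3" for p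
  proof (cases "p = 0")
    \<comment> \<open>At the origin \<open>E0\<close> vanishes and \<open>1 / 0\<close> is 0 by
      convention.\<close>
    case True
    then show ?thesis by (simp add: E0_def)
  next
    case False
    then obtain i where i: "p $ i \<noteq> 0" by (auto simp: vec_eq_iff)
    obtain n0 where "pi / \<bar>p $ i\<bar> < 2 ^ n0"
      using real_arch_pow[of 2 "pi / \<bar>p $ i\<bar>"] by auto
    then have "p \<notin> ?Q n0"
      using i by (auto simp: mem_box_cart field_simps abs_if not_le split: if_splits
          intro!: exI[of _ i])
    then have n: "p \<notin> ?Q (LEAST n. p \<notin> ?Q n)" by (rule LeastI)
    \<comment> \<open>The first cube that misses \<open>p\<close>. As \<open>?Q 0\<close> is the
      whole fundamental cube, its index is a successor, and the preceding cube contains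
      \<open>p\<close>.\<close>
    define n where "n = (LEAST n. p \<notin> ?Q n)"
    have "n \<noteq> 0" using n p unfolding n_def[symmetric] by (intro notI) simp
    then obtain k where k: "n = Suc k" using not0_implies_Suc by blast
    have Qk: "p \<in> ?Q k" using not_less_Least[of k "\<lambda>n. p \<notin> ?Q n"] k n_def by auto
    have "p \<notin> ?Q (Suc k)" using n k n_def by auto
    then obtain j where "\<bar>p $ j\<bar> > pi / 2 ^ Suc k"
      unfolding mem_box_cart by (metis abs_le_iff minus_le_iff not_le vec_lambda_beta)
    then have "(pi / 2 ^ Suc k)\<^sup>2 \<le> (p $ j)\<^sup>2" by (auto simp: abs_le_square_iff[symmetric])
    then have "(pi / 2 ^ Suc k)\<^sup>2 / 2 \<le> E0 p" using E0_ge[OF p, of j] by linarith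
    moreover have "0 < (pi / 2 ^ Suc k)\<^sup>2 / 2" by simp
    ultimately have "1 / E0 p \<le> 1 / ((pi / 2 ^ Suc k)\<^sup>2 / 2)"
      by (intro divide_left_mono mult_pos_pos) linarith+
    also have "\<dots> = 8 * 4 ^ k / pi\<^sup>2"
      by (simp add: power_divide power_mult[symmetric] field_simps power2_eq_square
          flip: power_mult_distrib)
    finally have "ennreal (1 / E0 p) \<le> ?t k p" using Qk by (simp add: ennreal_leI)
    also have "\<dots> \<le> (\<Sum>k. ?t k p)"
    proof -
      have "sum (\<lambda>k. ?t k p) {k} \<le> (\<Sum>k. ?t k p)"
        by (rule sum_le_suminf) auto
      then show ?thesis by (simp del: sum_mult_indicator)
    qed
    finally show ?thesis .
  qed
  have "(\<integral>\<^sup>+p. ennreal (1 / E0 p) \<partial>torus3) \<le> (\<integral>\<^sup>+p. (\<Sum>k. ?t k p) \<partial>torus3)"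
    by (intro nn_integral_mono bound) simp
  also have "\<dots> = (\<Sum>k. \<integral>\<^sup>+p. ?t k p \<partial>torus3)"
    by (intro nn_integral_suminf) measurable
  also have "\<dots> = (\<Sum>k. ennreal (64 * pi * (1 / 2) ^ k))"
  proof (intro suminf_cong)
    fix k
    have "emeasure torus3 (?Q k) = ennreal (8 * (pi / 2 ^ k) ^ 3)"
      using emeasure_torus3[of "?Q k"] emeasure_cube_radius[of "pi / 2 ^ k"] Q0[of k]
      by (simp add: Int_absorb1)
    then have "(\<integral>\<^sup>+p. ?t k p \<partial>torus3) = ennreal (8 * 4 ^ k / pi\<^sup>2) * ennreal (8 * (pi / 2 ^ k) ^ 3)"
      using Qm[of k] by (simp add: nn_integral_cmult_indicator)
    also have "\<dots> = ennreal (8 * 4 ^ k / pi\<^sup>2 * (8 * (pi / 2 ^ k) ^ 3))"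
      by (rule ennreal_mult[symmetric]) simp_all
    also have "8 * 4 ^ k / pi\<^sup>2 * (8 * (pi / 2 ^ k) ^ 3) = 64 * pi * (1 / 2) ^ k"
    proof -
      have "(4::real) ^ k = 2 ^ k * 2 ^ k" by (simp flip: power_mult_distrib)
      then show ?thesis by (simp add: power_divide field_simps power2_eq_square power3_eq_cube)
    qed
    finally show "(\<integral>\<^sup>+p. ?t k p \<partial>torus3) = ennreal (64 * pi * (1 / 2) ^ k)" .
  qed
  also have "\<dots> < \<infinity>"
    by (subst suminf_ennreal2) (auto intro!: summable_mult summable_geometric)
  finally show "(\<integral>\<^sup>+p. ennreal (1 / E0 p) \<partial>torus3) < \<infinity>" .
qed

text \<open>By \<open>E0_ge\<close> the origin is the only zero of \<open>E0\<close> in the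
  cube.\<close>

lemma AE_E0_pos: "AE p in torus3. 0 < E0 p"
proof -
  have "AE p in lborel. p \<noteq> (0 :: real^3)" by (simp add: AE_lborel_singleton)
  then have "AE p in torus3. p \<noteq> 0" unfolding AE_torus3_iff by eventually_elim simp
  moreover have "AE p in torus3. p \<in> cube3" by (rule AE_I2) simp
  ultimately show ?thesis
  proof eventually_elim
    case (elim p)
    then obtain i where "p $ i \<noteq> 0" by (auto simp: vec_eq_iff)
    then have "0 < (p $ i)\<^sup>2 / 2" by simp
    then show ?case using E0_ge[OF elim(2), of i] by linarith
  qed
qed

lemma integrable_csum_bounded:
  assumes "f \<in> borel_measurable borel" "\<And>x. \<bar>x\<bar> \<le> 3 \<Longrightarrow> \<bar>f x\<bar> \<le> B"
  shows "integrable torus3 (\<lambda>p. f (csum p) :: real)"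
proof (rule torus3.integrable_const_bound[of _ B])
  show "AE p in torus3. norm (f (csum p)) \<le> B"
    using assms(2) csum_bounds by (auto simp: abs_le_iff minus_le_iff)
  show "(\<lambda>p. f (csum p)) \<in> borel_measurable torus3"
    using measurable_compose[OF csum_measurable assms(1)] .
qed

lemma integrable_csum: "integrable torus3 csum"
  using integrable_csum_bounded[of "\<lambda>x. x" 3] by simp

lemma integral_csum: "(LINT p|torus3. csum p) = 0"
  using integral_csum_uminus[of "\<lambda>x. x"] by simp

text \<open>Zeros of \<open>csum\<close> lie on the level 12 of \<open>E0\<close>, while the levels
  between 0 and 1 already fill a set of positive measure.\<close>

lemma csum_not_AE_0: "\<not> (AE p in torus3. csum p = 0)"
proof
  assume "AE p in torus3. csum p = 0"
  then have "AE p in torus3. \<not> (0 < E0 p \<and> E0 p < 1)"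
    by eventually_elim (simp add: E0_csum)
  then show False using E0_level_pos[of 0 1] by simp
qed

section \<open>The scalar secular equation\<close>

text \<open>The torus average of \<open>1 / (E0 p - z)\<close> at \<open>z = 12 - w\<close>, hence
  \<open>a_s 1 1 (12 - w)\<close>. Centering the spectral variable at the middle of the band turns
  the symmetry of \<open>csum\<close> into oddness in \<open>w\<close>.\<close>

definition res_mean :: "real \<Rightarrow> real" where
  "res_mean w = (LINT p|torus3. 1 / (w - 4 * csum p)) / (8 * pi ^ 3)"

lemma res_mean_uminus: "res_mean (- w) = - res_mean w"
proof -
  have "(LINT p|torus3. 1 / (- w - 4 * csum p)) = (LINT p|torus3. 1 / (- w - 4 * (- csum p)))"
    by (rule integral_csum_uminus[symmetric]) measurable
  also have "\<dots> = (LINT p|torus3. - (1 / (w - 4 * csum p)))"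
    by (intro Bochner_Integration.integral_cong refl) (simp add: divide_simps)
  finally show ?thesis by (simp add: res_mean_def)
qed

text \<open>The threshold \<open>w = 12\<close>, that is \<open>z = 0\<close>, is included because
  \<open>mu0\<close> is a value there; for \<open>w < - 12\<close> the integrand is bounded.\<close>

context
  fixes w :: real
  assumes w: "12 \<le> w \<or> w < - 12"
begin

text \<open>The factor \<open>w\<close> gives both sides of the band the same sign. At
  \<open>w = 12\<close> the denominator vanishes at the origin, so the claim holds only almost
  everywhere.\<close>

lemma AE_denominator_pos: "AE p in torus3. 0 < w * (w - 4 * csum p)"
  using AE_E0_pos
proof eventually_elim
  case (elim p)
  show ?case
  proof (cases "12 \<le> w")
    case True
    then show ?thesis using elim by (simp add: E0_csum)
  next
    case False
    then have "w < - 12" using w by simp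
    then show ?thesis using csum_bounds(1)[of p] by (intro mult_neg_neg) auto
  qed
qed

lemma integrable_resolvent: "integrable torus3 (\<lambda>p. 1 / (w - 4 * csum p))"
proof (cases "12 \<le> w")
  case True
  show ?thesis
  proof (rule Bochner_Integration.integrable_bound[OF integrable_inverse_E0])
    show "AE p in torus3. norm (1 / (w - 4 * csum p)) \<le> norm (1 / E0 p)"
      using AE_E0_pos
    proof eventually_elim
      case (elim p)
      then have "1 / (w - 4 * csum p) \<le> 1 / E0 p"
        using True by (intro divide_left_mono mult_pos_pos) (auto simp: E0_csum)
      then show ?case using elim True by (simp add: E0_csum)
    qed
  qed measurable
next
  case False
  then have w': "w < - 12" using w by simp
  have "integrable torus3 (\<lambda>p. (\<lambda>x. 1 / (w - 4 * x)) (csum p))"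
  proof (rule integrable_csum_bounded)
    fix x :: real assume "\<bar>x\<bar> \<le> 3"
    then have "- w - 12 \<le> \<bar>w - 4 * x\<bar>" using w' by linarith
    then show "\<bar>1 / (w - 4 * x)\<bar> \<le> 1 / (- w - 12)"
      using w' unfolding abs_divide by (intro frac_le) auto
  qed measurable
  then show ?thesis .
qed

lemma resolvent_moment_0:
  "has_bochner_integral torus3 (\<lambda>p. 1 / (w - 4 * csum p)) (8 * pi ^ 3 * res_mean w)"
  using integrable_resolvent by (simp add: has_bochner_integral_iff res_mean_def)

text \<open>Writing \<open>4 * csum p\<close> as \<open>w - (w - 4 * csum p)\<close> lowers the
  power of \<open>csum\<close> by one, so this moment is expressed by the preceding one.\<close>

lemma resolvent_moment_1:
  "has_bochner_integral torus3 (\<lambda>p. csum p / (w - 4 * csum p))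
     (8 * pi ^ 3 * (w * res_mean w - 1) / 4)"
proof (rule has_bochner_integralI_AE)
  have "has_bochner_integral torus3 (\<lambda>p. (w * (1 / (w - 4 * csum p)) - 1) / 4)
      ((w * (8 * pi ^ 3 * res_mean w) - 8 * pi ^ 3) / 4)"
    using resolvent_moment_0 torus3.integrable_const[of "1::real"]
    by (intro has_bochner_integral_divide_zero has_bochner_integral_diff
        has_bochner_integral_mult_right) (simp_all add: has_bochner_integral_iff)
  then show "has_bochner_integral torus3 (\<lambda>p. (w * (1 / (w - 4 * csum p)) - 1) / 4)
      (8 * pi ^ 3 * (w * res_mean w - 1) / 4)"
    by (simp add: algebra_simps)
  show "AE p in torus3. (w * (1 / (w - 4 * csum p)) - 1) / 4 = csum p / (w - 4 * csum p)"
    using AE_denominator_pos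
  proof eventually_elim
    case (elim p)
    then have "w - 4 * csum p \<noteq> 0" by auto
    then show ?case by (simp add: divide_simps)
  qed
qed measurable

text \<open>The same reduction once more; the subtracted term is the integral of
  \<open>csum\<close>, which is 0.\<close>

lemma resolvent_moment_2:
  "has_bochner_integral torus3 (\<lambda>p. (csum p)\<^sup>2 / (w - 4 * csum p))
     (8 * pi ^ 3 * w * (w * res_mean w - 1) / 16)"
proof (rule has_bochner_integralI_AE)
  have "has_bochner_integral torus3 (\<lambda>p. (w * (csum p / (w - 4 * csum p)) - csum p) / 4)
      ((w * (8 * pi ^ 3 * (w * res_mean w - 1) / 4) - 0) / 4)"
    using resolvent_moment_1 integrable_csum integral_csum
    by (intro has_bochner_integral_divide_zero has_bochner_integral_diff
        has_bochner_integral_mult_right) (simp_all add: has_bochner_integral_iff)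
  then show "has_bochner_integral torus3 (\<lambda>p. (w * (csum p / (w - 4 * csum p)) - csum p) / 4)
      (8 * pi ^ 3 * w * (w * res_mean w - 1) / 16)"
    by (simp add: algebra_simps)
  show "AE p in torus3. (w * (csum p / (w - 4 * csum p)) - csum p) / 4 = (csum p)\<^sup>2 / (w - 4 * csum p)"
    using AE_denominator_pos
  proof eventually_elim
    case (elim p)
    then have "w - 4 * csum p \<noteq> 0" by auto
    then show ?case by (simp add: divide_simps) (simp add: algebra_simps power2_eq_square)
  qed
qed measurable

text \<open>Up to a positive factor the difference \<open>w * res_mean w - 1\<close> is
  \<open>w\<close> times the second moment, the integral of a nonnegative function that is not
  almost everywhere 0.\<close>

lemma res_mean_gt: "1 < w * res_mean w"
proof -
  let ?f = "\<lambda>p. w * ((csum p)\<^sup>2 / (w - 4 * csum p))"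
  have f: "has_bochner_integral torus3 ?f (w * (8 * pi ^ 3 * w * (w * res_mean w - 1) / 16))"
    using resolvent_moment_2 by (intro has_bochner_integral_mult_right) auto
  have nn: "AE p in torus3. 0 \<le> ?f p"
    using AE_denominator_pos
  proof eventually_elim
    case (elim p)
    then have "0 \<le> w / (w - 4 * csum p)"
      by (simp add: zero_less_mult_iff zero_le_divide_iff) linarith
    then have "0 \<le> w / (w - 4 * csum p) * (csum p)\<^sup>2" by (rule mult_nonneg_nonneg) simp
    then show ?case by (simp only: times_divide_eq_left times_divide_eq_right)
  qed
  have "integral\<^sup>L torus3 ?f \<noteq> 0"
  proof
    assume "integral\<^sup>L torus3 ?f = 0"
    with f nn have "AE p in torus3. ?f p = 0"
      by (subst (asm) integral_nonneg_eq_0_iff_AE) (auto simp: has_bochner_integral_iff)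
    with AE_denominator_pos have "AE p in torus3. csum p = 0" by eventually_elim auto
    with csum_not_AE_0 show False by simp
  qed
  moreover have "0 \<le> integral\<^sup>L torus3 ?f"
    using nn by (rule integral_nonneg_AE)
  ultimately have "0 < w * (8 * pi ^ 3 * w * (w * res_mean w - 1) / 16)"
    using f unfolding has_bochner_integral_iff by linarith
  then have "0 < (w * w) * (pi ^ 3 / 2) * (w * res_mean w - 1)"
    by (simp add: mult.assoc mult.left_commute)
  moreover have "0 < (w * w) * (pi ^ 3 / 2)"
  proof (rule mult_pos_pos)
    show "0 < w * w" using w by (auto simp: zero_less_mult_iff)
  qed simp
  ultimately have "0 < w * res_mean w - 1" by (rule zero_less_mult_pos)
  then show ?thesis by simp
qed

end

lemma res_mean_pos: "12 \<le> w \<Longrightarrow> 0 < res_mean w"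
  using res_mean_gt[of w] zero_less_mult_pos[of w "res_mean w"] by linarith

section \<open>Monotonicity and decay of the gap\<close>

text \<open>The left side is the expanded product of \<open>1 / x - 1 / t\<close> and
  \<open>1 / (x + d) - 1 / (t + d)\<close>, two factors of equal sign, with
  \<open>1 / (x * (x + d))\<close> written as a divided difference.\<close>

lemma comonotone_identity:
  fixes x t d :: real
  assumes "0 < x" "0 < t" "0 < d"
  shows "(1 / x - 1 / (x + d)) / d - 1 / (d + t) * (1 / x) - 1 / t * (1 / (x + d)) + 1 / (d + t) * (1 / t)
    = (x - t)\<^sup>2 / (x * t * ((x + d) * (d + t)))"
proof -
  have "1 / x - 1 / (x + d) = d / (x * (x + d))" using assms by (simp add: field_simps)
  then have "(1 / x - 1 / (x + d)) / d = 1 / (x * (x + d))" using assms by simp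
  moreover have "0 < x + d" "0 < d + t" using assms by auto
  ultimately show ?thesis
    using assms by (simp add: divide_simps) algebra
qed

text \<open>Chebyshev's sum inequality for the increasing functions \<open>1 / (w - 4 s)\<close> and \<open>1 / (w' - 4 s)\<close>
  of \<open>s\<close>, proved by comparing both with their values at the point where the first one attains its
  mean.\<close>

lemma res_mean_diff_ge:
  assumes "12 \<le> w" "w < w'"
  shows "(w' - w) * (res_mean w * res_mean w') \<le> res_mean w - res_mean w'"
proof -
  let ?W = "8 * pi ^ 3 :: real" and ?a = "res_mean w" and ?b = "res_mean w'" and ?d = "w' - w"
  let ?X = "\<lambda>p. 1 / (w - 4 * csum p)" and ?Y = "\<lambda>p. 1 / (w' - 4 * csum p)"
  \<comment> \<open>The value of \<open>?Y\<close> at a point where \<open>?X\<close> equals its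
    mean \<open>?a\<close>, that is where \<open>w - 4 * csum p\<close> is
    \<open>1 / ?a\<close>.\<close>
  define y where "y = 1 / (?d + 1 / ?a)"
  have a: "0 < ?a" using res_mean_pos assms by simp
  have X: "has_bochner_integral torus3 ?X (?W * ?a)" and Y: "has_bochner_integral torus3 ?Y (?W * ?b)"
    using assms by (auto intro!: resolvent_moment_0)
  have one: "has_bochner_integral torus3 (\<lambda>p. y * ?a) (?W * (y * ?a))"
    using torus3.integrable_const[of "y * ?a"] by (simp add: has_bochner_integral_iff)
  have int: "has_bochner_integral torus3 (\<lambda>p. (?X p - ?Y p) / ?d - y * ?X p - ?a * ?Y p + y * ?a)
      ((?W * ?a - ?W * ?b) / ?d - y * (?W * ?a) - ?a * (?W * ?b) + ?W * (y * ?a))"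
    by (intro has_bochner_integral_add has_bochner_integral_diff has_bochner_integral_divide_zero
        has_bochner_integral_mult_right X Y one)
  have "AE p in torus3. 0 < w - 4 * csum p"
    using AE_denominator_pos[of w] assms
    by (auto simp: zero_less_mult_iff elim!: eventually_mono)
  then have "AE p in torus3. 0 \<le> (?X p - ?Y p) / ?d - y * ?X p - ?a * ?Y p + y * ?a"
  proof eventually_elim
    case (elim p)
    define x where "x = w - 4 * csum p"
    have x: "0 < x" "w' - 4 * csum p = x + ?d" using elim by (auto simp: x_def)
    define t where "t = 1 / ?a"
    have t: "0 < t" "?a = 1 / t" "y = 1 / (?d + t)" using a by (auto simp: t_def y_def)
    have d: "0 < ?d" using assms by simp
    have "(1 / x - 1 / (x + ?d)) / ?d - y * (1 / x) - ?a * (1 / (x + ?d)) + y * ?a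
        = (x - t)\<^sup>2 / (x * t * ((x + ?d) * (?d + t)))"
      unfolding t(2,3) using x(1) t(1) d by (rule comonotone_identity)
    also have "0 \<le> \<dots>" using x(1) t(1) d by simp
    finally show ?case by (simp only: x(2) flip: x_def)
  qed
  then have "0 \<le> integral\<^sup>L torus3 (\<lambda>p. (?X p - ?Y p) / ?d - y * ?X p - ?a * ?Y p + y * ?a)"
    by (rule integral_nonneg_AE)
  then have "0 \<le> (?W * ?a - ?W * ?b) / ?d - y * (?W * ?a) - ?a * (?W * ?b) + ?W * (y * ?a)"
    using int by (simp only: has_bochner_integral_iff)
  \<comment> \<open>The two terms with \<open>y\<close> cancel because \<open>?a\<close> is exactly
    the mean of \<open>?X\<close>.\<close>
  also have "\<dots> = ?W * ((?a - ?b) / ?d - ?a * ?b)"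
    by (simp add: algebra_simps diff_divide_distrib)
  finally have "0 \<le> (?a - ?b) / ?d - ?a * ?b"
    by (simp add: zero_le_mult_iff) (use pi_gt_zero in linarith)
  then show ?thesis using assms by (simp add: field_simps)
qed

text \<open>Dominated convergence with the single majorant \<open>1 / E0\<close>, valid for all
  \<open>w \<ge> 12\<close> and so up to the threshold itself.\<close>

lemma continuous_on_res_mean: "continuous_on {12..} res_mean"
proof -
  have "continuous_on {12..} (\<lambda>w. LINT p|torus3. 1 / (w - 4 * csum p))"
    unfolding continuous_on_sequentially comp_def
  proof (intro allI ballI impI, elim conjE)
    fix x :: "nat \<Rightarrow> real" and w :: real
    assume w: "w \<in> {12..}" and x: "\<forall>n. x n \<in> {12..}" and lim: "x \<longlonglongrightarrow> w"
    show "(\<lambda>n. LINT p|torus3. 1 / (x n - 4 * csum p)) \<longlonglongrightarrow> (LINT p|torus3. 1 / (w - 4 * csum p))"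
    proof (rule integral_dominated_convergence[where w="\<lambda>p. 1 / E0 p"])
      show "AE p in torus3. (\<lambda>n. 1 / (x n - 4 * csum p)) \<longlonglongrightarrow> 1 / (w - 4 * csum p)"
        using AE_E0_pos by eventually_elim (use w lim in \<open>auto simp: E0_csum intro!: tendsto_intros\<close>)
      show "AE p in torus3. norm (1 / (x n - 4 * csum p)) \<le> 1 / E0 p" for n
        using AE_E0_pos
      proof eventually_elim
        case (elim p)
        have "12 \<le> x n" using x by simp
        then show ?case using elim by (simp add: E0_csum frac_le)
      qed
    qed (auto intro: integrable_inverse_E0)
  qed
  then show ?thesis unfolding res_mean_def by (intro continuous_intros) auto
qed

text \<open>\<open>1 / res_mean w\<close> is the harmonic mean of \<open>w - 4 * csum\<close>, whose arithmetic mean is \<open>w\<close>.\<close>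

definition gap :: "real \<Rightarrow> real" where
  "gap w = w - 1 / res_mean w"

lemma gap_pos: "12 \<le> w \<Longrightarrow> 0 < gap w"
  using res_mean_gt[of w] res_mean_pos[of w] by (simp add: gap_def field_simps)

text \<open>Dividing \<open>res_mean_diff_ge\<close> by the product of the two means gives
  \<open>w' - w \<le> 1 / res_mean w' - 1 / res_mean w\<close>.\<close>

lemma gap_antimono: "12 \<le> w \<Longrightarrow> w \<le> w' \<Longrightarrow> gap w' \<le> gap w"
  using res_mean_diff_ge[of w w'] res_mean_pos[of w] res_mean_pos[of w']
  by (cases "w = w'") (auto simp: gap_def field_simps)

lemma continuous_on_gap: "continuous_on {12..} gap"
  unfolding gap_def
  by (intro continuous_intros continuous_on_res_mean) (auto dest: res_mean_pos)

text \<open>Decay of \<open>gap\<close> makes \<open>24 / gap w\<close> grow at least linearly and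
  so drives the branches to minus infinity. In \<open>gap w = (w * a - 1) / a\<close> the numerator
  is bounded through the second moment and \<open>csum p ^ 2 \<le> 9\<close>, the denominator
  through \<open>- 3 \<le> csum p\<close>.\<close>

lemma gap_le:
  assumes "36 \<le> w"
  shows "gap w \<le> 288 / w"
proof -
  let ?a = "res_mean w" and ?W = "8 * pi ^ 3 :: real"
  have "1 / (w + 12) \<le> ?a"
  proof -
    have "(LINT p|torus3. 1 / (w + 12)) \<le> (LINT p|torus3. 1 / (w - 4 * csum p))"
      using csum_bounds assms integrable_resolvent[of w]
      by (intro integral_mono) (auto intro!: divide_left_mono mult_pos_pos
          intro: less_le_trans[of 0 "w - 12"] simp: minus_le_iff)
    then show ?thesis by (simp add: res_mean_def field_simps)
  qed
  moreover have "w * (w * ?a - 1) / 16 \<le> 9 / (w - 12)"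
  proof -
    have "(LINT p|torus3. (csum p)\<^sup>2 / (w - 4 * csum p)) \<le> (LINT p|torus3. 9 / (w - 12))"
    proof (rule integral_mono)
      fix p
      have "(csum p)\<^sup>2 \<le> 3\<^sup>2" using csum_bounds[of p] by (intro power2_le_iff_abs_le[THEN iffD2]) auto
      then show "(csum p)\<^sup>2 / (w - 4 * csum p) \<le> 9 / (w - 12)"
        using csum_bounds[of p] assms by (intro frac_le) auto
    qed (use resolvent_moment_2[of w] assms in \<open>auto simp: has_bochner_integral_iff\<close>)
    then have "?W * w * (w * ?a - 1) / 16 \<le> ?W * (9 / (w - 12))"
      using resolvent_moment_2[of w] assms by (simp add: has_bochner_integral_iff)
    then have "?W * (w * (w * ?a - 1) / 16) \<le> ?W * (9 / (w - 12))" by (simp add: mult_ac)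
    then show ?thesis by (subst (asm) mult_le_cancel_left_pos) auto
  qed
  ultimately have a: "1 \<le> ?a * (w + 12)" and b: "w * (w * ?a - 1) * (w - 12) \<le> 144"
    using assms by (auto simp: field_simps)
  \<comment> \<open>The threshold 36 is where \<open>w + 12 \<le> 2 * (w - 12)\<close> starts to
    hold; doubling 144 gives the constant 288.\<close>
  have "w * (w * ?a - 1) * (w + 12) \<le> 2 * (w * (w * ?a - 1) * (w - 12))"
  proof -
    have "0 \<le> w * (w * ?a - 1)" using res_mean_gt[of w] assms by auto
    then have "w * (w * ?a - 1) * (w + 12) \<le> w * (w * ?a - 1) * (2 * (w - 12))"
      using assms by (intro mult_left_mono) auto
    then show ?thesis by (simp only: mult_ac)
  qed
  also have "\<dots> \<le> 288" using b by simp
  also have "\<dots> \<le> 288 * (?a * (w + 12))" using a by simp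
  finally have "w * (w * ?a - 1) \<le> 288 * ?a"
    using assms by (simp add: mult.assoc[symmetric])
  then show ?thesis using assms res_mean_pos[of w] by (simp add: gap_def field_simps)
qed

text \<open>For \<open>w = 12 - z > 12\<close> the determinant of the symmetric problem vanishes iff
  \<open>w + \<mu>1 \<noteq> 0\<close> and \<open>branch \<mu>1 w = \<mu>2\<close>.\<close>

definition branch :: "real \<Rightarrow> real \<Rightarrow> real" where
  "branch \<mu>1 w = 24 / (w + \<mu>1) - 24 / gap w"

section \<open>Monotonicity and range of the branches\<close>

lemma branch_strict_antimono:
  assumes "12 \<le> w" "w < w'" "0 < w + \<mu>1 \<or> w' + \<mu>1 < 0"
  shows "branch \<mu>1 w' < branch \<mu>1 w"
proof -
  have "24 / gap w \<le> 24 / gap w'"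
    using gap_antimono[of w w'] gap_pos[of w'] assms by (intro divide_left_mono mult_pos_pos) auto
  moreover have "24 / (w' + \<mu>1) < 24 / (w + \<mu>1)"
    using assms by (auto simp: divide_simps split: if_splits)
  ultimately show ?thesis by (simp add: branch_def)
qed

lemma continuous_on_branch:
  assumes "A \<subseteq> {12..}" "- \<mu>1 \<notin> A"
  shows "continuous_on A (branch \<mu>1)"
proof -
  have "\<forall>w\<in>A. w + \<mu>1 \<noteq> 0" using assms(2) by (auto simp: add_eq_0_iff2)
  moreover have "\<forall>w\<in>A. gap w \<noteq> 0" using assms(1) gap_pos by force
  ultimately show ?thesis
    unfolding branch_def
    by (intro continuous_intros continuous_on_subset[OF continuous_on_gap assms(1)]) auto
qed

lemma branch_eventually_small:
  obtains B where "b \<le> B" "12 \<le> B" "branch \<mu>1 B \<le> c"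
proof
  \<comment> \<open>The entries serve in turn: the prescribed lower bound, \<open>gap_le\<close>, a
    first fraction of at most 24, and \<open>B / 12 \<ge> 24 - c\<close>.\<close>
  define B where "B = max b (max 36 (max (1 - \<mu>1) (12 * (24 - c))))"
  have B: "b \<le> B" "36 \<le> B" "1 \<le> B + \<mu>1" "24 - c \<le> B / 12"
    by (auto simp: B_def max_def)
  then show "b \<le> B" "12 \<le> B" by auto
  have "24 / (288 / B) \<le> 24 / gap B"
    using gap_le[of B] gap_pos[of B] B by (intro divide_left_mono mult_pos_pos) auto
  then have "B / 12 \<le> 24 / gap B" by simp
  moreover have "24 / (B + \<mu>1) \<le> 24" using B by (simp add: divide_le_eq)
  ultimately show "branch \<mu>1 B \<le> c" using B by (simp add: branch_def)
qed

lemma branch_attains: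
  assumes "12 \<le> b" "0 < b + \<mu>1" "\<mu>2 < branch \<mu>1 b"
  shows "\<exists>w. b < w \<and> branch \<mu>1 w = \<mu>2"
proof -
  obtain B where B: "b \<le> B" "branch \<mu>1 B \<le> \<mu>2"
    using branch_eventually_small by blast
  have "continuous_on {b..B} (branch \<mu>1)"
    using assms by (intro continuous_on_branch) auto
  from IVT2'[OF B(2) _ B(1) this] assms(3)
  obtain w where "b \<le> w" "branch \<mu>1 w = \<mu>2" by auto
  then show ?thesis using assms(3) by (intro exI[of _ w]) (auto simp: less_le)
qed

text \<open>Just right of the pole the first fraction is arbitrarily large while the gap term stays
  bounded, so the branch descends from plus to minus infinity and takes every value.\<close>

lemma branch_attains_right:
  assumes "\<mu>1 \<le> - 12"
  shows "\<exists>w > - \<mu>1. branch \<mu>1 w = \<mu>2"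
proof -
  define g where "g = 24 / gap (1 - \<mu>1)"
  define X where "X = \<bar>\<mu>2\<bar> + g + 1"
  \<comment> \<open>\<open>e \<le> 1\<close> lets \<open>g\<close> bound the gap term at
    \<open>- \<mu>1 + e\<close>, and \<open>e \<le> 24 / X\<close> lifts the first fraction above
    \<open>\<mu>2 + g\<close>.\<close>
  define e where "e = min 1 (24 / X)"
  have "0 < g" using gap_pos[of "1 - \<mu>1"] assms by (auto simp: g_def)
  then have X: "0 < X" "\<mu>2 + g < X" by (auto simp: X_def)
  then have e: "0 < e" "e \<le> 1" by (auto simp: e_def)
  have "e \<le> 24 / X" by (simp add: e_def)
  then have "X \<le> 24 / e" using X e(1) by (simp add: field_simps)
  then have "\<mu>2 + g < 24 / e" using X(2) by linarith
  moreover have "24 / gap (- \<mu>1 + e) \<le> g"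
  proof -
    have "gap (1 - \<mu>1) \<le> gap (- \<mu>1 + e)" using e assms by (intro gap_antimono) auto
    moreover have "0 < gap (1 - \<mu>1)" using assms by (intro gap_pos) auto
    ultimately show ?thesis unfolding g_def by (intro divide_left_mono) auto
  qed
  ultimately have "\<mu>2 < branch \<mu>1 (- \<mu>1 + e)" by (simp add: branch_def)
  then obtain w where "- \<mu>1 + e < w" "branch \<mu>1 w = \<mu>2"
    using branch_attains[of "- \<mu>1 + e" \<mu>1 \<mu>2] e assms by auto
  then show ?thesis using e by (intro exI[of _ w]) auto
qed

text \<open>Left of the pole the branch falls from its threshold value to minus infinity.\<close>

lemma branch_attains_left:
  assumes "\<mu>1 < - 12" "\<mu>2 < branch \<mu>1 12"
  shows "\<exists>w. 12 < w \<and> w < - \<mu>1 \<and> branch \<mu>1 w = \<mu>2"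
proof -
  \<comment> \<open>The first entry keeps \<open>- \<mu>1 - e\<close> in the domain
    \<open>{12..}\<close>, the second pushes the first fraction down to
    \<open>- (\<bar>\<mu>2\<bar> + 1)\<close> or below.\<close>
  define e where "e = min (- \<mu>1 - 12) (24 / (\<bar>\<mu>2\<bar> + 1))"
  have e: "0 < e" "e \<le> - \<mu>1 - 12" using assms by (auto simp: e_def)
  have "e \<le> 24 / (\<bar>\<mu>2\<bar> + 1)" by (simp add: e_def)
  then have "\<bar>\<mu>2\<bar> + 1 \<le> 24 / e" using e(1) by (simp add: field_simps)
  moreover have "0 < 24 / gap (- \<mu>1 - e)" using gap_pos[of "- \<mu>1 - e"] e by auto
  ultimately have "- (24 / e) - 24 / gap (- \<mu>1 - e) \<le> \<mu>2" by linarith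
  then have "branch \<mu>1 (- \<mu>1 - e) \<le> \<mu>2" by (simp add: branch_def)
  moreover have "continuous_on {12..- \<mu>1 - e} (branch \<mu>1)"
    using e by (intro continuous_on_branch) auto
  ultimately obtain w where "12 \<le> w" "w \<le> - \<mu>1 - e" "branch \<mu>1 w = \<mu>2"
    using IVT2'[of "branch \<mu>1" "- \<mu>1 - e" \<mu>2 12] e assms(2) by auto
  then show ?thesis using e assms(2) by (intro exI[of _ w]) (auto simp: less_le)
qed

lemma a_s_11: "a_s 1 1 z = res_mean (12 - z)"
proof -
  have *: "1 / sqrt (8 * pi ^ 3) * (1 / sqrt (8 * pi ^ 3)) / (12 - 4 * x - z)
      = 1 / (12 - z - 4 * x) / (8 * pi ^ 3)" for x
    by (simp add: algebra_simps)
  show ?thesis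
    unfolding res_mean_def a_s_def alpha_s_csum E0_csum * by (rule integral_divide_zero)
qed

section \<open>Counting the roots\<close>

definition roots :: "real \<Rightarrow> real \<Rightarrow> real set" where
  "roots \<mu>1 \<mu>2 = {w. 12 < w \<and> w + \<mu>1 \<noteq> 0 \<and> branch \<mu>1 w = \<mu>2}"

lemma branch_inj:
  assumes "12 \<le> w" "12 \<le> w'" "branch \<mu>1 w = branch \<mu>1 w'"
    "0 < w + \<mu>1 \<and> 0 < w' + \<mu>1 \<or> w + \<mu>1 < 0 \<and> w' + \<mu>1 < 0"
  shows "w = w'"
  using assms branch_strict_antimono[of w w' \<mu>1] branch_strict_antimono[of w' w \<mu>1]
  by (cases w w' rule: linorder_cases) auto

lemma roots_same_side:
  assumes "x \<in> roots \<mu>1 \<mu>2" "w \<in> roots \<mu>1 \<mu>2" "0 < x + \<mu>1 \<longleftrightarrow> 0 < w + \<mu>1"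
  shows "x = w"
proof (rule branch_inj)
  show "12 \<le> x" "12 \<le> w" "branch \<mu>1 x = branch \<mu>1 w"
    using assms by (auto simp: roots_def)
  show "0 < x + \<mu>1 \<and> 0 < w + \<mu>1 \<or> x + \<mu>1 < 0 \<and> w + \<mu>1 < 0"
    using assms unfolding roots_def by (cases "0 < x + \<mu>1") (simp_all add: less_le)
qed

text \<open>Used contrapositively: a \<open>\<mu>2\<close> above the threshold value leaves no root
  on the piece of the domain that starts at 12.\<close>

lemma branch_less_12:
  assumes "w \<in> roots \<mu>1 \<mu>2" "0 < 12 + \<mu>1 \<or> w + \<mu>1 < 0"
  shows "\<mu>2 < branch \<mu>1 12"
  using branch_strict_antimono[of 12 w \<mu>1] assms by (simp add: roots_def)

text \<open>Since \<open>a_s 1 1 0\<close> is \<open>res_mean 12\<close>, the constant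
  \<open>mu0\<close> is \<open>24 / gap 12\<close>. At \<open>\<mu>1 = - 12\<close> both sides
  contain \<open>24 / 0\<close>, which is 0.\<close>

lemma mu2_minus_eq: "mu2_minus \<mu>1 = branch \<mu>1 12"
proof -
  have "0 < 12 * res_mean 12 - 1" "0 < res_mean 12"
    using res_mean_gt[of 12] res_mean_pos[of 12] by auto
  then have "mu0 = 24 / gap 12"
    unfolding mu0_def gap_def a_s_11 diff_zero by (simp add: field_simps)
  then show ?thesis by (simp add: mu2_minus_def branch_def add.commute)
qed

text \<open>Each side of the pole carries at most one root. The piece adjacent to 12 has one iff
  \<open>\<mu>2\<close> is below the threshold value; for \<open>\<mu>1 \<le> - 12\<close> the piece
  right of the pole always has one.\<close>

lemma card_roots:
  assumes A: "(\<mu>1, \<mu>2) \<in> A_minus \<zeta>"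
  shows "finite (roots \<mu>1 \<mu>2) \<and> card (roots \<mu>1 \<mu>2) = \<zeta>"
proof (cases "- 12 < \<mu>1")
  case True
  have right: "0 < w + \<mu>1" if "w \<in> roots \<mu>1 \<mu>2" for w
    using that True by (simp add: roots_def)
  have "\<zeta> = 0 \<and> branch \<mu>1 12 < \<mu>2 \<or> \<zeta> = 1 \<and> \<mu>2 < branch \<mu>1 12"
    using A True by (auto simp: A_minus_def mu2_minus_eq split: if_splits)
  then show ?thesis
  proof (elim disjE conjE)
    assume "\<zeta> = 0" "branch \<mu>1 12 < \<mu>2"
    moreover have "0 < 12 + \<mu>1" using True by simp
    ultimately have "roots \<mu>1 \<mu>2 = {}" using branch_less_12 by force
    then show ?thesis using \<open>\<zeta> = 0\<close> by simp
  next
    assume "\<zeta> = 1" "\<mu>2 < branch \<mu>1 12"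
    moreover have "0 < 12 + \<mu>1" using True by simp
    ultimately obtain w where w: "w > 12" "branch \<mu>1 w = \<mu>2"
      using branch_attains[of 12 \<mu>1 \<mu>2] by blast
    then have "w \<in> roots \<mu>1 \<mu>2" using True by (simp add: roots_def)
    then have "roots \<mu>1 \<mu>2 = {w}" using right roots_same_side by blast
    then show ?thesis using \<open>\<zeta> = 1\<close> by simp
  qed
next
  case False
  then obtain v where v: "v > - \<mu>1" "branch \<mu>1 v = \<mu>2"
    using branch_attains_right[of \<mu>1 \<mu>2] by force
  have v_root: "v \<in> roots \<mu>1 \<mu>2" "0 < v + \<mu>1" using v False by (simp_all add: roots_def)
  have only_v: "roots \<mu>1 \<mu>2 = {v}" if "\<And>w. w \<in> roots \<mu>1 \<mu>2 \<Longrightarrow> 0 < w + \<mu>1"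
    using that v_root roots_same_side[of _ \<mu>1 \<mu>2 v] by blast
  show ?thesis
  proof (cases "\<mu>1 = - 12")
    case True
    then have "\<zeta> = 1" using A by (simp add: A_minus_def split: if_splits)
    \<comment> \<open>Here the pole sits at the threshold 12, so no root can lie to its
      left.\<close>
    moreover have "0 < w + \<mu>1" if "w \<in> roots \<mu>1 \<mu>2" for w
      using that True by (simp add: roots_def)
    ultimately show ?thesis using only_v by simp
  next
    case ne: False
    with False have lt: "\<mu>1 < - 12" by simp
    then have "\<zeta> = 1 \<and> branch \<mu>1 12 < \<mu>2 \<or> \<zeta> = 2 \<and> \<mu>2 < branch \<mu>1 12"
      using A by (auto simp: A_minus_def mu2_minus_eq split: if_splits)
    then show ?thesis
    proof (elim disjE conjE)
      assume "\<zeta> = 1" "branch \<mu>1 12 < \<mu>2"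
      have "0 < w + \<mu>1" if "w \<in> roots \<mu>1 \<mu>2" for w
      proof (rule ccontr)
        assume "\<not> 0 < w + \<mu>1"
        then have "w + \<mu>1 < 0" using that by (simp add: roots_def less_le)
        then show False using branch_less_12[OF that] \<open>branch \<mu>1 12 < \<mu>2\<close> by simp
      qed
      then show ?thesis using only_v \<open>\<zeta> = 1\<close> by simp
    next
      assume "\<zeta> = 2" "\<mu>2 < branch \<mu>1 12"
      then obtain u where u: "12 < u" "u < - \<mu>1" "branch \<mu>1 u = \<mu>2"
        using branch_attains_left[OF lt] by blast
      then have u_root: "u \<in> roots \<mu>1 \<mu>2" "\<not> 0 < u + \<mu>1" by (simp_all add: roots_def)
      have "roots \<mu>1 \<mu>2 = {u, v}"
        using u_root v_root roots_same_side[of _ \<mu>1 \<mu>2 u] roots_same_side[of _ \<mu>1 \<mu>2 v] by blast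
      moreover have "u \<noteq> v" using u v by simp
      ultimately show ?thesis using \<open>\<zeta> = 2\<close> by simp
    qed
  qed
qed

section \<open>Square integrable functions\<close>

lemma L2_measurable: "f \<in> L2 \<Longrightarrow> f \<in> borel_measurable torus3"
  and L2_integrable_sq: "f \<in> L2 \<Longrightarrow> integrable torus3 (\<lambda>p. (cmod (f p))\<^sup>2)"
  by (simp_all add: L2_def)

lemma L2_norm_nonneg [simp]: "0 \<le> L2_norm f"
  by (simp add: L2_norm_def)

lemma L2_norm_sq: "(L2_norm f)\<^sup>2 = (LINT p|torus3. (cmod (f p))\<^sup>2)"
  by (simp add: L2_norm_def)

lemma L2_norm_cmult: "L2_norm (\<lambda>p. c * f p) = cmod c * L2_norm f"
  by (simp add: L2_norm_def norm_mult power_mult_distrib real_sqrt_mult)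

lemma L2_norm_pos:
  assumes "f \<in> L2" "\<not> (AE p in torus3. f p = 0)"
  shows "0 < L2_norm f"
proof -
  have "(LINT p|torus3. (cmod (f p))\<^sup>2) \<noteq> 0"
    using assms L2_integrable_sq[of f] by (subst integral_nonneg_eq_0_iff_AE) auto
  then show ?thesis using L2_norm_sq[of f] L2_norm_nonneg[of f] by (auto simp: less_le)
qed

lemma cmod_add_sq_le: "(cmod (a + b))\<^sup>2 \<le> 2 * (cmod a)\<^sup>2 + 2 * (cmod b)\<^sup>2"
proof -
  have "(cmod (a + b))\<^sup>2 \<le> (cmod a + cmod b)\<^sup>2" by (simp add: norm_triangle_ineq power_mono)
  also have "\<dots> \<le> 2 * (cmod a)\<^sup>2 + 2 * (cmod b)\<^sup>2"
    using zero_le_power2[of "cmod a - cmod b"] by (simp add: power2_eq_square algebra_simps)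
  finally show ?thesis .
qed

lemma L2_add:
  assumes "f \<in> L2" "g \<in> L2"
  shows "(\<lambda>p. f p + g p) \<in> L2"
proof -
  have [measurable]: "f \<in> borel_measurable torus3" "g \<in> borel_measurable torus3"
    using assms L2_measurable by auto
  have "integrable torus3 (\<lambda>p. (cmod (f p + g p))\<^sup>2)"
    by (rule Bochner_Integration.integrable_bound[where f="\<lambda>p. 2 * (cmod (f p))\<^sup>2 + 2 * (cmod (g p))\<^sup>2"])
      (use assms cmod_add_sq_le in \<open>auto simp: L2_integrable_sq\<close>)
  then show ?thesis by (simp add: L2_def)
qed

lemma L2_norm_add_sq_le:
  assumes "f \<in> L2" "g \<in> L2"
  shows "(L2_norm (\<lambda>p. f p + g p))\<^sup>2 \<le> 2 * (L2_norm f)\<^sup>2 + 2 * (L2_norm g)\<^sup>2"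
proof -
  have "(LINT p|torus3. (cmod (f p + g p))\<^sup>2)
      \<le> (LINT p|torus3. 2 * (cmod (f p))\<^sup>2 + 2 * (cmod (g p))\<^sup>2)"
    using assms L2_integrable_sq[OF L2_add[OF assms]]
    by (intro integral_mono cmod_add_sq_le) (auto simp: L2_integrable_sq)
  then show ?thesis using assms by (simp add: L2_norm_sq L2_integrable_sq)
qed

lemma
  assumes f: "f \<in> L2" and [measurable]: "h \<in> borel_measurable torus3"
    and h: "\<And>p. cmod (h p) \<le> B"
  shows L2_bounded_mult: "(\<lambda>p. h p * f p) \<in> L2"
    and L2_norm_bounded_mult: "(L2_norm (\<lambda>p. h p * f p))\<^sup>2 \<le> B\<^sup>2 * (L2_norm f)\<^sup>2"
    and L2_bounded_mult_integrable: "integrable torus3 (\<lambda>p. h p * f p)"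
proof -
  have [measurable]: "f \<in> borel_measurable torus3" using f L2_measurable by auto
  have le: "(cmod (h p * f p))\<^sup>2 \<le> B\<^sup>2 * (cmod (f p))\<^sup>2" for p
    unfolding norm_mult power_mult_distrib by (intro mult_right_mono power_mono h) auto
  have int: "integrable torus3 (\<lambda>p. (cmod (h p * f p))\<^sup>2)"
    by (rule Bochner_Integration.integrable_bound[where f="\<lambda>p. B\<^sup>2 * (cmod (f p))\<^sup>2"])
      (use f le in \<open>auto simp: L2_integrable_sq\<close>)
  then show "(\<lambda>p. h p * f p) \<in> L2" by (simp add: L2_def)
  have "(LINT p|torus3. (cmod (h p * f p))\<^sup>2) \<le> (LINT p|torus3. B\<^sup>2 * (cmod (f p))\<^sup>2)"
    using f le int by (intro integral_mono) (auto simp: L2_integrable_sq)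
  then show "(L2_norm (\<lambda>p. h p * f p))\<^sup>2 \<le> B\<^sup>2 * (L2_norm f)\<^sup>2" by (simp add: L2_norm_sq)
  show "integrable torus3 (\<lambda>p. h p * f p)"
  proof (rule Bochner_Integration.integrable_bound[where f="\<lambda>p. 1 + (cmod (h p * f p))\<^sup>2"])
    \<comment> \<open>The torus has finite measure, so the constant 1 is integrable and square
      integrability implies integrability.\<close>
    have "x \<le> 1 + x\<^sup>2" for x :: real
      using zero_le_power2[of "x - 1 / 2"] by (simp add: power2_eq_square algebra_simps)
    then show "AE p in torus3. norm (h p * f p) \<le> norm (1 + (cmod (h p * f p))\<^sup>2)" by simp
  qed (use int in auto)
qed

lemma const_in_L2: "(\<lambda>p. c) \<in> L2"
  by (simp add: L2_def)

lemma L2_cmult: "f \<in> L2 \<Longrightarrow> (\<lambda>p. c * f p) \<in> L2"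
  by (rule L2_bounded_mult[where B="cmod c"]) auto

lemma bounded_in_L2:
  assumes "h \<in> borel_measurable torus3" "\<And>p. cmod (h p) \<le> B"
  shows "h \<in> L2"
  using L2_bounded_mult[OF const_in_L2[of 1] assms] by simp

lemma L2_integrable: "f \<in> L2 \<Longrightarrow> integrable torus3 f"
  using L2_bounded_mult_integrable[of f "\<lambda>_. 1" 1] by simp

text \<open>Cauchy-Schwarz against the constant function, obtained from nonnegativity of the
  variance of \<open>cmod (f p)\<close>.\<close>

lemma cmod_integral_sq_le:
  assumes "f \<in> L2"
  shows "(cmod (LINT p|torus3. f p))\<^sup>2 \<le> 8 * pi ^ 3 * (L2_norm f)\<^sup>2"
proof -
  let ?W = "8 * pi ^ 3 :: real" and ?I = "LINT p|torus3. cmod (f p)"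
  have W: "0 < ?W" by simp
  have int: "integrable torus3 (\<lambda>p. cmod (f p))" "integrable torus3 (\<lambda>p. (cmod (f p))\<^sup>2)"
    using L2_integrable[OF assms] L2_integrable_sq[OF assms] by auto
  have "0 \<le> (LINT p|torus3. (cmod (f p) - ?I / ?W)\<^sup>2)" by simp
  also have "\<dots> = (LINT p|torus3. (cmod (f p))\<^sup>2 - 2 * (?I / ?W) * cmod (f p) + (?I / ?W)\<^sup>2)"
    by (simp add: power2_diff algebra_simps)
  also have "\<dots> = (L2_norm f)\<^sup>2 - 2 * (?I / ?W) * ?I + ?W * (?I / ?W)\<^sup>2"
    using int by (simp add: L2_norm_sq mult.assoc)
  also have "\<dots> = (L2_norm f)\<^sup>2 - ?I\<^sup>2 / ?W"
  proof -
    have "L - 2 * (i / w) * i + w * (i / w)\<^sup>2 = L - i\<^sup>2 / w" if "0 < w" for L i w :: real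
      using that by (simp add: field_simps power2_eq_square)
    then show ?thesis using W .
  qed
  finally have "?I\<^sup>2 / ?W \<le> (L2_norm f)\<^sup>2" by simp
  then have "?I\<^sup>2 \<le> ?W * (L2_norm f)\<^sup>2" using W by (simp add: divide_le_eq mult.commute)
  moreover have "(cmod (LINT p|torus3. f p))\<^sup>2 \<le> ?I\<^sup>2"
    using integral_norm_bound[of torus3 f] by (intro power_mono) auto
  ultimately show ?thesis by linarith
qed

section \<open>Closure properties of the even and the symmetric subspace\<close>

lemma L2e_imp_L2: "f \<in> L2e \<Longrightarrow> f \<in> L2"
  by (simp add: L2e_def)

lemma L2e_add: "f \<in> L2e \<Longrightarrow> g \<in> L2e \<Longrightarrow> (\<lambda>p. f p + g p) \<in> L2e"
  unfolding L2e_def by (auto intro: L2_add)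

lemma L2e_bounded_mult:
  assumes "f \<in> L2e" "h \<in> borel_measurable torus3" "\<And>p. cmod (h p) \<le> B" "\<And>p. h (- p) = h p"
  shows "(\<lambda>p. h p * f p) \<in> L2e"
  using assms L2_bounded_mult[of f h B] unfolding L2e_def by (auto elim: eventually_mono)

lemma L2e_cmult: "f \<in> L2e \<Longrightarrow> (\<lambda>p. c * f p) \<in> L2e"
  by (rule L2e_bounded_mult[where B="cmod c"]) auto

lemma L2e_sum:
  assumes "\<And>i. i \<in> I \<Longrightarrow> f i \<in> L2e"
  shows "(\<lambda>p. \<Sum>i\<in>I. f i p) \<in> L2e"
  using assms
proof (induction I rule: infinite_finite_induct)
  case (insert i I)
  then show ?case using L2e_add[of "f i" "\<lambda>p. \<Sum>i\<in>I. f i p"] by simp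
qed (auto simp: L2e_def const_in_L2)

lemma bounded_in_L2e:
  assumes "h \<in> borel_measurable torus3" "\<And>p. cmod (h p) \<le> B" "\<And>p. h (- p) = h p"
  shows "h \<in> L2e"
  using bounded_in_L2[OF assms(1,2)] assms(3) by (simp add: L2e_def)

lemma L2es_imp_L2e: "f \<in> L2es \<Longrightarrow> f \<in> L2e"
  by (simp add: L2es_def)

lemma L2es_cmult: "f \<in> L2es \<Longrightarrow> (\<lambda>p. c * f p) \<in> L2es"
  unfolding L2es_def by (auto intro: L2e_cmult elim!: allE elim: eventually_mono)

lemma csum_function_in_L2es:
  assumes "h \<in> borel_measurable borel" "\<And>p. cmod (h (csum p)) \<le> B"
  shows "(\<lambda>p. h (csum p)) \<in> L2es"
proof -
  have "(\<lambda>p. h (csum p)) \<in> borel_measurable torus3"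
    using measurable_compose[OF csum_measurable assms(1)] .
  then have "(\<lambda>p. h (csum p)) \<in> L2e" using assms(2) by (intro bounded_in_L2e) auto
  then show ?thesis by (simp add: L2es_def csum_permute)
qed

section \<open>The essential spectrum\<close>

text \<open>\<open>None\<close> indexes the constant mode.\<close>

definition mode :: "3 option \<Rightarrow> real^3 \<Rightarrow> real" where
  "mode k p = (case k of None \<Rightarrow> 1 | Some i \<Rightarrow> cos (p $ i))"

definition coupling :: "real \<Rightarrow> real \<Rightarrow> 3 option \<Rightarrow> real" where
  "coupling \<mu>1 \<mu>2 k = (case k of None \<Rightarrow> \<mu>1 / (2 * pi) ^ 3 | Some i \<Rightarrow> 2 * \<mu>2 / (2 * pi) ^ 3)"

definition mode_coeff :: "(real^3 \<Rightarrow> complex) \<Rightarrow> complex^(3 option)" where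
  "mode_coeff f = (\<chi> k. LINT q|torus3. of_real (mode k q) * f q)"

definition mode_sum :: "real \<Rightarrow> real \<Rightarrow> complex^(3 option) \<Rightarrow> real^3 \<Rightarrow> complex" where
  "mode_sum \<mu>1 \<mu>2 x p = (\<Sum>k\<in>UNIV. of_real (coupling \<mu>1 \<mu>2 k * mode k p) * x $ k)"

text \<open>\<open>bs_matrix\<close> is \<open>1 + G D\<close> with \<open>G\<close> the compression of \<open>(E0 - z)\<inverse>\<close> to the modes and \<open>D\<close>
  the diagonal matrix of the couplings.\<close>

definition bs_matrix :: "real \<Rightarrow> real \<Rightarrow> complex \<Rightarrow> complex^(3 option)^(3 option)" where
  "bs_matrix \<mu>1 \<mu>2 z = (\<chi> k l. (if k = l then 1 else 0) +
     of_real (coupling \<mu>1 \<mu>2 l) * mode_coeff (\<lambda>p. of_real (mode l p) / (of_real (E0 p) - z)) $ k)"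

abbreviation (input) band :: "complex set" where
  "band \<equiv> complex_of_real ` {0..24}"

text \<open>The finite rank factorization: the potential sees \<open>f\<close> only through its four
  mode coefficients.\<close>

lemma V_op_mode_sum: "V_op \<mu>1 \<mu>2 f p = mode_sum \<mu>1 \<mu>2 (mode_coeff f) p"
  by (simp add: V_op_def mode_sum_def mode_coeff_def mode_def coupling_def UNIV_option_conv
      sum.reindex sum_distrib_left mult.assoc)

lemma mode_bound: "\<bar>mode k p\<bar> \<le> 1"
  by (simp add: mode_def split: option.split)

lemma mode_uminus [simp]: "mode k (- p) = mode k p"
  by (simp add: mode_def split: option.split)

lemma continuous_on_mode: "continuous_on A (mode k)"
  by (cases k) (auto simp: mode_def intro!: continuous_intros)

lemma mode_measurable [measurable]: "mode k \<in> borel_measurable torus3"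
  by (intro continuous_measurable_torus3 continuous_on_mode)

lemma mode_mult_integrable: "f \<in> L2 \<Longrightarrow> integrable torus3 (\<lambda>p. of_real (mode k p) * f p)"
  by (rule L2_bounded_mult_integrable[where B=1]) (auto simp: mode_bound)

lemma mode_coeff_cong:
  assumes "f \<in> L2" "g \<in> L2" "AE p in torus3. f p = g p"
  shows "mode_coeff f = mode_coeff g"
proof -
  have [measurable]: "f \<in> borel_measurable torus3" "g \<in> borel_measurable torus3"
    using assms L2_measurable by auto
  show ?thesis unfolding mode_coeff_def vec_eq_iff vec_lambda_beta
    by (intro allI integral_cong_AE) (use assms(3) in \<open>auto elim: eventually_mono\<close>)
qed

lemma cmod_mode_coeff_sq_le:
  assumes "f \<in> L2"
  shows "(cmod (mode_coeff f $ k))\<^sup>2 \<le> 8 * pi ^ 3 * (L2_norm f)\<^sup>2"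
proof -
  have m: "(\<lambda>p. complex_of_real (mode k p)) \<in> borel_measurable torus3" by measurable
  have b: "cmod (complex_of_real (mode k p)) \<le> 1" for p by (simp add: mode_bound)
  have L2: "(\<lambda>p. of_real (mode k p) * f p) \<in> L2"
    and "(L2_norm (\<lambda>p. of_real (mode k p) * f p))\<^sup>2 \<le> 1\<^sup>2 * (L2_norm f)\<^sup>2"
    by (rule L2_bounded_mult[OF assms m b] L2_norm_bounded_mult[OF assms m b])+
  then have "8 * pi ^ 3 * (L2_norm (\<lambda>p. of_real (mode k p) * f p))\<^sup>2 \<le> 8 * pi ^ 3 * (L2_norm f)\<^sup>2"
    by (intro mult_left_mono) auto
  with cmod_integral_sq_le[OF L2] show ?thesis
    unfolding mode_coeff_def vec_lambda_beta by (rule order_trans)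
qed

lemma mode_coeff_sum:
  assumes "\<And>i. i \<in> I \<Longrightarrow> f i \<in> L2"
  shows "mode_coeff (\<lambda>p. \<Sum>i\<in>I. c i * f i p) = (\<Sum>i\<in>I. c i *s mode_coeff (f i))"
proof -
  have "(LINT q|torus3. of_real (mode k q) * (\<Sum>i\<in>I. c i * f i q))
      = (\<Sum>i\<in>I. c i * (LINT q|torus3. of_real (mode k q) * f i q))" for k
  proof -
    have "(LINT q|torus3. of_real (mode k q) * (\<Sum>i\<in>I. c i * f i q))
        = (LINT q|torus3. (\<Sum>i\<in>I. c i * (of_real (mode k q) * f i q)))"
      by (simp add: sum_distrib_left mult.left_commute)
    then show ?thesis
      using assms mode_mult_integrable by (simp add: Bochner_Integration.integral_sum)
  qed
  then show ?thesis by (simp add: mode_coeff_def vec_eq_iff)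
qed

lemma mode_coeff_diff:
  assumes "f \<in> L2" "g \<in> L2"
  shows "mode_coeff (\<lambda>p. f p - g p) = mode_coeff f - mode_coeff g"
  using mode_mult_integrable[OF assms(1)] mode_mult_integrable[OF assms(2)]
  by (simp add: mode_coeff_def vec_eq_iff right_diff_distrib)

lemma mode_sum_in_L2e: "mode_sum \<mu>1 \<mu>2 x \<in> L2e"
proof -
  have "(\<lambda>p. \<Sum>k\<in>UNIV. (of_real (coupling \<mu>1 \<mu>2 k) * x $ k) * of_real (mode k p)) \<in> L2e"
    by (intro L2e_sum L2e_cmult bounded_in_L2e[where B=1]) (auto simp: mode_bound)
  then show ?thesis unfolding mode_sum_def by (simp add: mult_ac)
qed

lemma mode_sum_bound:
  "cmod (mode_sum \<mu>1 \<mu>2 x p) \<le> (\<Sum>k\<in>UNIV. \<bar>coupling \<mu>1 \<mu>2 k\<bar>) * norm x"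
proof -
  have "cmod (mode_sum \<mu>1 \<mu>2 x p) \<le> (\<Sum>k\<in>UNIV. cmod (of_real (coupling \<mu>1 \<mu>2 k * mode k p) * x $ k))"
    unfolding mode_sum_def by (rule norm_sum)
  also have "\<dots> \<le> (\<Sum>k\<in>UNIV. \<bar>coupling \<mu>1 \<mu>2 k\<bar> * norm x)"
  proof (rule sum_mono)
    fix k
    have "\<bar>coupling \<mu>1 \<mu>2 k\<bar> * \<bar>mode k p\<bar> \<le> \<bar>coupling \<mu>1 \<mu>2 k\<bar>"
      using mode_bound[of k p] by (intro mult_left_le) auto
    then have "\<bar>coupling \<mu>1 \<mu>2 k\<bar> * \<bar>mode k p\<bar> * cmod (x $ k) \<le> \<bar>coupling \<mu>1 \<mu>2 k\<bar> * norm x"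
      by (intro mult_mono Finite_Cartesian_Product.norm_nth_le) simp_all
    then show "cmod (of_real (coupling \<mu>1 \<mu>2 k * mode k p) * x $ k) \<le> \<bar>coupling \<mu>1 \<mu>2 k\<bar> * norm x"
      by (simp add: norm_mult abs_mult)
  qed
  finally show ?thesis by (simp add: sum_distrib_right)
qed

lemma H_op_shift_in_L2e:
  assumes "f \<in> L2e"
  shows "(\<lambda>p. H_op \<mu>1 \<mu>2 f p - z * f p) \<in> L2e"
proof -
  have "(\<lambda>p. (of_real (E0 p) - z) * f p) \<in> L2e"
  proof (rule L2e_bounded_mult[where B="24 + cmod z", OF assms])
    fix p
    have "cmod (of_real (E0 p) - z) \<le> cmod (of_real (E0 p)) + cmod z" by (rule norm_triangle_ineq4)
    then show "cmod (of_real (E0 p) - z) \<le> 24 + cmod z" using E0_bounds[of p] by simp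
    show "of_real (E0 (- p)) - z = of_real (E0 p) - z" by (simp add: E0_csum)
  qed measurable
  from L2e_add[OF this mode_sum_in_L2e[of \<mu>1 \<mu>2 "mode_coeff f"]] show ?thesis
    by (simp add: H_op_def V_op_mode_sum algebra_simps)
qed

lemma band_dist:
  assumes "z \<notin> band"
  obtains d where "0 < d" "\<And>p. d \<le> cmod (of_real (E0 p) - z)"
proof -
  have "compact band"
    by (intro compact_continuous_image continuous_intros) auto
  then obtain d where d: "0 < d" "\<And>x. x \<in> band \<Longrightarrow> d \<le> dist z x"
    using separate_point_closed[of band z] assms compact_imp_closed by blast
  have "d \<le> cmod (of_real (E0 p) - z)" for p
    using d(2)[of "of_real (E0 p)"] E0_bounds[of p] by (simp add: dist_norm norm_minus_commute)
  with d(1) show ?thesis by (rule that)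
qed

section \<open>Reduction off the band to a matrix equation\<close>

context
  fixes \<mu>1 \<mu>2 :: real and z :: complex
  assumes z: "z \<notin> band"
begin

lemma E0_ne: "of_real (E0 p) - z \<noteq> 0"
  using z E0_bounds[of p] by force

lemma resolvent_mult_bound:
  obtains d where "0 < d"
    "\<And>f. f \<in> L2 \<Longrightarrow> (L2_norm (\<lambda>p. f p / (of_real (E0 p) - z)))\<^sup>2 \<le> (1 / d)\<^sup>2 * (L2_norm f)\<^sup>2"
    "\<And>f. f \<in> L2e \<Longrightarrow> (\<lambda>p. f p / (of_real (E0 p) - z)) \<in> L2e"
proof -
  obtain d where d: "0 < d" "\<And>p. d \<le> cmod (of_real (E0 p) - z)"
    using band_dist[OF z] by blast
  have b: "cmod (1 / (of_real (E0 p) - z)) \<le> 1 / d" for p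
    using d(1) d(2)[of p] by (simp add: norm_divide frac_le)
  show ?thesis
  proof (rule that[OF d(1)])
    show "(L2_norm (\<lambda>p. f p / (of_real (E0 p) - z)))\<^sup>2 \<le> (1 / d)\<^sup>2 * (L2_norm f)\<^sup>2" if "f \<in> L2" for f
      using L2_norm_bounded_mult[OF that _ b] by simp
    show "(\<lambda>p. f p / (of_real (E0 p) - z)) \<in> L2e" if "f \<in> L2e" for f
      using L2e_bounded_mult[OF that _ b] by (simp add: E0_csum)
  qed
qed

lemma resolvent_mult_in_L2e: "f \<in> L2e \<Longrightarrow> (\<lambda>p. f p / (of_real (E0 p) - z)) \<in> L2e"
  using resolvent_mult_bound by blast

text \<open>The candidate for the preimage of \<open>g\<close> under \<open>H - z\<close> when the
  mode coefficients are prescribed to be \<open>x\<close>; it is a true solution once its own mode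
  coefficients are \<open>x\<close>.\<close>

definition solution :: "(real^3 \<Rightarrow> complex) \<Rightarrow> complex^(3 option) \<Rightarrow> real^3 \<Rightarrow> complex" where
  "solution g x p = (g p - mode_sum \<mu>1 \<mu>2 x p) / (of_real (E0 p) - z)"

lemma solution_in_L2e: "g \<in> L2e \<Longrightarrow> solution g x \<in> L2e"
proof -
  assume "g \<in> L2e"
  then have "(\<lambda>p. g p + - 1 * mode_sum \<mu>1 \<mu>2 x p) \<in> L2e"
    by (intro L2e_add L2e_cmult mode_sum_in_L2e)
  from resolvent_mult_in_L2e[OF this] show ?thesis
    unfolding solution_def by (simp add: diff_conv_add_uminus del: add_uminus_conv_diff)
qed

text \<open>Consistency of the candidate thus amounts to the linear system with matrix
  \<open>bs_matrix\<close> whose right side is the coefficient vector of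
  \<open>g / (E0 - z)\<close>.\<close>

lemma mode_coeff_solution:
  assumes "g \<in> L2e"
  shows "mode_coeff (solution g x)
    = mode_coeff (\<lambda>p. g p / (of_real (E0 p) - z)) + x - bs_matrix \<mu>1 \<mu>2 z *v x"
proof -
  let ?r = "\<lambda>l p. of_real (mode l p) / (of_real (E0 p) - z)"
  let ?c = "\<lambda>l. of_real (coupling \<mu>1 \<mu>2 l) * x $ l"
  have r: "?r l \<in> L2" for l
    by (intro L2e_imp_L2 resolvent_mult_in_L2e bounded_in_L2e[where B=1]) (auto simp: mode_bound)
  have g: "(\<lambda>p. g p / (of_real (E0 p) - z)) \<in> L2"
    using assms resolvent_mult_in_L2e L2e_imp_L2 by blast
  have "mode_coeff (solution g x)
      = mode_coeff (\<lambda>p. g p / (of_real (E0 p) - z) - (\<Sum>l\<in>UNIV. ?c l * ?r l p))"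
    unfolding solution_def mode_sum_def
    by (intro arg_cong[where f=mode_coeff] ext) (simp add: diff_divide_distrib sum_divide_distrib mult_ac)
  also have "\<dots> = mode_coeff (\<lambda>p. g p / (of_real (E0 p) - z))
      - mode_coeff (\<lambda>p. \<Sum>l\<in>UNIV. ?c l * ?r l p)"
  proof (rule mode_coeff_diff[OF g])
    have "(\<lambda>p. \<Sum>l\<in>UNIV. ?c l * ?r l p) \<in> L2e"
      by (intro L2e_sum L2e_cmult resolvent_mult_in_L2e bounded_in_L2e[where B=1])
        (auto simp: mode_bound)
    then show "(\<lambda>p. \<Sum>l\<in>UNIV. ?c l * ?r l p) \<in> L2" by (rule L2e_imp_L2)
  qed
  also have "mode_coeff (\<lambda>p. \<Sum>l\<in>UNIV. ?c l * ?r l p) = (\<Sum>l\<in>UNIV. ?c l *s mode_coeff (?r l))"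
    using r by (rule mode_coeff_sum)
  also have "(\<Sum>l\<in>UNIV. ?c l *s mode_coeff (?r l)) = bs_matrix \<mu>1 \<mu>2 z *v x - x"
  proof -
    have "(\<Sum>l\<in>UNIV. x $ l * (if k = l then 1 else 0)) = x $ k" for k
      by (simp add: if_distrib[of "\<lambda>t. _ * t"] cong: if_cong)
    then show ?thesis
      by (simp add: vec_eq_iff matrix_vector_mult_def bs_matrix_def distrib_left distrib_right
          sum.distrib mult_ac)
  qed
  finally show ?thesis by (simp add: algebra_simps)
qed

lemma H_op_shift_eq_iff:
  "H_op \<mu>1 \<mu>2 f p - z * f p = g p \<longleftrightarrow> f p = solution g (mode_coeff f) p"
  unfolding solution_def H_op_def V_op_mode_sum using E0_ne[of p]
  by (auto simp: eq_divide_eq algebra_simps)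

lemma bs_matrix_mode_coeff:
  assumes "f \<in> L2e" "g \<in> L2e" "AE p in torus3. f p = solution g (mode_coeff f) p"
  shows "bs_matrix \<mu>1 \<mu>2 z *v mode_coeff f = mode_coeff (\<lambda>p. g p / (of_real (E0 p) - z))"
proof -
  have "mode_coeff f = mode_coeff (solution g (mode_coeff f))"
    using assms by (intro mode_coeff_cong L2e_imp_L2 solution_in_L2e)
  then show ?thesis using mode_coeff_solution[OF assms(2)] by (simp add: algebra_simps)
qed

text \<open>The inverse matrix produces consistent coefficients for every \<open>g\<close>, which
  gives a solution; conversely it bounds the coefficients of any \<open>f\<close> by the norm of
  \<open>(H - z) f\<close>, which gives the lower bound.\<close>

lemma in_resolvent_set:
  assumes "det (bs_matrix \<mu>1 \<mu>2 z) \<noteq> 0"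
  shows "z \<in> resolvent_set (H_op \<mu>1 \<mu>2) L2e"
proof -
  obtain B where B: "bs_matrix \<mu>1 \<mu>2 z ** B = mat 1" "B ** bs_matrix \<mu>1 \<mu>2 z = mat 1"
    using assms by (metis invertible_det_nz invertible_def)
  have surj: "\<exists>f\<in>L2e. AE p in torus3. H_op \<mu>1 \<mu>2 f p - z * f p = g p" if g: "g \<in> L2e" for g
  proof -
    define x where "x = B *v mode_coeff (\<lambda>p. g p / (of_real (E0 p) - z))"
    have "bs_matrix \<mu>1 \<mu>2 z *v x = mode_coeff (\<lambda>p. g p / (of_real (E0 p) - z))"
      by (simp add: x_def matrix_vector_mul_assoc B)
    then have "mode_coeff (solution g x) = x" using mode_coeff_solution[OF g, of x] by simp
    then show ?thesis
      by (intro bexI[of _ "solution g x"] AE_I2)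
        (simp_all add: H_op_shift_eq_iff[of _ _ g] solution_in_L2e g)
  qed
  obtain d where d: "0 < d"
    "\<And>f. f \<in> L2 \<Longrightarrow> (L2_norm (\<lambda>p. f p / (of_real (E0 p) - z)))\<^sup>2 \<le> (1 / d)\<^sup>2 * (L2_norm f)\<^sup>2"
    "\<And>f. f \<in> L2e \<Longrightarrow> (\<lambda>p. f p / (of_real (E0 p) - z)) \<in> L2e"
    using resolvent_mult_bound by blast
  let ?W = "8 * pi ^ 3 :: real"
  \<comment> \<open>\<open>S\<close> bounds the potential term by the coefficient vector,
    \<open>C\<close> is the norm of the inverse matrix, and \<open>N\<close> bounds the coefficients
    of \<open>g / (E0 - z)\<close> by the norm of \<open>g\<close>. The factors 2 in
    \<open>K\<close> come from \<open>L2_norm_add_sq_le\<close>.\<close>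
  define S where "S = (\<Sum>k\<in>UNIV. \<bar>coupling \<mu>1 \<mu>2 k\<bar>)"
  define C where "C = onorm ((*v) B)"
  define N where "N = (\<Sum>k\<in>(UNIV :: 3 option set). sqrt (?W * (1 / d)\<^sup>2))"
  define K where "K = (1 / d)\<^sup>2 * (2 + 2 * (?W * (S * (C * N))\<^sup>2))"
  have "L2_norm f \<le> sqrt K * L2_norm (\<lambda>p. H_op \<mu>1 \<mu>2 f p - z * f p)" if f: "f \<in> L2e" for f
  proof -
    let ?g = "\<lambda>p. H_op \<mu>1 \<mu>2 f p - z * f p"
    let ?y = "mode_coeff (\<lambda>p. ?g p / (of_real (E0 p) - z))" and ?x = "mode_coeff f"
    have g: "?g \<in> L2e" using f by (rule H_op_shift_in_L2e)
    have sol: "f p = solution ?g ?x p" for p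
      using H_op_shift_eq_iff[of f p ?g] by simp
    have "?x = B *v ?y"
      using bs_matrix_mode_coeff[OF f g AE_I2[OF sol], symmetric]
      by (simp add: matrix_vector_mul_assoc B)
    then have x: "norm ?x \<le> C * norm ?y"
      unfolding C_def by (simp add: onorm[OF matrix_vector_mul_bounded_linear])
    have "norm ?y \<le> (\<Sum>k\<in>UNIV. cmod (?y $ k))"
      unfolding norm_vec_def by (rule L2_set_le_sum) simp
    also have "\<dots> \<le> (\<Sum>k\<in>(UNIV :: 3 option set). sqrt (?W * (1 / d)\<^sup>2) * L2_norm ?g)"
    proof (rule sum_mono)
      fix k
      have "(cmod (?y $ k))\<^sup>2 \<le> ?W * (L2_norm (\<lambda>p. ?g p / (of_real (E0 p) - z)))\<^sup>2"
        using d(3)[OF g] by (intro cmod_mode_coeff_sq_le L2e_imp_L2)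
      also have "\<dots> \<le> ?W * ((1 / d)\<^sup>2 * (L2_norm ?g)\<^sup>2)"
        using d(2)[OF L2e_imp_L2[OF g]] by (intro mult_left_mono) auto
      finally have "sqrt ((cmod (?y $ k))\<^sup>2) \<le> sqrt (?W * (1 / d)\<^sup>2 * (L2_norm ?g)\<^sup>2)"
        by (subst real_sqrt_le_iff) (simp only: mult.assoc)
      then show "cmod (?y $ k) \<le> sqrt (?W * (1 / d)\<^sup>2) * L2_norm ?g"
        by (simp only: real_sqrt_mult real_sqrt_abs abs_of_nonneg[OF L2_norm_nonneg] abs_norm_cancel)
    qed
    finally have y: "norm ?y \<le> N * L2_norm ?g" unfolding N_def by (simp only: sum_distrib_right)
    have "0 \<le> C" unfolding C_def by (rule onorm_pos_le[OF matrix_vector_mul_bounded_linear])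
    then have xy: "norm ?x \<le> C * N * L2_norm ?g"
      using x mult_left_mono[OF y] by (fastforce simp: mult.assoc)
    have "0 \<le> S" unfolding S_def by (rule sum_nonneg) simp
    have s: "mode_sum \<mu>1 \<mu>2 ?x \<in> L2" by (intro L2e_imp_L2 mode_sum_in_L2e)
    have "(L2_norm (mode_sum \<mu>1 \<mu>2 ?x))\<^sup>2 \<le> (LINT p|torus3. (S * (C * N) * L2_norm ?g)\<^sup>2)"
      unfolding L2_norm_sq
    proof (rule integral_mono)
      fix p
      have "cmod (mode_sum \<mu>1 \<mu>2 ?x p) \<le> S * norm ?x" unfolding S_def by (rule mode_sum_bound)
      also have "\<dots> \<le> S * (C * N) * L2_norm ?g"
        using mult_left_mono[OF xy \<open>0 \<le> S\<close>] by (simp only: mult.assoc)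
      finally show "(cmod (mode_sum \<mu>1 \<mu>2 ?x p))\<^sup>2 \<le> (S * (C * N) * L2_norm ?g)\<^sup>2"
        by (intro power_mono) auto
    qed (use s L2_integrable_sq in auto)
    then have ms: "(L2_norm (mode_sum \<mu>1 \<mu>2 ?x))\<^sup>2 \<le> ?W * (S * (C * N))\<^sup>2 * (L2_norm ?g)\<^sup>2"
      by (simp add: power_mult_distrib mult_ac)
    have "(L2_norm f)\<^sup>2 = (L2_norm (\<lambda>p. (?g p + - 1 * mode_sum \<mu>1 \<mu>2 ?x p) / (of_real (E0 p) - z)))\<^sup>2"
      using sol by (intro arg_cong[where f="\<lambda>f. (L2_norm f)\<^sup>2"]) (auto simp: solution_def)
    also have "\<dots> \<le> (1 / d)\<^sup>2 * (L2_norm (\<lambda>p. ?g p + - 1 * mode_sum \<mu>1 \<mu>2 ?x p))\<^sup>2"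
      by (intro d(2) L2_add L2_cmult s L2e_imp_L2[OF g])
    also have "\<dots> \<le> (1 / d)\<^sup>2 * (2 * (L2_norm ?g)\<^sup>2 + 2 * (L2_norm (\<lambda>p. - 1 * mode_sum \<mu>1 \<mu>2 ?x p))\<^sup>2)"
      by (intro mult_left_mono L2_norm_add_sq_le L2_cmult s L2e_imp_L2[OF g]) simp
    also have "\<dots> \<le> (1 / d)\<^sup>2 * (2 * (L2_norm ?g)\<^sup>2 + 2 * (?W * (S * (C * N))\<^sup>2 * (L2_norm ?g)\<^sup>2))"
      unfolding L2_norm_cmult using ms by (intro mult_left_mono add_left_mono) simp_all
    also have "\<dots> = K * (L2_norm ?g)\<^sup>2" by (simp add: K_def algebra_simps)
    finally have "sqrt ((L2_norm f)\<^sup>2) \<le> sqrt (K * (L2_norm ?g)\<^sup>2)" by (subst real_sqrt_le_iff)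
    then show ?thesis by (simp add: real_sqrt_mult)
  qed
  with surj show ?thesis unfolding resolvent_set_def by blast
qed

text \<open>A kernel vector is the coefficient vector of its own candidate with
  \<open>g = 0\<close>; being nonzero, it prevents the candidate from being null.\<close>

lemma is_eigenvalue_L2e:
  assumes "det (bs_matrix \<mu>1 \<mu>2 z) = 0"
  shows "is_eigenvalue (H_op \<mu>1 \<mu>2) L2e z"
proof -
  obtain x where x: "bs_matrix \<mu>1 \<mu>2 z *v x = 0" "x \<noteq> 0"
    using assms by (metis invertible_det_nz invertible_left_inverse matrix_left_invertible_ker)
  have zero: "(\<lambda>p. 0) \<in> L2e" by (simp add: L2e_def const_in_L2)
  let ?f = "solution (\<lambda>p. 0) x"
  have "mode_coeff (\<lambda>p. 0) = 0" by (simp add: mode_coeff_def vec_eq_iff)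
  then have c: "mode_coeff ?f = x" using mode_coeff_solution[OF zero, of x] x by simp
  have f: "?f \<in> L2e" using zero by (rule solution_in_L2e)
  have "H_op \<mu>1 \<mu>2 ?f p = z * ?f p" for p
    using H_op_shift_eq_iff[of ?f p "\<lambda>p. 0"] by (simp add: c)
  moreover have "\<not> (AE p in torus3. ?f p = 0)"
    using mode_coeff_cong[of ?f "\<lambda>p. 0"] c x(2) \<open>mode_coeff (\<lambda>p. 0) = 0\<close> L2e_imp_L2[OF f] const_in_L2
    by auto
  ultimately show ?thesis
    using f by (auto simp: is_eigenvalue_def is_eigenfunction_def eigenspace_def)
qed

text \<open>An eigenfunction depends linearly on its four mode coefficients, so every relation
  between coefficient vectors is a relation between eigenfunctions, and independence passes to the
  coefficient space.\<close>

lemma AE_independent_eigenspace_le: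
  assumes b: "\<forall>i<n. b i \<in> eigenspace (H_op \<mu>1 \<mu>2) L2e z" and indep: "AE_independent n b"
  shows "n \<le> CARD(3 option)"
proof -
  let ?v = "\<lambda>i. mode_coeff (b i)"
  have L2e: "b i \<in> L2e" if "i < n" for i using b that by (auto simp: eigenspace_def)
  have sol: "AE p in torus3. b i p = solution (\<lambda>p. 0) (?v i) p" if "i < n" for i
  proof -
    have "AE p in torus3. H_op \<mu>1 \<mu>2 (b i) p = z * b i p" using b that by (auto simp: eigenspace_def)
    then show ?thesis by eventually_elim (simp flip: H_op_shift_eq_iff)
  qed
  have c0: "c i = 0" if c: "(\<Sum>i<n. c i *s ?v i) = 0" and i: "i < n" for c i
  proof -
    have "AE p in torus3. \<forall>i\<in>{..<n}. b i p = solution (\<lambda>p. 0) (?v i) p"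
      using sol by (subst AE_ball_countable) auto
    then have "AE p in torus3. (\<Sum>i<n. c i * b i p) = 0"
    proof eventually_elim
      case (elim p)
      have "(\<Sum>i<n. c i * b i p) = (\<Sum>i<n. c i * solution (\<lambda>p. 0) (?v i) p)"
        using elim by simp
      also have "\<dots> = solution (\<lambda>p. 0) (\<Sum>i<n. c i *s ?v i) p"
        unfolding solution_def mode_sum_def sum_component vector_smult_component
        by (simp add: sum_distrib_left sum_divide_distrib sum_negf sum.swap[of _ UNIV] mult_ac)
      finally show ?case using c by (simp add: solution_def mode_sum_def)
    qed
    then show ?thesis using indep i by (auto simp: AE_independent_def)
  qed
  \<comment> \<open>\<open>vec.independent\<close> speaks of sets, so coinciding vectors are
    excluded first; their difference would be a nontrivial relation.\<close>
  have inj: "inj_on ?v {..<n}"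
  proof (rule inj_onI, rule ccontr)
    fix i j assume ij: "i \<in> {..<n}" "j \<in> {..<n}" "?v i = ?v j" "i \<noteq> j"
    have "(\<Sum>k<n. (if k = i then 1 else if k = j then - 1 else 0) *s ?v k)
        = (\<Sum>k\<in>{i, j}. (if k = i then 1 else if k = j then - 1 else 0) *s ?v k)"
      using ij by (intro sum.mono_neutral_right) auto
    also have "\<dots> = 0" using ij by simp
    finally show False using c0[of "\<lambda>k. if k = i then 1 else if k = j then - 1 else 0" i] ij by simp
  qed
  have "vec.independent (?v ` {..<n})"
  proof (rule vec.independent_if_scalars_zero)
    fix u x assume "(\<Sum>x\<in>?v ` {..<n}. u x *s x) = 0" "x \<in> ?v ` {..<n}"
    then show "u x = 0" using c0[of "\<lambda>i. u (?v i)"] by (auto simp: sum.reindex[OF inj])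
  qed simp
  then have "card (?v ` {..<n}) \<le> vec.dim (?v ` {..<n})"
    using vec.independent_bound_general by blast
  then show ?thesis using dim_subset_UNIV_cart_gen[of "?v ` {..<n}"] by (simp add: card_image[OF inj])
qed

lemma multiplicity_L2e_finite: "multiplicity_of (H_op \<mu>1 \<mu>2) L2e z < \<infinity>"
proof -
  have "AE_dim (eigenspace (H_op \<mu>1 \<mu>2) L2e z) \<le> enat (CARD(3 option))"
    unfolding AE_dim_def using AE_independent_eigenspace_le by (intro SUP_least) auto
  then show ?thesis unfolding multiplicity_of_def using enat_ord_simps(4) le_less_trans by blast
qed

end

section \<open>Isolation of the spectrum off the band by analyticity\<close>

lemma integral_torus3_eq_integral:
  fixes f :: "real^3 \<Rightarrow> complex"
  assumes "continuous_on cube3 f"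
  shows "(LINT p|torus3. f p) = integral cube3 f"
proof -
  have "set_integrable lborel cube3 f"
    unfolding set_integrable_def by (rule borel_integrable_compact[OF compact_cbox assms])
  then show ?thesis
    unfolding torus3_def
    by (subst integral_restrict_space) (auto simp flip: set_lebesgue_integral_def
        intro: set_borel_integral_eq_integral(2))
qed

text \<open>Differentiation under the integral, carried out in the gauge integral over the compact
  cube; on a ball avoiding the band the derivative of the integrand is jointly continuous.\<close>

lemma holomorphic_on_mode_coeff_resolvent:
  "(\<lambda>z. mode_coeff (\<lambda>p. of_real (mode l p) / (of_real (E0 p) - z)) $ k) holomorphic_on (- band)"
proof -
  let ?f = "\<lambda>z p. of_real (mode k p) * (of_real (mode l p) / (of_real (E0 p) - z))"
  let ?f' = "\<lambda>z p. of_real (mode k p) * (of_real (mode l p) / (of_real (E0 p) - z)\<^sup>2)"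
  have op: "open (- band)"
    by (intro open_Compl compact_imp_closed compact_continuous_image continuous_intros) auto
  have cont: "continuous_on A (\<lambda>p. complex_of_real (E0 p))" "continuous_on A (\<lambda>p. complex_of_real (mode j p))"
    for A j
    by (intro continuous_on_of_real continuous_on_E0 continuous_on_mode)+
  have "(\<lambda>z. integral cube3 (?f z)) field_differentiable (at z)" if z: "z \<in> - band" for z
  proof -
    obtain r where r: "0 < r" "ball z r \<subseteq> - band" using op z open_contains_ball by blast
    have ne: "of_real (E0 p) - y \<noteq> 0" if "y \<in> ball z r" for y p
      using that r(2) by (intro E0_ne) auto
    have "(\<lambda>z. integral cube3 (?f z)) holomorphic_on ball z r"
    proof (rule leibniz_rule_holomorphic[where fx="?f'"])
      show "((\<lambda>z. ?f z p) has_field_derivative ?f' y p) (at y within ball z r)"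
        if "y \<in> ball z r" for y p
        using ne[OF that] by (auto intro!: derivative_eq_intros simp: power2_eq_square)
      show "?f y integrable_on cube3" if "y \<in> ball z r" for y
        using ne[OF that] by (intro integrable_continuous continuous_intros cont) auto
      have c: "continuous_on (ball z r \<times> cube3) (\<lambda>q. g (snd q))"
        if "continuous_on UNIV g" for g :: "real^3 \<Rightarrow> complex"
        by (rule continuous_on_compose2[OF that]) (auto intro: continuous_intros)
      show "continuous_on (ball z r \<times> cube3) (\<lambda>(y, p). ?f' y p)"
        unfolding case_prod_beta using ne by (intro continuous_intros c cont) auto
    qed simp
    then show ?thesis using r(1) by (auto intro: holomorphic_on_imp_differentiable_at)
  qed
  then have "(\<lambda>z. integral cube3 (?f z)) holomorphic_on (- band)"
    by (auto simp: holomorphic_on_def field_differentiable_at_within)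
  moreover have "integral cube3 (?f z) = mode_coeff (\<lambda>p. of_real (mode l p) / (of_real (E0 p) - z)) $ k"
    if "z \<in> - band" for z
    unfolding mode_coeff_def vec_lambda_beta
    using E0_ne[of z] that
    by (intro integral_torus3_eq_integral[symmetric] continuous_intros cont) auto
  ultimately show ?thesis by (rule holomorphic_transform)
qed

lemma holomorphic_on_det_bs_matrix: "(\<lambda>z. det (bs_matrix \<mu>1 \<mu>2 z)) holomorphic_on (- band)"
  unfolding det_def bs_matrix_def vec_lambda_beta
  by (intro holomorphic_intros holomorphic_on_mode_coeff_resolvent)

text \<open>Far from the band \<open>bs_matrix\<close> is close to the identity: a kernel vector
  would have to be strictly smaller than itself in the sum norm.\<close>

lemma det_bs_matrix_nonzero:
  obtains z where "z \<notin> band" "det (bs_matrix \<mu>1 \<mu>2 z) \<noteq> 0"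
proof -
  let ?W = "8 * pi ^ 3 :: real"
  define S where "S = (\<Sum>k\<in>UNIV. \<bar>coupling \<mu>1 \<mu>2 k\<bar>)"
  \<comment> \<open>Chosen so that \<open>t - 24\<close> exceeds \<open>4 * ?W * S\<close>; the 4
    counts the modes.\<close>
  define t where "t = 25 + 4 * ?W * S"
  have S: "0 \<le> S" unfolding S_def by (rule sum_nonneg) simp
  then have t: "25 \<le> t" by (simp add: t_def)
  have notin: "complex_of_real t \<notin> band" using t by auto
  have "det (bs_matrix \<mu>1 \<mu>2 (of_real t)) \<noteq> 0"
  proof
    assume "det (bs_matrix \<mu>1 \<mu>2 (of_real t)) = 0"
    then obtain x where x: "bs_matrix \<mu>1 \<mu>2 (of_real t) *v x = 0" "x \<noteq> 0"
      by (metis invertible_det_nz invertible_left_inverse matrix_left_invertible_ker)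
    let ?G = "\<lambda>k l. mode_coeff (\<lambda>p. of_real (mode l p) / (of_real (E0 p) - of_real t)) $ k"
    have G: "cmod (?G k l) \<le> ?W / (t - 24)" for k l
    proof -
      have "cmod (?G k l) \<le> (LINT p|torus3. 1 / (t - 24))"
        unfolding mode_coeff_def vec_lambda_beta
      proof (rule Bochner_Integration.integral_norm_bound_integral)
        show "integrable torus3 (\<lambda>p. complex_of_real (mode k p) * (of_real (mode l p) / (of_real (E0 p) - of_real t)))"
          using notin by (intro mode_mult_integrable L2e_imp_L2 resolvent_mult_in_L2e
              bounded_in_L2e[where B=1]) (auto simp: mode_bound)
        fix p
        have "\<bar>mode k p\<bar> * (\<bar>mode l p\<bar> / \<bar>E0 p - t\<bar>) \<le> 1 * (1 / (t - 24))"
          using mode_bound E0_bounds[of p] t by (intro mult_mono frac_le) auto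
        then show "cmod (of_real (mode k p) * (complex_of_real (mode l p) / (of_real (E0 p) - of_real t))) \<le> 1 / (t - 24)"
          by (simp add: norm_mult norm_divide flip: of_real_diff)
      qed simp
      then show ?thesis by simp
    qed
    let ?M = "\<Sum>k\<in>UNIV. cmod (x $ k)"
    have "cmod (x $ k) \<le> ?W / (t - 24) * S * ?M" for k
    proof -
      have "(\<Sum>l\<in>UNIV. x $ l * (if k = l then 1 else 0)) = x $ k"
        by (simp add: if_distrib[of "\<lambda>t. _ * t"] cong: if_cong)
      then have "x $ k + (\<Sum>l\<in>UNIV. of_real (coupling \<mu>1 \<mu>2 l) * ?G k l * x $ l) = 0"
        using arg_cong[OF x(1), of "\<lambda>v. v $ k"]
        by (simp add: matrix_vector_mult_def bs_matrix_def distrib_right sum.distrib mult.commute[of _ "x $ _"]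
            distrib_left)
      then have "x $ k = - (\<Sum>l\<in>UNIV. of_real (coupling \<mu>1 \<mu>2 l) * ?G k l * x $ l)"
        by (simp add: eq_neg_iff_add_eq_0)
      then have "cmod (x $ k) \<le> (\<Sum>l\<in>UNIV. cmod (of_real (coupling \<mu>1 \<mu>2 l) * ?G k l * x $ l))"
        by (simp only: norm_minus_cancel norm_sum)
      also have "\<dots> \<le> (\<Sum>l\<in>UNIV. \<bar>coupling \<mu>1 \<mu>2 l\<bar> * (?W / (t - 24)) * ?M)"
        unfolding norm_mult norm_of_real
        by (intro sum_mono mult_mono G mult_left_mono member_le_sum mult_nonneg_nonneg sum_nonneg)
          (use t in auto)
      also have "\<dots> = ?W / (t - 24) * S * ?M"
        by (simp add: S_def sum_distrib_left sum_distrib_right sum_divide_distrib mult_ac)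
      finally show ?thesis .
    qed
    then have "?M \<le> (\<Sum>k\<in>(UNIV :: 3 option set). ?W / (t - 24) * S * ?M)" by (intro sum_mono)
    then have "?M \<le> 4 * ?W * S / (t - 24) * ?M" by simp
    moreover have "4 * ?W * S / (t - 24) < 1"
    proof -
      have "0 \<le> 4 * ?W * S" using S by simp
      then show ?thesis unfolding t_def by (subst divide_less_eq_1_pos) linarith+
    qed
    moreover have "0 < ?M"
    proof -
      obtain k where "x $ k \<noteq> 0" using x(2) by (auto simp: vec_eq_iff)
      then show ?thesis by (intro sum_pos2[of _ k]) auto
    qed
    ultimately have "?M < 1 * ?M" by (meson mult_strict_right_mono le_less_trans)
    then show False by simp
  qed
  with notin show ?thesis by (rule that)
qed

text \<open>Spectral points off the band are zeros of a holomorphic function that does not vanish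
  identically.\<close>

lemma isolated_in_spectrum:
  assumes "z \<notin> band" "z \<in> spectrum_of (H_op \<mu>1 \<mu>2) L2e"
  shows "z isolated_in spectrum_of (H_op \<mu>1 \<mu>2) L2e"
proof -
  let ?d = "\<lambda>z. det (bs_matrix \<mu>1 \<mu>2 z)"
  have zeros: "?d y = 0" if "y \<notin> band" "y \<in> spectrum_of (H_op \<mu>1 \<mu>2) L2e" for y
    using in_resolvent_set[OF that(1)] that(2) unfolding spectrum_of_def by blast
  have comp: "compact band" by (intro compact_continuous_image continuous_intros) auto
  \<comment> \<open>Connectedness of the complement lets a single nonzero value exclude identical
    vanishing near \<open>z\<close>.\<close>
  have conn: "connected (- band)"
  proof (rule connected_complement_bounded_convex)
    show "bounded band" using comp by (rule compact_imp_bounded)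
    show "convex band" by (rule convex_linear_image) (auto intro: linearI simp: scaleR_conv_of_real)
  qed simp
  obtain y where y: "y \<notin> band" "?d y \<noteq> 0" by (rule det_bs_matrix_nonzero)
  obtain r where r: "0 < r" "ball z r \<subseteq> - band" "\<And>y. y \<in> ball z r - {z} \<Longrightarrow> ?d y \<noteq> 0"
    by (rule isolated_zeros[of ?d "- band" z y])
      (use assms y zeros conn open_Compl[OF compact_imp_closed[OF comp]] holomorphic_on_det_bs_matrix
        in auto)
  have "ball z r \<inter> spectrum_of (H_op \<mu>1 \<mu>2) L2e = {z}"
    using r zeros assms(2) by fastforce
  then show ?thesis unfolding isolated_in_def using assms(2) by (intro conjI exI[of _ "ball z r"]) auto
qed

section \<open>Antisymmetric test functions for the band\<close>

text \<open>The alternating polynomial in the three cosines: it is even in \<open>p\<close> and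
  changes sign under every transposition of coordinates.\<close>

definition vandermonde3 :: "real^3 \<Rightarrow> real" where
  "vandermonde3 p = (cos (p $ 1) - cos (p $ 2)) * (cos (p $ 2) - cos (p $ 3)) * (cos (p $ 1) - cos (p $ 3))"

lemma continuous_on_vandermonde3: "continuous_on A vandermonde3"
  unfolding vandermonde3_def by (intro continuous_intros)

lemma vandermonde3_bound: "\<bar>vandermonde3 p\<bar> \<le> 8"
proof -
  have "\<bar>cos x - cos y\<bar> \<le> 2" for x y :: real
    using abs_cos_le_one[of x] abs_cos_le_one[of y] by linarith
  then have "\<bar>vandermonde3 p\<bar> \<le> 2 * 2 * 2"
    unfolding vandermonde3_def abs_mult by (intro mult_mono) auto
  then show ?thesis by simp
qed

lemma three_distinct: "(1::3) \<noteq> 2" "(1::3) \<noteq> 3" "(2::3) \<noteq> 3" "(2::3) \<noteq> 1" "(3::3) \<noteq> 1" "(3::3) \<noteq> 2"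
  by simp_all

text \<open>An antisymmetric function is annihilated by the potential, because each mode is fixed by some
  transposition.\<close>

lemma mode_coeff_antisymmetric:
  assumes [measurable]: "h \<in> borel_measurable borel"
  shows "mode_coeff (\<lambda>p. of_real (h (csum p) * vandermonde3 p)) = 0"
proof -
  let ?f = "\<lambda>p. complex_of_real (h (csum p) * vandermonde3 p)"
  have [measurable]: "vandermonde3 \<in> borel_measurable torus3"
    by (intro continuous_measurable_torus3 continuous_on_vandermonde3)
  have [measurable]: "(\<lambda>p. h (csum p)) \<in> borel_measurable torus3"
    using measurable_compose[OF csum_measurable assms] .
  have "(LINT p|torus3. of_real (mode k p) * ?f p) = 0" for k
  proof -
    have flip: "vandermonde3 (\<chi> j. p $ Transposition.transpose a b j) = - vandermonde3 p" if "a \<noteq> b" for a b p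
      using that exhaust_3[of a] exhaust_3[of b] unfolding vandermonde3_def
      by (elim disjE) (simp_all add: Transposition.transpose_def algebra_simps)
    obtain a b :: 3 where ab: "a \<noteq> b" "\<And>p. mode k (\<chi> j. p $ Transposition.transpose a b j) = mode k p"
    proof (cases k)
      case None
      then show ?thesis using that[of 1 2] by (simp add: mode_def)
    next
      case (Some i)
      obtain a b :: 3 where "a \<noteq> b" "a \<noteq> i" "b \<noteq> i"
        using exhaust_3[of i] three_distinct by metis
      then show ?thesis using that[of a b] Some by (simp add: mode_def Transposition.transpose_def)
    qed
    have perm: "Transposition.transpose a b permutes UNIV" by (rule permutes_swap_id) auto
    have "(LINT p|torus3. of_real (mode k p) * ?f p)
        = (LINT p|torus3. - (of_real (mode k p) * ?f p))"
      by (subst integral_torus3_permute[OF perm, symmetric])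
        (simp_all add: ab flip[OF ab(1)] csum_permute[OF perm])
    then show ?thesis by simp
  qed
  then show ?thesis by (simp add: mode_coeff_def vec_eq_iff)
qed

text \<open>A diagonal point would be a zero of \<open>vandermonde3\<close>, so the three cosines
  are spread symmetrically about their common value, which preserves their sum and hence
  \<open>E0\<close>.\<close>

lemma vandermonde3_level:
  assumes "0 \<le> a" "a < b" "b \<le> 24"
  shows "\<not> (AE p in torus3. \<not> (a < E0 p \<and> E0 p < b \<and> vandermonde3 p \<noteq> 0))"
proof -
  let ?c = "(a + b) / 2"
  define x where "x = 1 - ?c / 12"
  \<comment> \<open>Half the distance from \<open>x\<close> to the nearer of 1 and -1, so that all
    three values are strictly inside and their arccosines avoid 0 and \<open>pi\<close>.\<close>
  define d where "d = (1 - \<bar>x\<bar>) / 2"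
  have c: "a < ?c" "?c < b" "0 < ?c" "?c < 24" using assms by auto
  then have "\<bar>x\<bar> < 1" by (auto simp: x_def abs_if)
  moreover have "2 * d = 1 - \<bar>x\<bar>" by (simp add: d_def)
  ultimately have d: "0 < d" "\<bar>x + d\<bar> < 1" "\<bar>x - d\<bar> < 1" by linarith+
  define u where "u i = (if i = 1 then x + d else if i = 2 then x else x - d)" for i :: 3
  have u: "\<bar>u i\<bar> < 1" for i using d \<open>\<bar>x\<bar> < 1\<close> by (simp add: u_def)
  let ?p = "\<chi> i. arccos (u i) :: real^3"
  have cos: "cos (?p $ i) = u i" for i
    using u[of i] by (simp add: cos_arccos_abs less_imp_le)
  have "csum ?p = 3 * x" unfolding csum_def cos by (simp add: sum_3 u_def)
  then have E0: "E0 ?p = ?c" by (simp add: E0_csum x_def)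
  have V: "vandermonde3 ?p \<noteq> 0"
    unfolding vandermonde3_def cos using d(1) by (simp add: u_def)
  have "open {p. a < E0 p \<and> E0 p < b \<and> vandermonde3 p \<noteq> 0}"
    by (intro open_Collect_conj open_Collect_less open_Collect_neq continuous_on_E0
        continuous_on_vandermonde3 continuous_intros)
  moreover have "?p \<in> box (\<chi> i. - pi) (\<chi> i. pi)"
  proof -
    have "0 < arccos (u i)" "arccos (u i) < pi" for i
      using arccos_lt_bounded[of "u i"] u[of i] by (auto simp: abs_less_iff)
    then show ?thesis using pi_gt_zero by (auto simp: mem_box_cart intro: less_trans[of _ 0])
  qed
  ultimately show ?thesis
    using torus3_open_pos[of "{p. a < E0 p \<and> E0 p < b \<and> vandermonde3 p \<noteq> 0}" ?p] c E0 V by auto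
qed

text \<open>An approximate eigenfunction argument: on test functions localized near the level
  \<open>t\<close>, the operator minus \<open>z\<close> is too small for any candidate constant
  \<open>K\<close>.\<close>

lemma band_subset_spectrum: "band \<subseteq> spectrum_of (H_op \<mu>1 \<mu>2) L2e"
proof (rule subsetI, rule ccontr)
  fix z assume "z \<in> band" "z \<notin> spectrum_of (H_op \<mu>1 \<mu>2) L2e"
  then obtain t where t: "z = of_real t" "0 \<le> t" "t \<le> 24" by auto
  have "z \<in> resolvent_set (H_op \<mu>1 \<mu>2) L2e"
    using \<open>z \<notin> spectrum_of (H_op \<mu>1 \<mu>2) L2e\<close> by (simp add: spectrum_of_def)
  then obtain K where
    K: "\<And>f. f \<in> L2e \<Longrightarrow> L2_norm f \<le> K * L2_norm (\<lambda>p. H_op \<mu>1 \<mu>2 f p - z * f p)"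
    unfolding resolvent_set_def by blast
  define e where "e = 1 / (\<bar>K\<bar> + 1)"
  have e: "0 < e" "\<bar>K\<bar> * e < 1" by (simp_all add: e_def)
  \<comment> \<open>The truncation at 0 and 24 keeps a nonempty level interval inside the band even
    if \<open>t\<close> is an end point.\<close>
  define a b where "a = max 0 (t - e)" and "b = min 24 (t + e)"
  have ab: "0 \<le> a" "a < b" "b \<le> 24" "t - e \<le> a" "b \<le> t + e" using t e by (auto simp: a_def b_def)
  \<comment> \<open>The cutoff is a function of \<open>csum\<close> alone, hence symmetric, and
    leaves the product with \<open>vandermonde3\<close> antisymmetric.\<close>
  let ?h = "\<lambda>s. indicator {s. a < 12 - 4 * s \<and> 12 - 4 * s < b} s :: real"
  let ?f = "\<lambda>p. complex_of_real (?h (csum p) * vandermonde3 p)"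
  have h [measurable]: "?h \<in> borel_measurable borel" by measurable
  have meas [measurable]: "vandermonde3 \<in> borel_measurable torus3" "(\<lambda>p. ?h (csum p)) \<in> borel_measurable torus3"
    using measurable_compose[OF csum_measurable h]
    by (auto intro!: continuous_measurable_torus3 continuous_on_vandermonde3)
  have f: "?f \<in> L2e"
  proof (rule bounded_in_L2e[where B=8])
    show "cmod (?f p) \<le> 8" for p
      using vandermonde3_bound[of p] by (simp add: indicator_def)
    show "?f (- p) = ?f p" for p by (simp add: vandermonde3_def)
  qed measurable
  have "\<not> (AE p in torus3. ?f p = 0)"
  proof
    assume "AE p in torus3. ?f p = 0"
    then have "AE p in torus3. \<not> (a < E0 p \<and> E0 p < b \<and> vandermonde3 p \<noteq> 0)"
      by eventually_elim (auto simp: E0_csum indicator_def)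
    then show False using vandermonde3_level[OF ab(1-3)] by simp
  qed
  then have pos: "0 < L2_norm ?f" using f by (intro L2_norm_pos L2e_imp_L2)
  \<comment> \<open>Repeating the indicator changes nothing in the product with \<open>?f\<close>,
    but makes the multiplier bounded by \<open>e\<close> everywhere.\<close>
  let ?g = "\<lambda>p. complex_of_real ((E0 p - t) * ?h (csum p))"
  have eq: "H_op \<mu>1 \<mu>2 ?f p - z * ?f p = ?g p * ?f p" for p
    unfolding H_op_def V_op_mode_sum mode_coeff_antisymmetric[OF h] t(1)
    by (simp add: mode_sum_def indicator_def algebra_simps)
  have "(L2_norm (\<lambda>p. ?g p * ?f p))\<^sup>2 \<le> e\<^sup>2 * (L2_norm ?f)\<^sup>2"
  proof (rule L2_norm_bounded_mult)
    show "cmod (?g p) \<le> e" for p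
      unfolding norm_of_real using e ab by (auto simp: E0_csum indicator_def)
  qed (use f L2e_imp_L2 in auto)
  then have "(L2_norm (\<lambda>p. ?g p * ?f p))\<^sup>2 \<le> (e * L2_norm ?f)\<^sup>2" by (simp only: power_mult_distrib)
  then have le: "L2_norm (\<lambda>p. ?g p * ?f p) \<le> e * L2_norm ?f"
    by (rule power2_le_imp_le) (use e in auto)
  have "L2_norm ?f \<le> K * L2_norm (\<lambda>p. ?g p * ?f p)" using K[OF f] by (simp only: eq)
  also have "\<dots> \<le> \<bar>K\<bar> * L2_norm (\<lambda>p. ?g p * ?f p)" by (intro mult_right_mono) auto
  also have "\<dots> \<le> \<bar>K\<bar> * (e * L2_norm ?f)" by (intro mult_left_mono le) auto
  also have "\<dots> = \<bar>K\<bar> * e * L2_norm ?f" by simp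
  also have "\<dots> < 1 * L2_norm ?f" using e pos by (intro mult_strict_right_mono)
  finally show False by simp
qed

text \<open>Off the band every spectral point is an isolated eigenvalue of finite multiplicity; on
  it every point is a limit point of the spectrum and so cannot be discrete.\<close>

lemma essential_spectrum_eq: "essential_spectrum (H_op \<mu>1 \<mu>2) L2e = band"
proof (intro equalityI subsetI)
  fix z assume z: "z \<in> essential_spectrum (H_op \<mu>1 \<mu>2) L2e"
  then have spec: "z \<in> spectrum_of (H_op \<mu>1 \<mu>2) L2e" by (simp add: essential_spectrum_def)
  show "z \<in> band"
  proof (rule ccontr)
    assume nb: "z \<notin> band"
    then have "det (bs_matrix \<mu>1 \<mu>2 z) = 0"
      using in_resolvent_set[OF nb] spec unfolding spectrum_of_def by blast
    then have "z \<in> discrete_spectrum (H_op \<mu>1 \<mu>2) L2e"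
      using is_eigenvalue_L2e[OF nb] isolated_in_spectrum[OF nb spec] multiplicity_L2e_finite[OF nb]
      by (simp add: discrete_spectrum_def)
    then show False using z by (simp add: essential_spectrum_def)
  qed
next
  fix z assume z: "z \<in> band"
  have "connected band" by (intro connected_continuous_image continuous_intros) auto
  moreover have "band \<noteq> {y}" for y
  proof -
    have "complex_of_real 0 \<in> band" "complex_of_real 1 \<in> band" by (intro imageI; simp)+
    then show ?thesis by (metis of_real_eq_iff singletonD zero_neq_one)
  qed
  ultimately have "z islimpt band" using z by (intro connected_imp_perfect)
  then have "z islimpt spectrum_of (H_op \<mu>1 \<mu>2) L2e" using band_subset_spectrum islimpt_subset by blast
  then show "z \<in> essential_spectrum (H_op \<mu>1 \<mu>2) L2e"
    using z band_subset_spectrum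
    by (auto simp: essential_spectrum_def discrete_spectrum_def isolated_in_islimpt_iff)
qed

section \<open>Symmetric eigenfunctions\<close>

lemma L2es_permute:
  "f \<in> L2es \<Longrightarrow> \<pi> permutes (UNIV :: 3 set) \<Longrightarrow> AE p in torus3. f (\<chi> i. p $ \<pi> i) = f p"
  by (simp add: L2es_def)

text \<open>Transposing two coordinates identifies the three cosine integrals, so each is a third of
  their sum.\<close>

lemma integral_cos_L2es:
  assumes f: "f \<in> L2es"
  shows "(LINT p|torus3. of_real (cos (p $ i)) * f p) = (LINT p|torus3. of_real (csum p) * f p) / 3"
proof -
  have L2: "f \<in> L2" using f L2es_imp_L2e L2e_imp_L2 by blast
  have [measurable]: "f \<in> borel_measurable torus3" using L2 by (rule L2_measurable)
  let ?I = "\<lambda>i. LINT p|torus3. of_real (cos (p $ i)) * f p"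
  have int: "integrable torus3 (\<lambda>p. of_real (cos (p $ i)) * f p)" for i
    using mode_mult_integrable[OF L2, of "Some i"] by (simp add: mode_def)
  have eq: "?I i = ?I j" for i j
  proof -
    let ?\<pi> = "Transposition.transpose i j"
    have perm: "?\<pi> permutes (UNIV :: 3 set)" by (rule permutes_swap_id) auto
    let ?P = "\<lambda>p :: real^3. \<chi> k. p $ ?\<pi> k"
    have m: "(\<lambda>p. of_real (cos (p $ i)) * f p) \<in> borel_measurable torus3" for i by measurable
    have "(\<lambda>p. f (?P p)) \<in> borel_measurable torus3"
    proof (rule measurable_compose[of ?P torus3 torus3])
      have "?P \<in> borel_measurable torus3"
        by (intro continuous_measurable_torus3 continuous_intros)
      then show "?P \<in> measurable torus3 torus3"
        unfolding torus3_def
        by (intro measurable_restrict_space2) (auto simp: space_restrict_space mem_cube3)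
    qed measurable
    then have "(LINT p|torus3. of_real (cos (p $ j)) * f (?P p)) = ?I j"
      by (intro integral_cong_AE) (use L2es_permute[OF f perm] in \<open>auto elim: eventually_mono\<close>)
    then show ?thesis
      using integral_torus3_permute[OF perm m[of i]] by simp
  qed
  have "(LINT p|torus3. of_real (csum p) * f p) = (\<Sum>k\<in>UNIV. ?I k)"
    using int by (simp add: csum_def sum_distrib_right Bochner_Integration.integral_sum)
  also have "\<dots> = (\<Sum>k\<in>(UNIV :: 3 set). ?I i)" using eq by (intro sum.cong) auto
  finally show ?thesis by simp
qed

text \<open>On symmetric functions the three cosine modes collapse to \<open>csum\<close> and the
  rank of the potential drops from four to at most two.\<close>

lemma V_op_L2es:
  assumes "f \<in> L2es"
  shows "V_op \<mu>1 \<mu>2 f p = of_real (\<mu>1 / (8 * pi ^ 3)) * (LINT q|torus3. f q)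
    + of_real (2 * \<mu>2 / (24 * pi ^ 3)) * of_real (csum p) * (LINT q|torus3. of_real (csum q) * f q)"
proof -
  have "complex_of_real (\<Sum>i\<in>UNIV. cos (p $ i)) = of_real (csum p)" by (simp add: csum_def)
  then show ?thesis
    unfolding V_op_def integral_cos_L2es[OF assms] sum_distrib_right[symmetric] of_real_sum[symmetric]
    by (simp add: power_mult_distrib)
qed

section \<open>The two-by-two system for symmetric eigenfunctions\<close>

text \<open>The free resolvent at \<open>z = 12 - w\<close> applied to a combination of 1 and
  \<open>csum\<close>.\<close>

definition res_fun :: "real \<Rightarrow> complex \<Rightarrow> complex \<Rightarrow> real^3 \<Rightarrow> complex" where
  "res_fun w x y p = (x + y * of_real (csum p)) / of_real (w - 4 * csum p)"

lemma res_fun_cmult: "res_fun w (c * x) (c * y) p = c * res_fun w x y p"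
  by (simp add: res_fun_def distrib_left mult.assoc)

text \<open>The determinant of \<open>sym_system\<close> after simplification: the terms quadratic
  in \<open>res_mean w\<close> cancel.\<close>

definition sym_det :: "real \<Rightarrow> real \<Rightarrow> real \<Rightarrow> real" where
  "sym_det \<mu>1 \<mu>2 w = 1 + \<mu>1 * res_mean w + \<mu>2 * (w * res_mean w - 1) * (w + \<mu>1) / 24"

context
  fixes \<mu>1 \<mu>2 w :: real
  assumes w: "12 < w \<or> w < - 12"
begin

lemma w_at_least_12: "12 \<le> w \<or> w < - 12"
  using w by auto

lemma csum_ne: "w - 4 * csum p \<noteq> 0"
  using w csum_bounds[of p] by auto

lemma res_fun_in_L2es: "res_fun w x y \<in> L2es"
proof -
  let ?d = "\<bar>w\<bar> - 12"
  have "(\<lambda>p. (\<lambda>s. (x + y * of_real s) / of_real (w - 4 * s)) (csum p)) \<in> L2es"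
  proof (rule csum_function_in_L2es)
    fix p
    have "cmod (x + y * of_real (csum p)) \<le> cmod x + cmod y * 3"
    proof -
      have "cmod (x + y * of_real (csum p)) \<le> cmod x + cmod (y * of_real (csum p))"
        by (rule norm_triangle_ineq)
      also have "\<dots> \<le> cmod x + cmod y * 3"
        using csum_bounds[of p] by (auto simp: norm_mult intro!: mult_left_mono)
      finally show ?thesis .
    qed
    moreover have "?d \<le> \<bar>w - 4 * csum p\<bar>" "0 < ?d" using w csum_bounds[of p] by auto
    ultimately show "cmod ((x + y * of_real (csum p)) / of_real (w - 4 * csum p))
        \<le> (cmod x + cmod y * 3) / ?d"
      unfolding norm_divide norm_of_real by (intro frac_le) auto
  qed measurable
  then show ?thesis unfolding res_fun_def .
qed

lemma res_fun_moments:
  "(LINT p|torus3. res_fun w x y p) = of_real (8 * pi ^ 3) *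
     (of_real (res_mean w) * x + of_real ((w * res_mean w - 1) / 4) * y)"
  "(LINT p|torus3. of_real (csum p) * res_fun w x y p) = of_real (8 * pi ^ 3) *
     (of_real ((w * res_mean w - 1) / 4) * x + of_real (w * (w * res_mean w - 1) / 16) * y)"
proof -
  let ?m0 = "\<lambda>p. complex_of_real (1 / (w - 4 * csum p))"
    and ?m1 = "\<lambda>p. complex_of_real (csum p / (w - 4 * csum p))"
    and ?m2 = "\<lambda>p. complex_of_real ((csum p)\<^sup>2 / (w - 4 * csum p))"
  note m = resolvent_moment_0[OF w_at_least_12] resolvent_moment_1[OF w_at_least_12] resolvent_moment_2[OF w_at_least_12]
  note m = m[THEN has_bochner_integral_of_real]
  have "has_bochner_integral torus3 (\<lambda>p. ?m0 p * x + ?m1 p * y)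
      (of_real (8 * pi ^ 3 * res_mean w) * x + of_real (8 * pi ^ 3 * (w * res_mean w - 1) / 4) * y)"
    by (intro has_bochner_integral_add has_bochner_integral_mult_left m)
  moreover have "(\<lambda>p. ?m0 p * x + ?m1 p * y) = res_fun w x y"
    by (intro ext) (simp add: res_fun_def add_divide_distrib)
  ultimately show "(LINT p|torus3. res_fun w x y p) = of_real (8 * pi ^ 3) *
     (of_real (res_mean w) * x + of_real ((w * res_mean w - 1) / 4) * y)"
    by (simp add: has_bochner_integral_iff distrib_left mult.assoc)
  have "has_bochner_integral torus3 (\<lambda>p. ?m1 p * x + ?m2 p * y)
      (of_real (8 * pi ^ 3 * (w * res_mean w - 1) / 4) * x
        + of_real (8 * pi ^ 3 * w * (w * res_mean w - 1) / 16) * y)"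
    by (intro has_bochner_integral_add has_bochner_integral_mult_left m)
  moreover have "(\<lambda>p. ?m1 p * x + ?m2 p * y) = (\<lambda>p. of_real (csum p) * res_fun w x y p)"
    by (intro ext) (simp add: res_fun_def add_divide_distrib distrib_left power2_eq_square mult_ac)
  ultimately show "(LINT p|torus3. of_real (csum p) * res_fun w x y p) = of_real (8 * pi ^ 3) *
     (of_real ((w * res_mean w - 1) / 4) * x + of_real (w * (w * res_mean w - 1) / 16) * y)"
    by (simp add: has_bochner_integral_iff distrib_left mult.assoc)
qed

text \<open>The condition that the potential, applied to \<open>res_fun w x y\<close>, returns minus
  the numerator \<open>x + y * csum p\<close>; see \<open>res_fun_coefficients\<close>.\<close>

definition sym_system :: "complex \<Rightarrow> complex \<Rightarrow> bool" where
  "sym_system x y \<longleftrightarrow>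
     of_real (1 + \<mu>1 * res_mean w) * x + of_real (\<mu>1 * (w * res_mean w - 1) / 4) * y = 0 \<and>
     of_real (2 * \<mu>2 / 3 * ((w * res_mean w - 1) / 4)) * x
       + of_real (1 + 2 * \<mu>2 / 3 * (w * (w * res_mean w - 1) / 16)) * y = 0"

lemma H_op_L2es_eq_iff:
  assumes "f \<in> L2es"
  shows "H_op \<mu>1 \<mu>2 f p = of_real (12 - w) * f p \<longleftrightarrow>
    f p = res_fun w (- (of_real (\<mu>1 / (8 * pi ^ 3)) * (LINT q|torus3. f q)))
      (- (of_real (2 * \<mu>2 / (24 * pi ^ 3)) * (LINT q|torus3. of_real (csum q) * f q))) p"
proof -
  have "complex_of_real (w - 4 * csum p) \<noteq> 0" using csum_ne[of p] unfolding of_real_eq_0_iff .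
  then show ?thesis
    unfolding H_op_def V_op_L2es[OF assms] res_fun_def E0_csum eq_divide_eq
    by (simp add: algebra_simps)
qed

lemma res_fun_coefficients:
  "- (of_real (\<mu>1 / (8 * pi ^ 3)) * (LINT q|torus3. res_fun w x y q)) = x \<and>
   - (of_real (2 * \<mu>2 / (24 * pi ^ 3)) * (LINT q|torus3. of_real (csum q) * res_fun w x y q)) = y
   \<longleftrightarrow> sym_system x y"
proof -
  define a b c where "a = complex_of_real (res_mean w)"
    and "b = complex_of_real ((w * res_mean w - 1) / 4)"
    and "c = complex_of_real (w * (w * res_mean w - 1) / 16)"
  have r: "\<mu>1 / (8 * pi ^ 3) * (8 * pi ^ 3) = \<mu>1" "2 * \<mu>2 / (24 * pi ^ 3) * (8 * pi ^ 3) = 2 * \<mu>2 / 3"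
    by simp_all
  have m: "of_real (\<mu>1 / (8 * pi ^ 3)) * (of_real (8 * pi ^ 3) * u) = of_real \<mu>1 * u"
    "of_real (2 * \<mu>2 / (24 * pi ^ 3)) * (of_real (8 * pi ^ 3) * u) = of_real (2 * \<mu>2 / 3) * u" for u :: complex
    using r[THEN arg_cong[where f="\<lambda>t. complex_of_real t * u"]] by (simp_all only: of_real_mult mult.assoc)
  have "sym_system x y \<longleftrightarrow> of_real \<mu>1 * (a * x + b * y) + x = 0 \<and>
      of_real (2 * \<mu>2 / 3) * (b * x + c * y) + y = 0"
  proof -
    have "complex_of_real (1 + \<mu>1 * res_mean w) * x + of_real (\<mu>1 * (w * res_mean w - 1) / 4) * y
        = of_real \<mu>1 * (a * x + b * y) + x"
      by (simp add: a_def b_def algebra_simps)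
    moreover have "complex_of_real (2 * \<mu>2 / 3 * ((w * res_mean w - 1) / 4)) * x
        + of_real (1 + 2 * \<mu>2 / 3 * (w * (w * res_mean w - 1) / 16)) * y
        = of_real (2 * \<mu>2 / 3) * (b * x + c * y) + y"
      unfolding b_def c_def by (simp only: of_real_mult of_real_add of_real_1) algebra
    ultimately show ?thesis by (simp only: sym_system_def)
  qed
  then show ?thesis
    unfolding res_fun_moments m neg_eq_iff_add_eq_0 a_def b_def c_def by simp
qed

lemma integral_AE_eq_res_fun:
  assumes "f \<in> L2es" "AE p in torus3. f p = res_fun w x y p"
  shows "(LINT q|torus3. f q) = (LINT q|torus3. res_fun w x y q)"
    "(LINT q|torus3. of_real (csum q) * f q) = (LINT q|torus3. of_real (csum q) * res_fun w x y q)"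
proof -
  have [measurable]: "f \<in> borel_measurable torus3" "res_fun w x y \<in> borel_measurable torus3"
    using assms(1) res_fun_in_L2es L2es_imp_L2e L2e_imp_L2 L2_measurable by blast+
  show "(LINT q|torus3. f q) = (LINT q|torus3. res_fun w x y q)"
    "(LINT q|torus3. of_real (csum q) * f q) = (LINT q|torus3. of_real (csum q) * res_fun w x y q)"
    using assms(2) by (auto intro!: integral_cong_AE elim: eventually_mono)
qed

lemma eigenspace_L2es_iff:
  "f \<in> eigenspace (H_op \<mu>1 \<mu>2) L2es (of_real (12 - w)) \<longleftrightarrow>
    f \<in> L2es \<and> (\<exists>x y. sym_system x y \<and> (AE p in torus3. f p = res_fun w x y p))"
proof (intro iffI conjI; (elim conjE exE)?)
  assume "f \<in> eigenspace (H_op \<mu>1 \<mu>2) L2es (of_real (12 - w))"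
  then have f: "f \<in> L2es" and eq: "AE p in torus3. H_op \<mu>1 \<mu>2 f p = of_real (12 - w) * f p"
    by (auto simp: eigenspace_def)
  show "f \<in> L2es" by fact
  define x where "x = - (of_real (\<mu>1 / (8 * pi ^ 3)) * (LINT q|torus3. f q))"
  define y where "y = - (of_real (2 * \<mu>2 / (24 * pi ^ 3)) * (LINT q|torus3. of_real (csum q) * f q))"
  have AE: "AE p in torus3. f p = res_fun w x y p"
    using eq unfolding x_def y_def by eventually_elim (simp only: H_op_L2es_eq_iff[OF f])
  have "sym_system x y"
    unfolding res_fun_coefficients[symmetric] integral_AE_eq_res_fun[OF f AE, symmetric]
    by (simp only: x_def y_def)
  then show "\<exists>x y. sym_system x y \<and> (AE p in torus3. f p = res_fun w x y p)" using AE by blast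
next
  fix x y assume f: "f \<in> L2es" and sys: "sym_system x y" and AE: "AE p in torus3. f p = res_fun w x y p"
  note coeff = sys[folded res_fun_coefficients, folded integral_AE_eq_res_fun[OF f AE]]
  have "H_op \<mu>1 \<mu>2 f p = of_real (12 - w) * f p \<longleftrightarrow> f p = res_fun w x y p" for p
    unfolding H_op_L2es_eq_iff[OF f] using coeff by simp
  then show "f \<in> eigenspace (H_op \<mu>1 \<mu>2) L2es (of_real (12 - w))"
    using f AE by (simp add: eigenspace_def)
qed

text \<open>Integrating the numerator removes \<open>csum\<close>, which has mean 0, and leaves
  \<open>x = 0\<close>; then \<open>y = 0\<close> because \<open>csum\<close> is not null.\<close>

lemma res_fun_AE_0:
  assumes "AE p in torus3. res_fun w x y p = 0"
  shows "x = 0 \<and> y = 0"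
proof -
  have AE: "AE p in torus3. x + y * of_real (csum p) = 0"
    using assms
  proof eventually_elim
    case (elim p)
    have "complex_of_real (w - 4 * csum p) \<noteq> 0" using csum_ne[of p] unfolding of_real_eq_0_iff .
    with elim show ?case by (simp add: res_fun_def)
  qed
  have "(LINT p|torus3. x + y * of_real (csum p)) = (LINT p|torus3. 0)"
    using AE by (intro integral_cong_AE) auto
  moreover have "integrable torus3 (\<lambda>p. complex_of_real (csum p))" "(LINT p|torus3. complex_of_real (csum p)) = 0"
    using integrable_csum integral_csum by auto
  ultimately have "x = 0" by simp
  with AE have "y = 0 \<or> (AE p in torus3. csum p = 0)" by auto
  with csum_not_AE_0 \<open>x = 0\<close> show ?thesis by simp
qed

lemma sym_system_det_nonzero:
  assumes "sym_det \<mu>1 \<mu>2 w \<noteq> 0" "sym_system x y"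
  shows "x = 0 \<and> y = 0"
proof -
  define a b c d where abcd: "a = 1 + \<mu>1 * res_mean w" "b = \<mu>1 * (w * res_mean w - 1) / 4"
    "c = 2 * \<mu>2 / 3 * ((w * res_mean w - 1) / 4)" "d = 1 + 2 * \<mu>2 / 3 * (w * (w * res_mean w - 1) / 16)"
  have "a * d - b * c = sym_det \<mu>1 \<mu>2 w"
    unfolding abcd sym_det_def by (simp add: field_simps)
  then have det: "complex_of_real (a * d - b * c) \<noteq> 0" using assms(1) by simp
  have "of_real a * x + of_real b * y = 0" "of_real c * x + of_real d * y = 0"
    using assms(2) unfolding sym_system_def abcd by auto
  then have "complex_of_real (a * d - b * c) * x = 0" "complex_of_real (a * d - b * c) * y = 0"
    unfolding of_real_diff of_real_mult by algebra+
  with det show ?thesis unfolding mult_eq_0_iff by blast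
qed

text \<open>Orthogonal to the first row of the system, which never vanishes.\<close>

definition kernel :: "real \<times> real" where
  "kernel = (\<mu>1 * (w * res_mean w - 1) / 4, - (1 + \<mu>1 * res_mean w))"

definition eigfun :: "real^3 \<Rightarrow> complex" where
  "eigfun = res_fun w (of_real (fst kernel)) (of_real (snd kernel))"

lemma kernel_nonzero: "fst kernel \<noteq> 0 \<or> snd kernel \<noteq> 0"
  using res_mean_gt[OF w_at_least_12] by (auto simp: kernel_def)

lemma eigfun_not_AE_0: "\<not> (AE p in torus3. eigfun p = 0)"
  using res_fun_AE_0 kernel_nonzero unfolding eigfun_def of_real_eq_0_iff by (metis of_real_eq_0_iff)

lemma eigfun_in_L2es: "eigfun \<in> L2es"
  unfolding eigfun_def by (rule res_fun_in_L2es)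

text \<open>The first row is nonzero, so the rank is exactly one and the solutions form the line
  orthogonal to that row.\<close>

lemma sym_system_det_zero:
  assumes "sym_det \<mu>1 \<mu>2 w = 0"
  shows "sym_system x y \<longleftrightarrow> (\<exists>c. x = c * of_real (fst kernel) \<and> y = c * of_real (snd kernel))"
proof -
  define a b c d where abcd: "a = 1 + \<mu>1 * res_mean w" "b = \<mu>1 * (w * res_mean w - 1) / 4"
    "c = 2 * \<mu>2 / 3 * ((w * res_mean w - 1) / 4)" "d = 1 + 2 * \<mu>2 / 3 * (w * (w * res_mean w - 1) / 16)"
  have "a * d - b * c = sym_det \<mu>1 \<mu>2 w"
    unfolding abcd sym_det_def by (simp add: field_simps)
  then have "complex_of_real (a * d - b * c) = 0" using assms by simp
  then have det: "complex_of_real a * of_real d = of_real b * of_real c" by simp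
  have k: "fst kernel = b" "snd kernel = - a" by (simp_all add: kernel_def abcd)
  have nz: "b \<noteq> 0 \<or> a \<noteq> 0" using kernel_nonzero k by simp
  have "of_real a * x + of_real b * y = 0 \<and> of_real c * x + of_real d * y = 0 \<longleftrightarrow>
      (\<exists>t. x = t * of_real b \<and> y = t * of_real (- a))"
  proof safe
    assume 1: "of_real a * x + of_real b * y = 0"
    show "\<exists>t. x = t * of_real b \<and> y = t * of_real (- a)"
    proof (cases "b = 0")
      case True
      then have "a \<noteq> 0" "x = 0" using nz 1 by auto
      then show ?thesis using True by (intro exI[of _ "- y / of_real a"]) simp
    next
      case False
      have "y * of_real b = - (of_real a * x)" using 1 by (simp add: algebra_simps eq_neg_iff_add_eq_0)
      then have "y = - (of_real a * x) / of_real b" using False by (simp add: field_simps)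
      then show ?thesis using False by (intro exI[of _ "x / of_real b"]) simp
    qed
  next
    fix t :: complex
    show "of_real a * (t * of_real b) + of_real b * (t * of_real (- a)) = 0" by simp
    show "of_real c * (t * of_real b) + of_real d * (t * of_real (- a)) = 0"
      unfolding of_real_minus using det by algebra
  qed
  then show ?thesis unfolding sym_system_def k abcd[symmetric] .
qed

lemma eigenspace_det_zero:
  assumes "sym_det \<mu>1 \<mu>2 w = 0"
  shows "f \<in> eigenspace (H_op \<mu>1 \<mu>2) L2es (of_real (12 - w)) \<longleftrightarrow>
    f \<in> L2es \<and> (\<exists>c. AE p in torus3. f p = c * eigfun p)"
  unfolding eigenspace_L2es_iff sym_system_det_zero[OF assms] eigfun_def
  by (auto simp flip: res_fun_cmult; blast)

lemma eigfun_in_eigenspace: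
  assumes "sym_det \<mu>1 \<mu>2 w = 0"
  shows "eigfun \<in> eigenspace (H_op \<mu>1 \<mu>2) L2es (of_real (12 - w))"
  unfolding eigenspace_det_zero[OF assms] using eigfun_in_L2es by (auto intro!: exI[of _ 1])

lemma is_eigenvalue_L2es_iff:
  "is_eigenvalue (H_op \<mu>1 \<mu>2) L2es (of_real (12 - w)) \<longleftrightarrow> sym_det \<mu>1 \<mu>2 w = 0"
proof
  assume "is_eigenvalue (H_op \<mu>1 \<mu>2) L2es (of_real (12 - w))"
  then obtain f x y where "sym_system x y" "AE p in torus3. f p = res_fun w x y p"
    "\<not> (AE p in torus3. f p = 0)"
    unfolding is_eigenvalue_def is_eigenfunction_def eigenspace_L2es_iff by blast
  moreover from this have "\<not> (x = 0 \<and> y = 0)" by (auto simp: res_fun_def)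
  ultimately show "sym_det \<mu>1 \<mu>2 w = 0" using sym_system_det_nonzero by blast
next
  assume "sym_det \<mu>1 \<mu>2 w = 0"
  from eigfun_in_eigenspace[OF this] show "is_eigenvalue (H_op \<mu>1 \<mu>2) L2es (of_real (12 - w))"
    unfolding is_eigenvalue_def is_eigenfunction_def using eigfun_not_AE_0 by blast
qed

text \<open>The eigenspace is spanned by \<open>eigfun\<close>, so any two of its members are
  proportional.\<close>

lemma multiplicity_L2es:
  assumes "sym_det \<mu>1 \<mu>2 w = 0"
  shows "multiplicity_of (H_op \<mu>1 \<mu>2) L2es (of_real (12 - w)) = 1"
proof -
  let ?X = "eigenspace (H_op \<mu>1 \<mu>2) L2es (of_real (12 - w))"
  have le: "n \<le> 1" if b: "\<forall>i<n. b i \<in> ?X" and indep: "AE_independent n b" for n b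
  proof (rule ccontr)
    assume "\<not> n \<le> 1"
    then have n: "0 < n" "1 < n" "{..<n} = {0, 1} \<union> {2..<n}" by auto
    obtain c0 c1 where c: "AE p in torus3. b 0 p = c0 * eigfun p" "AE p in torus3. b 1 p = c1 * eigfun p"
      using b n(1,2) unfolding eigenspace_det_zero[OF assms] by blast
    define u where "u i = (if i = 0 then c1 else if i = 1 then - c0 else 0)" for i :: nat
    have sum: "(\<Sum>i<n. u i * b i p) = c1 * b 0 p - c0 * b 1 p" for p
      unfolding n(3) by (subst sum.union_disjoint) (auto simp: u_def)
    have "AE p in torus3. (\<Sum>i<n. u i * b i p) = 0"
      unfolding sum using c by eventually_elim simp
    then have "u 0 = 0" "u 1 = 0" using indep n unfolding AE_independent_def by blast+
    then have "c0 = 0" by (simp add: u_def)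
    \<comment> \<open>With \<open>c0 = 0\<close> the function \<open>b 0\<close> is null, so the
      unit coefficient vector is itself a nontrivial relation.\<close>
    define e where "e i = (if i = 0 then 1 else 0 :: complex)" for i :: nat
    have "AE p in torus3. (\<Sum>i<n. e i * b i p) = 0"
      using c(1) \<open>c0 = 0\<close> n(1) by (simp add: e_def if_distrib[of "\<lambda>t. t * _"] cong: if_cong)
    then have "e 0 = 0" using indep n(1) unfolding AE_independent_def by blast
    then show False by (simp add: e_def)
  qed
  have "AE_independent 1 (\<lambda>_. eigfun)"
    unfolding AE_independent_def
  proof (intro allI impI)
    fix c :: "nat \<Rightarrow> complex" and i :: nat
    assume "AE p in torus3. (\<Sum>i<1. c i * eigfun p) = 0" "i < 1"
    then have "c 0 = 0 \<or> (AE p in torus3. eigfun p = 0)" by auto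
    then show "c i = 0" using eigfun_not_AE_0 \<open>i < 1\<close> by simp
  qed
  then have "1 \<in> {n. \<exists>b. (\<forall>i<n. b i \<in> ?X) \<and> AE_independent n b}"
    using eigfun_in_eigenspace[OF assms] by auto
  then have "enat 1 \<le> AE_dim ?X" unfolding AE_dim_def by (rule SUP_upper)
  moreover have "AE_dim ?X \<le> enat 1"
    unfolding AE_dim_def using le by (intro SUP_least) auto
  ultimately show ?thesis unfolding multiplicity_of_def by (simp add: one_enat_def)
qed

section \<open>Explicit normalized eigenfunctions\<close>

text \<open>Shared by the formula \<open>f_s\<close> and the degenerate one for
  \<open>\<mu>2 = 0\<close>: each is a nonzero multiple of \<open>eigfun\<close> and only has to be
  divided by its norm.\<close>

lemma normalized_eigenfunction:
  assumes "sym_det \<mu>1 \<mu>2 w = 0" "d \<noteq> 0" "\<And>p. of_real (h p) = d * eigfun p"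
  shows "\<exists>C. C \<noteq> 0 \<and> L2_norm (\<lambda>p. C * of_real (h p)) = 1 \<and>
    is_eigenfunction (H_op \<mu>1 \<mu>2) L2es (of_real (12 - w)) (\<lambda>p. C * of_real (h p))"
proof -
  let ?h = "\<lambda>p. complex_of_real (h p)"
  have nz: "\<not> (AE p in torus3. ?h p = 0)"
    using eigfun_not_AE_0 assms(2) unfolding assms(3) by simp
  have L2es: "?h \<in> L2es" unfolding assms(3) by (intro L2es_cmult eigfun_in_L2es)
  have pos: "0 < L2_norm ?h" using nz L2es by (intro L2_norm_pos L2e_imp_L2 L2es_imp_L2e)
  define C where "C = complex_of_real (1 / L2_norm ?h)"
  have C: "C \<noteq> 0" "cmod C = 1 / L2_norm ?h" using pos by (simp_all add: C_def norm_divide)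
  have "(\<lambda>p. C * ?h p) \<in> eigenspace (H_op \<mu>1 \<mu>2) L2es (of_real (12 - w))"
    unfolding eigenspace_det_zero[OF assms(1)]
    using L2es_cmult[OF L2es, of C] assms(3) by (auto intro!: exI[of _ "C * d"])
  then have "is_eigenfunction (H_op \<mu>1 \<mu>2) L2es (of_real (12 - w)) (\<lambda>p. C * ?h p)"
    using nz C(1) by (simp add: is_eigenfunction_def)
  moreover have "L2_norm (\<lambda>p. C * ?h p) = 1"
    unfolding L2_norm_cmult C(2) using pos by simp
  ultimately show ?thesis using C(1) by blast
qed

lemma a_s_12: "a_s 1 2 (12 - w) = 8 * pi ^ 3 * ((w * res_mean w - 1) / 4) / (sqrt (8 * pi ^ 3) * sqrt (12 * pi ^ 3))"
proof -
  have *: "1 / sqrt (8 * pi ^ 3) * (x / sqrt (12 * pi ^ 3)) / (12 - 4 * x - (12 - w))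
      = x / (w - 4 * x) / (sqrt (8 * pi ^ 3) * sqrt (12 * pi ^ 3))" for x
    by (simp add: mult_ac)
  show ?thesis
    unfolding a_s_def alpha_s_csum E0_csum * integral_divide_zero
    using resolvent_moment_1[OF w_at_least_12] by (simp add: has_bochner_integral_iff)
qed

text \<open>The normalization of \<open>alpha_s 1\<close> cancels against that inside
  \<open>a_s 1 2\<close>, leaving the kernel vector and a common factor that is nonzero when
  \<open>\<mu>2\<close> is.\<close>

lemma f_s_eigfun:
  "\<mu>1 * \<mu>2 * a_s 1 2 (12 - w) * (alpha_s 1 p / (E0 p - (12 - w)))
     - \<mu>2 * (1 + \<mu>1 * a_s 1 1 (12 - w)) * (alpha_s 2 p / (E0 p - (12 - w)))
   = \<mu>2 / sqrt (12 * pi ^ 3) * ((fst kernel + snd kernel * csum p) / (w - 4 * csum p))"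
proof -
  define u v where "u = sqrt (8 * pi ^ 3)" and "v = sqrt (12 * pi ^ 3)"
  have uv: "u \<noteq> 0" "v \<noteq> 0" "8 * pi ^ 3 = u * u" by (simp_all add: u_def v_def)
  have *: "\<mu>1 * \<mu>2 * (u * u * b / (u * v)) * (1 / u / d) - \<mu>2 * a * (s / v / d)
      = \<mu>2 / v * ((\<mu>1 * b + - a * s) / d)" if "d \<noteq> 0" for a b d s :: real
    using uv(1,2) that by (simp add: field_simps)
  have w_eq: "12 - 4 * csum p - (12 - w) = w - 4 * csum p" "12 - (12 - w) = w" by simp_all
  show ?thesis
    unfolding a_s_12 a_s_11 alpha_s_csum E0_csum kernel_def fst_conv snd_conv w_eq
      u_def[symmetric] v_def[symmetric] times_divide_eq_right[of \<mu>1 _ 4, symmetric]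
    unfolding uv(3)
    by (rule *[OF csum_ne])
qed

lemma eigfun_real: "eigfun p = of_real ((fst kernel + snd kernel * csum p) / (w - 4 * csum p))"
  by (simp add: eigfun_def res_fun_def)

lemma f_s_normalized:
  assumes "sym_det \<mu>1 \<mu>2 w = 0" "\<mu>2 \<noteq> 0"
  shows "\<exists>C. C \<noteq> 0 \<and> L2_norm (f_s C \<mu>1 \<mu>2 (12 - w)) = 1 \<and>
    is_eigenfunction (H_op \<mu>1 \<mu>2) L2es (of_real (12 - w)) (f_s C \<mu>1 \<mu>2 (12 - w))"
proof -
  have "f_s C \<mu>1 \<mu>2 (12 - w) = (\<lambda>p. C * of_real
      (\<mu>2 / sqrt (12 * pi ^ 3) * ((fst kernel + snd kernel * csum p) / (w - 4 * csum p))))" for C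
    unfolding f_s_def f_s_eigfun by (rule refl)
  moreover have "complex_of_real (\<mu>2 / sqrt (12 * pi ^ 3)) \<noteq> 0" using assms(2) by simp
  ultimately show ?thesis
    using normalized_eigenfunction[OF assms(1), of "of_real (\<mu>2 / sqrt (12 * pi ^ 3))"
        "\<lambda>p. \<mu>2 / sqrt (12 * pi ^ 3) * ((fst kernel + snd kernel * csum p) / (w - 4 * csum p))"]
    by (simp only: eigfun_real of_real_mult) blast
qed

text \<open>For \<open>\<mu>2 = 0\<close> the determinant is minus the second kernel component, so
  only the constant in the numerator of \<open>eigfun\<close> survives.\<close>

lemma alpha_1_normalized:
  assumes "sym_det \<mu>1 \<mu>2 w = 0" "\<mu>2 = 0"
  shows "\<exists>C. C \<noteq> 0 \<and> L2_norm (\<lambda>p. C * of_real (alpha_s 1 p / (E0 p - (12 - w)))) = 1 \<and>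
    is_eigenfunction (H_op \<mu>1 \<mu>2) L2es (of_real (12 - w))
      (\<lambda>p. C * of_real (alpha_s 1 p / (E0 p - (12 - w))))"
proof -
  have snd: "snd kernel = 0" using assms by (simp add: sym_det_def kernel_def)
  then have fst: "fst kernel \<noteq> 0" using kernel_nonzero by simp
  let ?d = "1 / (sqrt (8 * pi ^ 3) * fst kernel)"
  have "complex_of_real ?d \<noteq> 0" using fst by simp
  moreover have "alpha_s 1 p / (E0 p - (12 - w)) = ?d * ((fst kernel + snd kernel * csum p) / (w - 4 * csum p))" for p
    unfolding alpha_s_csum E0_csum snd using fst by simp
  then have "complex_of_real (alpha_s 1 p / (E0 p - (12 - w))) = of_real ?d * eigfun p" for p
    unfolding eigfun_real of_real_mult[symmetric] by simp
  ultimately show ?thesis by (rule normalized_eigenfunction[OF assms(1)])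
qed

end

section \<open>From roots to eigenvalues on either side of the band\<close>

text \<open>At \<open>w = - \<mu>1\<close> the determinant equals \<open>1 - w * res_mean w\<close>,
  which is negative, so dividing by \<open>w + \<mu>1\<close> loses no zero.\<close>

lemma sym_det_zero_iff_roots:
  assumes "12 < w"
  shows "sym_det \<mu>1 \<mu>2 w = 0 \<longleftrightarrow> w \<in> roots \<mu>1 \<mu>2"
proof -
  define a where "a = res_mean w"
  have a: "0 < a" "0 < w * a - 1" using res_mean_pos[of w] res_mean_gt[of w] assms by (auto simp: a_def)
  show ?thesis
  proof (cases "w + \<mu>1 = 0")
    case True
    then have "\<mu>1 = - w" by simp
    then show ?thesis using a by (simp add: sym_det_def roots_def flip: a_def)
  next
    case False
    have g: "24 / gap w = 24 * a / (w * a - 1)"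
      using a by (simp add: gap_def field_simps flip: a_def)
    have "branch \<mu>1 w = \<mu>2 \<longleftrightarrow> 24 * (w * a - 1) - 24 * a * (w + \<mu>1) = \<mu>2 * (w * a - 1) * (w + \<mu>1)"
      unfolding branch_def g using a False by (simp add: diff_frac_eq divide_eq_eq mult_ac)
    also have "\<dots> \<longleftrightarrow> sym_det \<mu>1 \<mu>2 w = 0"
      unfolding sym_det_def by (simp add: a_def[symmetric] algebra_simps) (auto simp: field_simps)
    finally show ?thesis using False assms by (simp add: roots_def)
  qed
qed

text \<open>Because \<open>res_mean\<close> is odd, reflection at the middle of the band is absorbed
  by reversing the signs of both couplings.\<close>

lemma sym_det_uminus: "sym_det \<mu>1 \<mu>2 (- w) = sym_det (- \<mu>1) (- \<mu>2) w"
  by (simp add: sym_det_def res_mean_uminus algebra_simps)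

lemma A_plus_iff: "(\<mu>1, \<mu>2) \<in> A_plus \<zeta> \<longleftrightarrow> (- \<mu>1, - \<mu>2) \<in> A_minus \<zeta>"
proof -
  have "mu2_minus (- \<mu>1) = - mu2_plus \<mu>1"
    using minus_divide_right[of 24 "\<mu>1 - 12"] by (simp add: mu2_minus_def mu2_plus_def)
  then show ?thesis unfolding A_plus_def A_minus_def by auto
qed

lemma eigs_below_eq: "eigs_below \<mu>1 \<mu>2 = (\<lambda>w. 12 - w) ` roots \<mu>1 \<mu>2"
proof -
  have "z \<in> eigs_below \<mu>1 \<mu>2 \<longleftrightarrow> 12 - z \<in> roots \<mu>1 \<mu>2" for z
  proof -
    have "z \<in> eigs_below \<mu>1 \<mu>2 \<longleftrightarrow> is_eigenvalue (H_op \<mu>1 \<mu>2) L2es (of_real z) \<and> z < 0"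
      unfolding eigs_below_def essential_spectrum_eq by (auto simp: image_iff intro: less_le_trans)
    also have "\<dots> \<longleftrightarrow> 12 - z \<in> roots \<mu>1 \<mu>2"
    proof (cases "z < 0")
      case True
      then show ?thesis
        using is_eigenvalue_L2es_iff[of "12 - z" \<mu>1 \<mu>2] sym_det_zero_iff_roots[of "12 - z" \<mu>1 \<mu>2] by simp
    qed (simp add: roots_def)
    finally show ?thesis .
  qed
  note key = this
  show ?thesis
  proof (intro set_eqI iffI)
    fix z assume "z \<in> eigs_below \<mu>1 \<mu>2"
    then show "z \<in> (\<lambda>w. 12 - w) ` roots \<mu>1 \<mu>2"
      unfolding key by (intro image_eqI[of _ _ "12 - z"]) auto
  next
    fix z assume "z \<in> (\<lambda>w. 12 - w) ` roots \<mu>1 \<mu>2"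
    then show "z \<in> eigs_below \<mu>1 \<mu>2" unfolding key by auto
  qed
qed

lemma eigs_above_eq: "eigs_above \<mu>1 \<mu>2 = (\<lambda>w. 12 + w) ` roots (- \<mu>1) (- \<mu>2)"
proof -
  have "z \<in> eigs_above \<mu>1 \<mu>2 \<longleftrightarrow> z - 12 \<in> roots (- \<mu>1) (- \<mu>2)" for z
  proof -
    have "z \<in> eigs_above \<mu>1 \<mu>2 \<longleftrightarrow> is_eigenvalue (H_op \<mu>1 \<mu>2) L2es (of_real z) \<and> 24 < z"
      unfolding eigs_above_def essential_spectrum_eq by (auto simp: image_iff intro: le_less_trans)
    also have "\<dots> \<longleftrightarrow> z - 12 \<in> roots (- \<mu>1) (- \<mu>2)"
    proof (cases "24 < z")
      case True
      then show ?thesis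
        using is_eigenvalue_L2es_iff[of "12 - z" \<mu>1 \<mu>2] sym_det_uminus[of \<mu>1 \<mu>2 "z - 12"]
          sym_det_zero_iff_roots[of "z - 12" "- \<mu>1" "- \<mu>2"] by simp
    qed (simp add: roots_def)
    finally show ?thesis .
  qed
  note key = this
  show ?thesis
  proof (intro set_eqI iffI)
    fix z assume "z \<in> eigs_above \<mu>1 \<mu>2"
    then show "z \<in> (\<lambda>w. 12 + w) ` roots (- \<mu>1) (- \<mu>2)"
      unfolding key by (intro image_eqI[of _ _ "z - 12"]) auto
  next
    fix z assume "z \<in> (\<lambda>w. 12 + w) ` roots (- \<mu>1) (- \<mu>2)"
    then show "z \<in> eigs_above \<mu>1 \<mu>2" unfolding key by auto
  qed
qed

lemma eigs_below_det: "z \<in> eigs_below \<mu>1 \<mu>2 \<Longrightarrow> 12 < 12 - z \<and> sym_det \<mu>1 \<mu>2 (12 - z) = 0"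
  unfolding eigs_below_eq using sym_det_zero_iff_roots by (auto simp: roots_def)

lemma eigs_above_det: "z \<in> eigs_above \<mu>1 \<mu>2 \<Longrightarrow> 12 - z < - 12 \<and> sym_det \<mu>1 \<mu>2 (12 - z) = 0"
  unfolding eigs_above_eq using sym_det_zero_iff_roots sym_det_uminus by (auto simp: roots_def)

lemma multiplicity_sum:
  assumes "\<And>z. z \<in> Z \<Longrightarrow> (12 < 12 - z \<or> 12 - z < - 12) \<and> sym_det \<mu>1 \<mu>2 (12 - z) = 0"
  shows "(\<Sum>z\<in>Z. multiplicity_of (H_op \<mu>1 \<mu>2) L2es (complex_of_real z)) = enat (card Z)"
proof -
  have "multiplicity_of (H_op \<mu>1 \<mu>2) L2es (complex_of_real z) = 1" if "z \<in> Z" for z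
    using multiplicity_L2es[of "12 - z" \<mu>1 \<mu>2] assms[OF that] by simp
  then show ?thesis by (simp add: of_nat_eq_enat)
qed

theorem theorem4p3:
  fixes \<zeta> :: nat and \<mu>1 \<mu>2 :: real
  assumes "\<zeta> \<in> {0, 1, 2}"
  shows "((\<mu>1, \<mu>2) \<in> A_minus \<zeta> \<longrightarrow>
      essential_spectrum (H_op \<mu>1 \<mu>2) L2e = complex_of_real ` {0..24} \<and>
      finite (eigs_below \<mu>1 \<mu>2) \<and>
      (\<Sum>z\<in>eigs_below \<mu>1 \<mu>2. multiplicity_of (H_op \<mu>1 \<mu>2) L2es (complex_of_real z)) = enat \<zeta> \<and>
      (\<forall>z\<in>eigs_below \<mu>1 \<mu>2.
        (\<mu>2 \<noteq> 0 \<longrightarrow> (\<exists>C. C \<noteq> 0 \<and> L2_norm (f_s C \<mu>1 \<mu>2 z) = 1 \<and>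
          is_eigenfunction (H_op \<mu>1 \<mu>2) L2es (complex_of_real z) (f_s C \<mu>1 \<mu>2 z))) \<and>
        (\<mu>2 = 0 \<longrightarrow> (\<exists>C. C \<noteq> 0 \<and>
          L2_norm (\<lambda>p. C * complex_of_real (alpha_s 1 p / (E0 p - z))) = 1 \<and>
          is_eigenfunction (H_op \<mu>1 \<mu>2) L2es (complex_of_real z)
            (\<lambda>p. C * complex_of_real (alpha_s 1 p / (E0 p - z)))))))
    \<and>
    ((\<mu>1, \<mu>2) \<in> A_plus \<zeta> \<longrightarrow>
      essential_spectrum (H_op \<mu>1 \<mu>2) L2e = complex_of_real ` {0..24} \<and>
      finite (eigs_above \<mu>1 \<mu>2) \<and>
      (\<Sum>z\<in>eigs_above \<mu>1 \<mu>2. multiplicity_of (H_op \<mu>1 \<mu>2) L2es (complex_of_real z)) = enat \<zeta> \<and>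
      (\<forall>z\<in>eigs_above \<mu>1 \<mu>2.
        (\<mu>2 \<noteq> 0 \<longrightarrow> (\<exists>C. C \<noteq> 0 \<and> L2_norm (f_s C \<mu>1 \<mu>2 z) = 1 \<and>
          is_eigenfunction (H_op \<mu>1 \<mu>2) L2es (complex_of_real z) (f_s C \<mu>1 \<mu>2 z))) \<and>
        (\<mu>2 = 0 \<longrightarrow> (\<exists>C. C \<noteq> 0 \<and>
          L2_norm (\<lambda>p. C * complex_of_real (alpha_s 1 p / (E0 p - z))) = 1 \<and>
          is_eigenfunction (H_op \<mu>1 \<mu>2) L2es (complex_of_real z)
            (\<lambda>p. C * complex_of_real (alpha_s 1 p / (E0 p - z)))))))"
proof (intro conjI impI ballI)
  assume A: "(\<mu>1, \<mu>2) \<in> A_minus \<zeta>"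
  have roots: "finite (roots \<mu>1 \<mu>2)" "card (roots \<mu>1 \<mu>2) = \<zeta>" using card_roots[OF A] by auto
  show "essential_spectrum (H_op \<mu>1 \<mu>2) L2e = complex_of_real ` {0..24}"
    by (rule essential_spectrum_eq)
  show "finite (eigs_below \<mu>1 \<mu>2)" unfolding eigs_below_eq using roots by simp
  \<comment> \<open>The map from roots to eigenvalues is injective and each eigenvalue is simple, so
    the multiplicities add up to the number of roots.\<close>
  have "card (eigs_below \<mu>1 \<mu>2) = \<zeta>"
    unfolding eigs_below_eq using roots by (subst card_image) (auto simp: inj_on_def)
  then show "(\<Sum>z\<in>eigs_below \<mu>1 \<mu>2. multiplicity_of (H_op \<mu>1 \<mu>2) L2es (complex_of_real z)) = enat \<zeta>"
    using multiplicity_sum[of "eigs_below \<mu>1 \<mu>2" \<mu>1 \<mu>2] eigs_below_det by blast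
  fix z assume "z \<in> eigs_below \<mu>1 \<mu>2"
  then have w: "12 < 12 - z \<or> 12 - z < - 12" and det: "sym_det \<mu>1 \<mu>2 (12 - z) = 0"
    using eigs_below_det by blast+
  show "\<exists>C. C \<noteq> 0 \<and> L2_norm (f_s C \<mu>1 \<mu>2 z) = 1 \<and>
    is_eigenfunction (H_op \<mu>1 \<mu>2) L2es (complex_of_real z) (f_s C \<mu>1 \<mu>2 z)" if "\<mu>2 \<noteq> 0"
    using f_s_normalized[OF w det that] by simp
  show "\<exists>C. C \<noteq> 0 \<and> L2_norm (\<lambda>p. C * complex_of_real (alpha_s 1 p / (E0 p - z))) = 1 \<and>
    is_eigenfunction (H_op \<mu>1 \<mu>2) L2es (complex_of_real z)
      (\<lambda>p. C * complex_of_real (alpha_s 1 p / (E0 p - z)))" if "\<mu>2 = 0"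
    using alpha_1_normalized[OF w det that] by simp
next
  assume A: "(\<mu>1, \<mu>2) \<in> A_plus \<zeta>"
  \<comment> \<open>Reflection reduces the count above the band to the count below it for the
    opposite couplings.\<close>
  have roots: "finite (roots (- \<mu>1) (- \<mu>2))" "card (roots (- \<mu>1) (- \<mu>2)) = \<zeta>"
    using card_roots A unfolding A_plus_iff by blast+
  show "essential_spectrum (H_op \<mu>1 \<mu>2) L2e = complex_of_real ` {0..24}"
    by (rule essential_spectrum_eq)
  show "finite (eigs_above \<mu>1 \<mu>2)" unfolding eigs_above_eq using roots by simp
  have "card (eigs_above \<mu>1 \<mu>2) = \<zeta>"
    unfolding eigs_above_eq using roots by (subst card_image) (auto simp: inj_on_def)
  then show "(\<Sum>z\<in>eigs_above \<mu>1 \<mu>2. multiplicity_of (H_op \<mu>1 \<mu>2) L2es (complex_of_real z)) = enat \<zeta>"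
    using multiplicity_sum[of "eigs_above \<mu>1 \<mu>2" \<mu>1 \<mu>2] eigs_above_det by blast
  fix z assume "z \<in> eigs_above \<mu>1 \<mu>2"
  then have w: "12 < 12 - z \<or> 12 - z < - 12" and det: "sym_det \<mu>1 \<mu>2 (12 - z) = 0"
    using eigs_above_det by blast+
  show "\<exists>C. C \<noteq> 0 \<and> L2_norm (f_s C \<mu>1 \<mu>2 z) = 1 \<and>
    is_eigenfunction (H_op \<mu>1 \<mu>2) L2es (complex_of_real z) (f_s C \<mu>1 \<mu>2 z)" if "\<mu>2 \<noteq> 0"
    using f_s_normalized[OF w det that] by simp
  show "\<exists>C. C \<noteq> 0 \<and> L2_norm (\<lambda>p. C * complex_of_real (alpha_s 1 p / (E0 p - z))) = 1 \<and>
    is_eigenfunction (H_op \<mu>1 \<mu>2) L2es (complex_of_real z)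
      (\<lambda>p. C * complex_of_real (alpha_s 1 p / (E0 p - z)))" if "\<mu>2 = 0"
    using alpha_1_normalized[OF w det that] by simp
qed

end
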